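(* Consider the setting, the AGP-UCB algorithm (with feedback at every step) and the quantities $\gamma_T$, $R_T$, $\varphi_n$ defined in the context. Assume: (i) for every $t$, the function $-V(\cdot;t)$ is convex and $L$-strongly smooth over $D$, uniformly in $t$, i.e. $-V(x;t)+V(y;t)\le -\nabla V(y;t)^{\top}(x-y)+\frac L2\|x-y\|_2^2$ for all $x,y\in D$; (ii) $D\subseteq[0,r]^d$ is compact and convex, $d\in\mathbb N$, $r>0$, and there are constants $a,b>0$ such that the sample paths $U$ of $\mathrm{GP}(0,k)$ satisfy $\Pr\{\sup_{x\in D}|\partial U/\partial x_j|>M\}\le a\,e^{-(M/b)^2}$ for all $M>0$ and $j=1,\dots,d$; (iii) there is $\Delta<\infty$ such that $\Delta_n:=\max_{x\in D}|V(x;t_n)-V(x;t_{n-1})|\le\Delta$ for all $n$; (iv) the approximate optimizers produced by the algorithm satisfy, for a constant $\eta<1$ and every $n$, $\varphi_n^*-\varphi_n(x_n)\le\eta\,(\varphi_n^*-\varphi_n(x_{n-1}))$, where $\varphi_n^*=\max_{x\in D}\varphi_n(x)$; (v) the kernel $k$ is not degenerate, and the mean and variance are well-behaved, so that they can be represented by generalized Fourier series in the kernel (eigenfunction) basis. Pick $\delta\in(0,1)$, run AGP-UCB with $\beta_n=2\log(2n^2\pi^2/(3\delta))+2d\log\big(d\,n^2\,b\,r\sqrt{\log(4da/\delta)}\big)$, $n\ge1$, and let $G_T:=2\sum_{n=1}^T\sum_{z=1}^{n-1}\eta^z\Delta_{n-z+1}$. If $\Delta_n\to0$ as $n\to\infty$,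 then $G_T$ can be upper bounded by a function sublinear in $T$, and a no-regret result holds: with probability at least $1-\delta$, $R_T$ is bounded by a function that is $o(T)$. Furthermore, if $\Delta_n$ decays at least as fast as $O(1/\sqrt n)$, then the resulting bound on $R_T$ is, in the $O^*$ sense, the same as in the static (time-invariant, exactly optimized) case, namely $R_T=O^*(\sqrt{dT\gamma_T})$ with probability at least $1-\delta$.
   Context: Setting. $V(x;t)$ is a known deterministic time-varying function and $U(x)$ is an unknown time-invariant function, $x\in D\subset\mathbb R^d$; $f(x;t)=V(x;t)+U(x)$ is to be maximized over $D$ at sampling times $t_1,t_2,\dots$ (with constant sampling period). $U$ is a sample path of a Gaussian process $\mathrm{GP}(0,k)$ with kernel $k$, $k(x,x)\le1$ on $D$. Feedback and posterior. Feedback at a point $x_i\in D$ is $y_i=U(x_i)+\varepsilon_i$, with $\varepsilon_i\sim N(0,\sigma^2)$ i.i.d. Given $x_1,\dots,x_n$ and $\mathbf y_n=(y_1,\dots,y_n)^\top$, let $\mathbf k_n(x)=(k(x_1,x),\dots,k(x_n,x))^\top$, $K_n=[k(x_i,x_j)]_{i,j\le n}$, and $\mu_n(x)=\mathbf k_n(x)^\top(K_n+\sigma^2I_n)^{-1}\mathbf y_n$, $k_n(x,x')=k(x,x')-\mathbf k_n(x)^\top(K_n+\sigma^2I_n)^{-1}\mathbf k_n(x')$, $\sigma_n^2(x)=k_n(x,x)$; $\mu_0\equiv0$, $\sigma_0^2(x)=k(x,x)$. AGP-UCB algorithm (feedback received at every time step, so the time index $k$ and the data index $n$ coincide). Start from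 $x_0\in D$. At each time $t_n$, $n\ge1$: (S1) set $\hat U_n(x)=\mu_{n-1}(x)+\sqrt{\beta_n}\,\sigma_{n-1}(x)$; (S2) with $\varphi_n(x):=V(x;t_n)+\hat U_n(x)$, compute an approximate maximizer $x_n\in D$ of $\varphi_n$ over $D$ by running finitely many steps of a given optimization scheme $\mathcal M$ on $\varphi_n$ started at $x_{n-1}$; (S3) collect $y_n=U(x_n)+\varepsilon_n$ and update the posterior to $\mu_n,\sigma_n$. Information gain: $\gamma_T:=\max_{A\subset D,|A|=T}\frac12\log|I+\sigma^{-2}K_A|$, $K_A=[k(x,x')]_{x,x'\in A}$, where $|\cdot|$ of a matrix is the determinant. Regret: $R_T:=\sum_{n=1}^T\big(f_n^*-f(x_n;t_n)\big)$, $f_n^*=\max_{x\in D}f(x;t_n)$. Notation: $O^*$ is a big-$O$ (in $T$) up to polylogarithmic factors. The kernel (eigenfunction) basis consists of the eigenfunctions $\phi_i$ of the kernel $k$, with eigenvalues $\lambda_i$; non-degenerate means that there are not just finitely many nonzero eigenvalues. *)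

theory Defs
  imports
    "HOL-Probability.Probability"
    "HOL-Library.Landau_Symbols"
    "Jordan_Normal_Form.Determinant"
    "Jordan_Normal_Form.Gauss_Jordan_Elimination"
begin

text \<open>The names and infix symbols of matrices and vectors of run-time dimension collide with those
  of HOL-Analysis. The former are used here with qualified or prefix names only, so that
  \<open>x $ j\<close> and \<open>x \<bullet> y\<close> always belong to \<open>real ^ 'd\<close>.\<close>

no_notation vec_index (infixl "$" 100)
no_notation scalar_prod (infix "\<bullet>" 70)


subsection \<open>Gaussian processes\<close>

text \<open>Normal law with mean \<open>m\<close> and variance \<open>v\<close>; variance \<open>0\<close> means almost surely constant.\<close>

definition normal_rv :: "'w measure \<Rightarrow> real \<Rightarrow> real \<Rightarrow> ('w \<Rightarrow> real) \<Rightarrow> bool" where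
  "normal_rv M m v X \<longleftrightarrow> X \<in> borel_measurable M \<and> 0 \<le> v \<and>
     (if v = 0 then (AE \<omega> in M. X \<omega> = m)
      else distributed M lborel X (\<lambda>x. ennreal (normal_density m (sqrt v) x)))"

text \<open>Joint normality of the finite-dimensional marginals is expressed through their linear
  combinations. Symmetry of \<open>k\<close> has to be required separately because the variances of the
  linear combinations only determine \<open>k x y + k y x\<close>.\<close>

definition gaussian_process ::
  "'w measure \<Rightarrow> 'a set \<Rightarrow> ('a \<Rightarrow> real) \<Rightarrow> ('a \<Rightarrow> 'a \<Rightarrow> real) \<Rightarrow> ('w \<Rightarrow> 'a \<Rightarrow> real) \<Rightarrow> bool" where
  "gaussian_process M D m k U \<longleftrightarrow>
     (\<forall>x\<in>D. \<forall>y\<in>D. k x y = k y x) \<and>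
     (\<forall>S c. finite S \<and> S \<subseteq> D \<longrightarrow>
        normal_rv M (\<Sum>x\<in>S. c x * m x) (\<Sum>x\<in>S. \<Sum>y\<in>S. c x * c y * k x y)
          (\<lambda>\<omega>. \<Sum>x\<in>S. c x * U \<omega> x))"


subsection \<open>Posterior and information gain\<close>

text \<open>The lists \<open>xs\<close>, \<open>ys\<close> hold the sample points and the corresponding observations.\<close>

definition gram :: "('a \<Rightarrow> 'a \<Rightarrow> real) \<Rightarrow> 'a list \<Rightarrow> real mat" where
  "gram k xs = Matrix.mat (length xs) (length xs) (\<lambda>(i, j). k (xs ! i) (xs ! j))"

definition kvec :: "('a \<Rightarrow> 'a \<Rightarrow> real) \<Rightarrow> 'a list \<Rightarrow> 'a \<Rightarrow> real Matrix.vec" where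
  "kvec k xs z = Matrix.vec (length xs) (\<lambda>i. k (xs ! i) z)"

definition reg_inverse :: "('a \<Rightarrow> 'a \<Rightarrow> real) \<Rightarrow> real \<Rightarrow> 'a list \<Rightarrow> real mat" where
  "reg_inverse k \<sigma> xs = the (mat_inverse (gram k xs + \<sigma>\<^sup>2 \<cdot>\<^sub>m 1\<^sub>m (length xs)))"

definition post_mean ::
  "('a \<Rightarrow> 'a \<Rightarrow> real) \<Rightarrow> real \<Rightarrow> 'a list \<Rightarrow> real list \<Rightarrow> 'a \<Rightarrow> real" where
  "post_mean k \<sigma> xs ys z =
     scalar_prod (kvec k xs z) (reg_inverse k \<sigma> xs *\<^sub>v vec_of_list ys)"

definition post_cov :: "('a \<Rightarrow> 'a \<Rightarrow> real) \<Rightarrow> real \<Rightarrow> 'a list \<Rightarrow> 'a \<Rightarrow> 'a \<Rightarrow> real" where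
  "post_cov k \<sigma> xs z z' =
     k z z' - scalar_prod (kvec k xs z) (reg_inverse k \<sigma> xs *\<^sub>v kvec k xs z')"

definition post_var :: "('a \<Rightarrow> 'a \<Rightarrow> real) \<Rightarrow> real \<Rightarrow> 'a list \<Rightarrow> 'a \<Rightarrow> real" where
  "post_var k \<sigma> xs z = post_cov k \<sigma> xs z z"

text \<open>A set \<open>A \<subseteq> D\<close> with \<open>T\<close> elements is given by an enumeration without repetitions; the
  determinant does not depend on the enumeration. The maximum over \<open>A\<close> is read as a supremum.\<close>

definition info_gain :: "('a \<Rightarrow> 'a \<Rightarrow> real) \<Rightarrow> real \<Rightarrow> 'a set \<Rightarrow> nat \<Rightarrow> real" where
  "info_gain k \<sigma> D T =
     (SUP xs\<in>{xs. distinct xs \<and> set xs \<subseteq> D \<and> length xs = T}.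
        1 / 2 * ln (Determinant.det (1\<^sub>m T + (1 / \<sigma>\<^sup>2) \<cdot>\<^sub>m gram k xs)))"


subsection \<open>The kernel eigenfunction basis\<close>

definition square_integrable :: "'a measure \<Rightarrow> ('a \<Rightarrow> real) \<Rightarrow> bool" where
  "square_integrable \<nu> f \<longleftrightarrow> f \<in> borel_measurable \<nu> \<and> integrable \<nu> (\<lambda>x. (f x)\<^sup>2)"

text \<open>\<open>e\<close> is an orthonormal system in \<open>L\<^sup>2(\<nu>)\<close> of eigenfunctions of the integral operator with
  kernel \<open>k\<close>, with eigenvalues \<open>l\<close>, to which no eigenfunction for a nonzero eigenvalue can be
  added. Eigenfunctions for the eigenvalue \<open>0\<close> may or may not be among the \<open>e i\<close>.\<close>

definition kernel_eigenbasis ::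
  "'a measure \<Rightarrow> ('a \<Rightarrow> 'a \<Rightarrow> real) \<Rightarrow> (nat \<Rightarrow> 'a \<Rightarrow> real) \<Rightarrow> (nat \<Rightarrow> real) \<Rightarrow> bool" where
  "kernel_eigenbasis \<nu> k e l \<longleftrightarrow>
     (\<forall>i. square_integrable \<nu> (e i)) \<and>
     (\<forall>i j. (\<integral>x. e i x * e j x \<partial>\<nu>) = (if i = j then 1 else 0)) \<and>
     (\<forall>i. \<forall>x\<in>space \<nu>. (\<integral>y. k x y * e i y \<partial>\<nu>) = l i * e i x) \<and>
     (\<forall>g c. square_integrable \<nu> g \<and> c \<noteq> 0 \<and>
        (\<forall>x\<in>space \<nu>. (\<integral>y. k x y * g y \<partial>\<nu>) = c * g x) \<and>
        (\<forall>i. (\<integral>x. g x * e i x \<partial>\<nu>) = 0) \<longrightarrow> (AE x in \<nu>. g x = 0))"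

definition nondegenerate_spectrum :: "(nat \<Rightarrow> real) \<Rightarrow> bool" where
  "nondegenerate_spectrum l \<longleftrightarrow> infinite {i. l i \<noteq> 0}"

definition fourier_representable ::
  "'a measure \<Rightarrow> (nat \<Rightarrow> 'a \<Rightarrow> real) \<Rightarrow> ('a \<Rightarrow> real) \<Rightarrow> bool" where
  "fourier_representable \<nu> e f \<longleftrightarrow> square_integrable \<nu> f \<and>
     (\<lambda>N. \<integral>x. (f x - (\<Sum>i<N. (\<integral>y. f y * e i y \<partial>\<nu>) * e i x))\<^sup>2 \<partial>\<nu>) \<longlonglongrightarrow> 0"


subsection \<open>Gradients and smoothness\<close>

text \<open>The derivative is taken within \<open>D\<close>, so that no values outside \<open>D\<close> are involved.\<close>

definition gradient_on :: "('a::real_inner) set \<Rightarrow> ('a \<Rightarrow> real) \<Rightarrow> ('a \<Rightarrow> 'a) \<Rightarrow> bool" where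
  "gradient_on D F g \<longleftrightarrow> (\<forall>x\<in>D. (F has_derivative (\<lambda>h. inner (g x) h)) (at x within D))"

definition strongly_smooth_on ::
  "real \<Rightarrow> ('a::real_inner) set \<Rightarrow> ('a \<Rightarrow> real) \<Rightarrow> ('a \<Rightarrow> 'a) \<Rightarrow> bool" where
  "strongly_smooth_on L D F g \<longleftrightarrow> gradient_on D F g \<and>
     (\<forall>x\<in>D. \<forall>y\<in>D. F x - F y \<le> inner (g y) (x - y) + L / 2 * (norm (x - y))\<^sup>2)"


subsection \<open>The algorithm\<close>

definition beta :: "nat \<Rightarrow> real \<Rightarrow> real \<Rightarrow> real \<Rightarrow> real \<Rightarrow> nat \<Rightarrow> real" where
  "beta d a b r \<delta> n =
     2 * ln (2 * (real n)\<^sup>2 * pi\<^sup>2 / (3 * \<delta>)) +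
     2 * real d * ln (real d * (real n)\<^sup>2 * b * r * sqrt (ln (4 * real d * a / \<delta>)))"

definition feedback ::
  "('w \<Rightarrow> 'a \<Rightarrow> real) \<Rightarrow> (nat \<Rightarrow> 'w \<Rightarrow> real) \<Rightarrow> (nat \<Rightarrow> 'w \<Rightarrow> 'a) \<Rightarrow> nat \<Rightarrow> 'w \<Rightarrow> real" where
  "feedback U \<epsilon> X i \<omega> = U \<omega> (X i \<omega>) + \<epsilon> i \<omega>"

text \<open>The entries \<open>f 1, \<dots>, f n\<close> of a sequence (index \<open>0\<close> is not data).\<close>

definition data_upto :: "(nat \<Rightarrow> 'b) \<Rightarrow> nat \<Rightarrow> 'b list" where
  "data_upto f n = map f [1..<Suc n]"

definition posterior_mean ::
  "('a \<Rightarrow> 'a \<Rightarrow> real) \<Rightarrow> real \<Rightarrow> ('w \<Rightarrow> 'a \<Rightarrow> real) \<Rightarrow> (nat \<Rightarrow> 'w \<Rightarrow> real) \<Rightarrow>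
   (nat \<Rightarrow> 'w \<Rightarrow> 'a) \<Rightarrow> nat \<Rightarrow> 'w \<Rightarrow> 'a \<Rightarrow> real" where
  "posterior_mean k \<sigma> U \<epsilon> X n \<omega> =
     post_mean k \<sigma> (data_upto (\<lambda>i. X i \<omega>) n) (data_upto (\<lambda>i. feedback U \<epsilon> X i \<omega>) n)"

definition posterior_var ::
  "('a \<Rightarrow> 'a \<Rightarrow> real) \<Rightarrow> real \<Rightarrow> (nat \<Rightarrow> 'w \<Rightarrow> 'a) \<Rightarrow> nat \<Rightarrow> 'w \<Rightarrow> 'a \<Rightarrow> real" where
  "posterior_var k \<sigma> X n \<omega> = post_var k \<sigma> (data_upto (\<lambda>i. X i \<omega>) n)"

definition ucb ::
  "('a \<Rightarrow> 'a \<Rightarrow> real) \<Rightarrow> real \<Rightarrow> (nat \<Rightarrow> real) \<Rightarrow> ('w \<Rightarrow> 'a \<Rightarrow> real) \<Rightarrow> (nat \<Rightarrow> 'w \<Rightarrow> real) \<Rightarrow>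
   (nat \<Rightarrow> 'w \<Rightarrow> 'a) \<Rightarrow> nat \<Rightarrow> 'w \<Rightarrow> 'a \<Rightarrow> real" where
  "ucb k \<sigma> \<beta> U \<epsilon> X n \<omega> z =
     posterior_mean k \<sigma> U \<epsilon> X (n - 1) \<omega> z + sqrt (\<beta> n) * sqrt (posterior_var k \<sigma> X (n - 1) \<omega> z)"

definition acq ::
  "('a \<Rightarrow> real \<Rightarrow> real) \<Rightarrow> (nat \<Rightarrow> real) \<Rightarrow> ('a \<Rightarrow> 'a \<Rightarrow> real) \<Rightarrow> real \<Rightarrow> (nat \<Rightarrow> real) \<Rightarrow>
   ('w \<Rightarrow> 'a \<Rightarrow> real) \<Rightarrow> (nat \<Rightarrow> 'w \<Rightarrow> real) \<Rightarrow> (nat \<Rightarrow> 'w \<Rightarrow> 'a) \<Rightarrow> nat \<Rightarrow> 'w \<Rightarrow> 'a \<Rightarrow> real" where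
  "acq V t k \<sigma> \<beta> U \<epsilon> X n \<omega> z = V z (t n) + ucb k \<sigma> \<beta> U \<epsilon> X n \<omega> z"

text \<open>An optimization scheme maps an objective, a starting point and a number \<open>m\<close> of steps to the
  \<open>m\<close>-th iterate. Nothing else is assumed of it, so step sizes and internal state are allowed.\<close>

definition optimization_scheme :: "(('a \<Rightarrow> real) \<Rightarrow> 'a \<Rightarrow> nat \<Rightarrow> 'a) \<Rightarrow> bool" where
  "optimization_scheme \<A> \<longleftrightarrow> (\<forall>\<phi> x. \<A> \<phi> x 0 = x)"

text \<open>The sigma-algebra generated by the observations \<open>Y 1, \<dots>, Y (n - 1)\<close>.\<close>

definition history :: "'w measure \<Rightarrow> (nat \<Rightarrow> 'w \<Rightarrow> real) \<Rightarrow> nat \<Rightarrow> 'w measure" where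
  "history M Y n = vimage_algebra (space M) (\<lambda>\<omega>. \<lambda>i\<in>{1..<n}. Y i \<omega>) (\<Pi>\<^sub>M i\<in>{1..<n}. borel)"

text \<open>\<open>X\<close> is a run of the algorithm. Since the acquisition function at time \<open>n\<close> is determined by
  \<open>Y 1, \<dots>, Y (n - 1)\<close>, so is \<open>X n\<close>; the measurability condition makes this precise.\<close>

definition agp_ucb ::
  "'w measure \<Rightarrow> ('a::topological_space) set \<Rightarrow> ('a \<Rightarrow> real \<Rightarrow> real) \<Rightarrow> (nat \<Rightarrow> real) \<Rightarrow>
   ('a \<Rightarrow> 'a \<Rightarrow> real) \<Rightarrow> real \<Rightarrow> (nat \<Rightarrow> real) \<Rightarrow> (('a \<Rightarrow> real) \<Rightarrow> 'a \<Rightarrow> nat \<Rightarrow> 'a) \<Rightarrow> 'a \<Rightarrow>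
   ('w \<Rightarrow> 'a \<Rightarrow> real) \<Rightarrow> (nat \<Rightarrow> 'w \<Rightarrow> real) \<Rightarrow> (nat \<Rightarrow> 'w \<Rightarrow> 'a) \<Rightarrow> bool" where
  "agp_ucb M D V t k \<sigma> \<beta> \<A> x0 U \<epsilon> X \<longleftrightarrow>
     x0 \<in> D \<and> (\<forall>\<omega>\<in>space M. X 0 \<omega> = x0) \<and>
     (\<forall>n\<ge>1. X n \<in> measurable (history M (feedback U \<epsilon> X) n) borel \<and>
        (\<forall>\<omega>\<in>space M. X n \<omega> \<in> D \<and>
           (\<exists>m. X n \<omega> = \<A> (acq V t k \<sigma> \<beta> U \<epsilon> X n \<omega>) (X (n - 1) \<omega>) m)))"


subsection \<open>Regret and growth rates\<close>

definition variation :: "'a set \<Rightarrow> ('a \<Rightarrow> real \<Rightarrow> real) \<Rightarrow> (nat \<Rightarrow> real) \<Rightarrow> nat \<Rightarrow> real" where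
  "variation D V t n = (SUP x\<in>D. \<bar>V x (t n) - V x (t (n - 1))\<bar>)"

definition regret ::
  "'a set \<Rightarrow> ('a \<Rightarrow> real \<Rightarrow> real) \<Rightarrow> (nat \<Rightarrow> real) \<Rightarrow> ('w \<Rightarrow> 'a \<Rightarrow> real) \<Rightarrow> (nat \<Rightarrow> 'w \<Rightarrow> 'a) \<Rightarrow>
   nat \<Rightarrow> 'w \<Rightarrow> real" where
  "regret D V t U X T \<omega> =
     (\<Sum>n=1..T. (SUP x\<in>D. V x (t n) + U \<omega> x) - (V (X n \<omega>) (t n) + U \<omega> (X n \<omega>)))"

definition tracking_term :: "real \<Rightarrow> (nat \<Rightarrow> real) \<Rightarrow> nat \<Rightarrow> real" where
  "tracking_term \<eta> \<Delta>s T = 2 * (\<Sum>n=1..T. \<Sum>z=1..n-1. \<eta> ^ z * \<Delta>s (n - z + 1))"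

definition bigo_polylog :: "(nat \<Rightarrow> real) \<Rightarrow> (nat \<Rightarrow> real) set" where
  "bigo_polylog g = (\<Union>p::nat. O(\<lambda>T. g T * ln (real T) ^ p))"

end

theory Submission
  imports Defs "HOL-Real_Asymp.Real_Asymp"
begin

text \<open>The bound \<open>B\<close> is deterministic, but it may depend on the whole probability
  space. So it is enough to show that almost surely, for some random finite constant \<open>C\<close>,
  the regret satisfies \<open>R\<^sub>T \<le> C * b T\<close> for all \<open>T \<ge> 1\<close>, where
  \<open>b T = sqrt (ln (T + 2)) * sqrt (T * \<gamma>\<^sub>T) + sqrt T + (\<Delta>\<^sub>2 + \<dots> + \<Delta>\<^sub>T)\<close>.
  The events that the constant is at most \<open>m\<close> increase to an event of probability one, so
  some deterministic constant serves with probability at least \<open>1 - \<delta>\<close>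
  (\<open>AE_random_constant\<close>).

  Confidence. Each sampled point is a function of the earlier observations. Given the unknown
  function, the observations are therefore obtained from the noise by a triangular system of
  translations (\<open>nn_integral_traj\<close>), and their density is the likelihood. Exchanging the
  integrals over the function and the observations reduces an adaptive design to fixed ones
  (\<open>adaptive_tail\<close>). For a fixed design, multiplying a Gaussian process by one Gaussian
  likelihood factor gives again a Gaussian process, whose mean and covariance are the posterior ones
  (\<open>weighted_gp_observe\<close>). So the unknown function deviates from the posterior mean by
  more than \<open>sqrt \<beta>\<^sub>n\<close> posterior standard deviations with probability at most
  \<open>2 * exp (- \<beta>\<^sub>n / 2)\<close>, which is of order
  \<open>1 / n ^ (2 + 2 * d)\<close>. By Borel-Cantelli, almost surely from some time on, the
  confidence bounds hold on nets of about \<open>n ^ (2 * d)\<close> points, and by Lipschitz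
  continuity they hold everywhere up to \<open>O(1 / sqrt n)\<close>.

  Tracking. The gap of \<open>x\<^sub>n\<close> for the acquisition function contracts by the factor
  \<open>\<eta>\<close> in each step, up to the change of the acquisition function. The last
  observation changes the posterior mean uniformly by at most a multiple of the confidence width at
  the last sampled point (\<open>post_mean_step_le\<close>). So gaps, and hence regrets,
  sum up to the total drift of the known part plus a multiple of the sum of the confidence widths at
  the sampled points (\<open>regret_le\<close>). By Cauchy-Schwarz and the chain rule for information,
  the latter is of the order \<open>sqrt (ln T) * sqrt (T * \<gamma>\<^sub>T)\<close>.

  Rates. The bound on the gradients makes the kernel Lipschitz (\<open>kdist_le\<close>). If a sample
  has large posterior variance, it lowers the posterior variance at the nearest point of a net by a
  fixed amount (\<open>sum_post_var_le\<close>); this gives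
  \<open>\<gamma>\<^sub>T \<le> c * (T / q\<^sup>2 + (q + 1) ^ (d + 4))\<close> for every
  \<open>q\<close>, hence \<open>b T = o(T)\<close> when
  \<open>\<Delta>\<^sub>n \<rightarrow> 0\<close>. Nondegeneracy of the kernel
  (\<open>nondegenerate_kdist\<close>) yields a point of positive variance, so that
  \<open>\<gamma>\<^sub>T\<close> is bounded below by a positive constant and terms of order
  \<open>sqrt T\<close> are absorbed when \<open>\<Delta>\<^sub>n = O(1 / sqrt n)\<close>. It also
  yields two distinct points in the convex domain, so that the domain has no isolated points and the
  information gain, a supremum over sets, dominates samples that revisit points
  (\<open>info_le_info_gain\<close>).\<close>

section \<open>Posterior moments as a recursion\<close>

text \<open>Appending one sample point borders the regularised Gram matrix by one row and column. Solving the
  bordered system by eliminating the new unknown turns the matrix formulas for the posterior mean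
  and covariance into rank-one updates, and the determinant into a product. All later arguments use
  the posterior only through these updates.\<close>

definition reg_gram :: "('a \<Rightarrow> 'a \<Rightarrow> real) \<Rightarrow> real \<Rightarrow> 'a list \<Rightarrow> real mat" where
  "reg_gram k \<sigma> xs = gram k xs + \<sigma>\<^sup>2 \<cdot>\<^sub>m 1\<^sub>m (length xs)"

definition inv_form :: "('a \<Rightarrow> 'a \<Rightarrow> real) \<Rightarrow> real \<Rightarrow> 'a list \<Rightarrow> real Matrix.vec \<Rightarrow> real Matrix.vec \<Rightarrow> real" where
  "inv_form k \<sigma> xs u v = scalar_prod u (reg_inverse k \<sigma> xs *\<^sub>v v)"

lemma reg_gram_carrier [simp]: "reg_gram k \<sigma> xs \<in> carrier_mat (length xs) (length xs)"
  by (simp add: reg_gram_def gram_def)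

lemma kvec_carrier [simp]: "kvec k xs z \<in> carrier_vec (length xs)"
  by (simp add: kvec_def)

lemma mat_inverse_nonsingular:
  fixes A :: "real mat"
  assumes A: "A \<in> carrier_mat n n" and d: "Determinant.det A \<noteq> 0"
  shows "A * the (mat_inverse A) = 1\<^sub>m n" "the (mat_inverse A) * A = 1\<^sub>m n"
    "the (mat_inverse A) \<in> carrier_mat n n"
proof -
  have "mat_inverse A \<noteq> None"
    using mat_inverse(1)[OF A, of "()"] det_non_zero_imp_unit[OF A d, of "()"] by blast
  then obtain B where B: "mat_inverse A = Some B" by blast
  from mat_inverse(2)[OF A B] B
  show "A * the (mat_inverse A) = 1\<^sub>m n" "the (mat_inverse A) * A = 1\<^sub>m n"
    "the (mat_inverse A) \<in> carrier_mat n n" by auto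
qed

lemma reg_inverse_carrier:
  "Determinant.det (reg_gram k \<sigma> xs) \<noteq> 0 \<Longrightarrow> reg_inverse k \<sigma> xs \<in> carrier_mat (length xs) (length xs)"
  using mat_inverse_nonsingular(3)[OF reg_gram_carrier] by (simp add: reg_inverse_def reg_gram_def)

lemma reg_gram_reg_inverse:
  assumes "Determinant.det (reg_gram k \<sigma> xs) \<noteq> 0" "v \<in> carrier_vec (length xs)"
  shows "reg_gram k \<sigma> xs *\<^sub>v (reg_inverse k \<sigma> xs *\<^sub>v v) = v"
proof -
  have "reg_gram k \<sigma> xs * reg_inverse k \<sigma> xs = 1\<^sub>m (length xs)"
    using mat_inverse_nonsingular(1)[OF reg_gram_carrier assms(1)]
    by (simp add: reg_inverse_def reg_gram_def)
  then show ?thesis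
    using assms reg_inverse_carrier[OF assms(1)]
    by (metis assoc_mult_mat_vec one_mult_mat_vec reg_gram_carrier)
qed

lemma reg_inverse_unique:
  assumes "Determinant.det (reg_gram k \<sigma> xs) \<noteq> 0" "w \<in> carrier_vec (length xs)"
    and "reg_gram k \<sigma> xs *\<^sub>v w = v"
  shows "reg_inverse k \<sigma> xs *\<^sub>v v = w"
proof -
  have "reg_inverse k \<sigma> xs * reg_gram k \<sigma> xs = 1\<^sub>m (length xs)"
    using mat_inverse_nonsingular(2)[OF reg_gram_carrier assms(1)]
    by (simp add: reg_inverse_def reg_gram_def)
  then show ?thesis
    using assms reg_inverse_carrier[OF assms(1)]
    by (metis assoc_mult_mat_vec one_mult_mat_vec reg_gram_carrier)
qed

lemma dim_kvec [simp]: "dim_vec (kvec k xs z) = length xs"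
  by (simp add: kvec_def)

abbreviation row_mat :: "real Matrix.vec \<Rightarrow> real mat" where
  "row_mat v \<equiv> Matrix.mat 1 (dim_vec v) (\<lambda>(i, j). vec_index v j)"
abbreviation col_mat :: "real Matrix.vec \<Rightarrow> real mat" where
  "col_mat v \<equiv> Matrix.mat (dim_vec v) 1 (\<lambda>(i, j). vec_index v i)"
abbreviation one_mat :: "real \<Rightarrow> real mat" where
  "one_mat c \<equiv> Matrix.mat 1 1 (\<lambda>_. c)"
abbreviation one_vec :: "real \<Rightarrow> real Matrix.vec" where
  "one_vec c \<equiv> Matrix.vec 1 (\<lambda>_. c)"

lemma kvec_snoc: "kvec k (xs @ [x]) z = kvec k xs z @\<^sub>v one_vec (k x z)"
  by (rule eq_vecI) (auto simp: kvec_def nth_append less_Suc_eq)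

lemma vec_of_list_snoc: "vec_of_list (ys @ [y]) = vec_of_list ys @\<^sub>v one_vec y"
  by (rule eq_vecI) (auto simp: nth_append vec_of_list_index)

lemma reg_gram_snoc:
  assumes "\<And>z. z \<in> set xs \<Longrightarrow> k x z = k z x"
  shows "reg_gram k \<sigma> (xs @ [x]) =
    four_block_mat (reg_gram k \<sigma> xs) (col_mat (kvec k xs x)) (row_mat (kvec k xs x)) (one_mat (k x x + \<sigma>\<^sup>2))"
proof -
  have "k x (xs ! j) = k (xs ! j) x" if "j < length xs" for j using assms that by auto
  then show ?thesis
    by (intro eq_matI) (auto simp: reg_gram_def gram_def kvec_def nth_append less_Suc_eq)
qed

lemma col_mat_mult_one_vec: "col_mat v *\<^sub>v one_vec q = q \<cdot>\<^sub>v v"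
  by (rule eq_vecI) (auto simp: scalar_prod_def)

lemma row_mat_mult_vec: "dim_vec w = dim_vec v \<Longrightarrow> row_mat v *\<^sub>v w = one_vec (scalar_prod v w)"
  by (rule eq_vecI) (auto simp: scalar_prod_def)

lemma one_mat_mult_vec: "one_mat c *\<^sub>v one_vec q = one_vec (c * q)"
  by (rule eq_vecI) (auto simp: scalar_prod_def)

text \<open>Subtracting the combination of the old columns with coefficients \<open>w\<close> from the new column clears
  its upper part and leaves the Schur complement in the corner. That complement is the posterior
  variance at the new point plus the noise variance.\<close>

lemma det_reg_gram_snoc:
  assumes sym: "\<And>z. z \<in> set xs \<Longrightarrow> k x z = k z x"
    and d: "Determinant.det (reg_gram k \<sigma> xs) \<noteq> 0"
  shows "Determinant.det (reg_gram k \<sigma> (xs @ [x])) =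
    Determinant.det (reg_gram k \<sigma> xs) * (post_var k \<sigma> xs x + \<sigma>\<^sup>2)"
proof -
  let ?n = "length xs" and ?K = "reg_gram k \<sigma> xs" and ?v = "kvec k xs x"
  let ?c = "k x x + \<sigma>\<^sup>2"
  define w where "w = reg_inverse k \<sigma> xs *\<^sub>v ?v"
  have w: "w \<in> carrier_vec ?n" using reg_inverse_carrier[OF d] by (simp add: w_def)
  have Kw: "?K *\<^sub>v w = ?v" unfolding w_def by (rule reg_gram_reg_inverse[OF d]) simp
  let ?E = "four_block_mat (1\<^sub>m ?n) (col_mat (- w)) (0\<^sub>m 1 ?n) (1\<^sub>m 1)"
  have snoc: "reg_gram k \<sigma> (xs @ [x]) = four_block_mat ?K (col_mat ?v) (row_mat ?v) (one_mat ?c)"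
    by (rule reg_gram_snoc) (rule sym)
  have dv: "dim_vec ?v = ?n" "dim_vec w = ?n" using w by (auto simp: kvec_def)
  have K: "?K \<in> carrier_mat ?n ?n" by simp
  have c1: "col_mat ?v \<in> carrier_mat ?n 1" "row_mat ?v \<in> carrier_mat 1 ?n"
    "one_mat ?c \<in> carrier_mat 1 1" "col_mat (-w) \<in> carrier_mat ?n 1" using dv by auto
  have 1: "?K * 1\<^sub>m ?n + col_mat ?v * 0\<^sub>m 1 ?n = ?K"
    by (simp add: right_mult_zero_mat[OF c1(1)] dv(1) right_mult_one_mat[OF K] right_add_zero_mat[OF K])
  have 2: "?K * col_mat (-w) + col_mat ?v * 1\<^sub>m 1 = 0\<^sub>m ?n 1"
  proof (rule eq_matI)
    fix i j assume ij: "i < dim_row (0\<^sub>m ?n 1 :: real mat)" "j < dim_col (0\<^sub>m ?n 1 :: real mat)"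
    have "scalar_prod (Matrix.row ?K i) w = vec_index ?v i"
      using Kw ij by (metis K carrier_matD(1) index_mult_mat_vec index_zero_mat(2))
    moreover have "col (col_mat (-w)) 0 = - w" using dv by (intro eq_vecI) auto
    moreover have "scalar_prod (Matrix.row ?K i) (- w) = - scalar_prod (Matrix.row ?K i) w"
      using w ij by (simp add: scalar_prod_def sum_negf[symmetric])
    ultimately show "(?K * col_mat (-w) + col_mat ?v * 1\<^sub>m 1) $$ (i, j) = 0\<^sub>m ?n 1 $$ (i, j)"
      using ij dv by (simp add: carrier_matD[OF K])
  qed (use K dv in auto)
  have 3: "row_mat ?v * 1\<^sub>m ?n + one_mat ?c * 0\<^sub>m 1 ?n = row_mat ?v"
    using right_mult_one_mat[OF c1(2)] right_mult_zero_mat[OF c1(3)] c1(2) by simp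
  have 4: "row_mat ?v * col_mat (-w) + one_mat ?c * 1\<^sub>m 1 = one_mat (?c - scalar_prod ?v w)"
    using dv by (intro eq_matI) (auto simp: scalar_prod_def sum_negf[symmetric])
  have "reg_gram k \<sigma> (xs @ [x]) * ?E =
      four_block_mat ?K (0\<^sub>m ?n 1) (row_mat ?v) (one_mat (?c - scalar_prod ?v w))"
    unfolding snoc
    by (subst mult_four_block_mat[OF K c1(1) c1(2) c1(3) one_carrier_mat c1(4) zero_carrier_mat one_carrier_mat])
      (simp only: 1 2 3 4)
  then have "Determinant.det (reg_gram k \<sigma> (xs @ [x]) * ?E) = Determinant.det ?K * (?c - scalar_prod ?v w)"
    using det_four_block_mat_upper_right_zero[OF K refl c1(2), of "one_mat (?c - scalar_prod ?v w)"]
    by (simp add: det_single)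
  moreover have "Determinant.det ?E = 1"
    using det_four_block_mat_lower_left_zero[OF one_carrier_mat c1(4) refl one_carrier_mat] by simp
  moreover have "?E \<in> carrier_mat (Suc ?n) (Suc ?n)"
    using four_block_carrier_mat[of "1\<^sub>m ?n" ?n ?n "1\<^sub>m 1" 1 1] by simp
  ultimately have "Determinant.det (reg_gram k \<sigma> (xs @ [x])) = Determinant.det ?K * (?c - scalar_prod ?v w)"
    using det_mult[of "reg_gram k \<sigma> (xs @ [x])" "Suc ?n" ?E] reg_gram_carrier[of k \<sigma> "xs @ [x]"] by simp
  then show ?thesis by (simp add: post_var_def post_cov_def w_def algebra_simps)
qed

text \<open>The solution of the bordered system has last entry \<open>q\<close>, the residual of the last equation divided
  by the Schur complement, and the old entries are corrected by \<open>q\<close> times the solution for the new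
  column.\<close>

lemma inv_form_snoc:
  assumes sym: "\<And>z. z \<in> set xs \<Longrightarrow> k x z = k z x"
    and d: "Determinant.det (reg_gram k \<sigma> xs) \<noteq> 0"
    and den: "post_var k \<sigma> xs x + \<sigma>\<^sup>2 \<noteq> 0"
    and u: "u \<in> carrier_vec (length xs)" and v: "v \<in> carrier_vec (length xs)"
  shows "inv_form k \<sigma> (xs @ [x]) (u @\<^sub>v one_vec s) (v @\<^sub>v one_vec s') =
    inv_form k \<sigma> xs u v + (s - inv_form k \<sigma> xs u (kvec k xs x)) *
      (s' - inv_form k \<sigma> xs (kvec k xs x) v) / (post_var k \<sigma> xs x + \<sigma>\<^sup>2)"
proof -
  let ?n = "length xs" and ?K = "reg_gram k \<sigma> xs" and ?k = "kvec k xs x"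
  let ?c = "k x x + \<sigma>\<^sup>2"
  define den' where "den' = post_var k \<sigma> xs x + \<sigma>\<^sup>2"
  define w0 where "w0 = reg_inverse k \<sigma> xs *\<^sub>v v"
  define w1 where "w1 = reg_inverse k \<sigma> xs *\<^sub>v ?k"
  define q where "q = (s' - scalar_prod ?k w0) / den'"
  have den': "den' = ?c - scalar_prod ?k w1" "den' \<noteq> 0"
    using den by (auto simp: den'_def post_var_def post_cov_def w1_def)
  have w: "w0 \<in> carrier_vec ?n" "w1 \<in> carrier_vec ?n"
    using reg_inverse_carrier[OF d] v by (auto simp: w0_def w1_def)
  have Kw: "?K *\<^sub>v w0 = v" "?K *\<^sub>v w1 = ?k"
    using reg_gram_reg_inverse[OF d] v by (auto simp: w0_def w1_def)
  define w where "w = w0 - q \<cdot>\<^sub>v w1"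
  have wc: "w \<in> carrier_vec ?n" using \<open>w0 \<in> _\<close> \<open>w1 \<in> _\<close> by (simp add: w_def)
  have sp: "scalar_prod a w = scalar_prod a w0 - q * scalar_prod a w1" if "a \<in> carrier_vec ?n" for a
    using that \<open>w0 \<in> _\<close> \<open>w1 \<in> _\<close> unfolding w_def
    by (simp add: scalar_prod_minus_distrib[of _ ?n])
  have Kw': "?K *\<^sub>v w = v - q \<cdot>\<^sub>v ?k"
    unfolding w_def using \<open>w0 \<in> _\<close> \<open>w1 \<in> _\<close> Kw
    by (simp add: mult_minus_distrib_mat_vec[OF reg_gram_carrier] mult_mat_vec[OF reg_gram_carrier])
  have snoc: "reg_gram k \<sigma> (xs @ [x]) = four_block_mat ?K (col_mat ?k) (row_mat ?k) (one_mat ?c)"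
    by (rule reg_gram_snoc) (rule sym)
  have dv: "dim_vec ?k = ?n" by (simp add: kvec_def)
  have c1: "col_mat ?k \<in> carrier_mat ?n 1" "row_mat ?k \<in> carrier_mat 1 ?n"
    "one_mat ?c \<in> carrier_mat 1 1" using dv by auto
  have "reg_gram k \<sigma> (xs @ [x]) *\<^sub>v (w @\<^sub>v one_vec q) =
      (?K *\<^sub>v w + col_mat ?k *\<^sub>v one_vec q) @\<^sub>v (row_mat ?k *\<^sub>v w + one_mat ?c *\<^sub>v one_vec q)"
    unfolding snoc
    by (rule four_block_mat_mult_vec[OF reg_gram_carrier c1 wc]) simp
  also have "?K *\<^sub>v w + col_mat ?k *\<^sub>v one_vec q = v"
    unfolding Kw' col_mat_mult_one_vec using v dv by (intro eq_vecI) auto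
  also have "row_mat ?k *\<^sub>v w + one_mat ?c *\<^sub>v one_vec q = one_vec (scalar_prod ?k w + ?c * q)"
    using row_mat_mult_vec[of w ?k] wc dv by (subst one_mat_mult_vec, intro eq_vecI) auto
  also have "scalar_prod ?k w + ?c * q = s'"
  proof -
    have "scalar_prod ?k w + ?c * q = scalar_prod ?k w0 + q * den'"
      by (simp add: sp den'(1) algebra_simps)
    then show ?thesis using den'(2) by (simp add: q_def)
  qed
  finally have "reg_gram k \<sigma> (xs @ [x]) *\<^sub>v (w @\<^sub>v one_vec q) = v @\<^sub>v one_vec s'" .
  moreover have "Determinant.det (reg_gram k \<sigma> (xs @ [x])) \<noteq> 0"
    using det_reg_gram_snoc[of xs k x, OF sym d] d den by simp
  moreover have "w @\<^sub>v one_vec q \<in> carrier_vec (length (xs @ [x]))"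
    using append_carrier_vec[OF wc, of "one_vec q" 1] by simp
  ultimately have "reg_inverse k \<sigma> (xs @ [x]) *\<^sub>v (v @\<^sub>v one_vec s') = w @\<^sub>v one_vec q"
    by (intro reg_inverse_unique)
  then have "inv_form k \<sigma> (xs @ [x]) (u @\<^sub>v one_vec s) (v @\<^sub>v one_vec s') =
      scalar_prod u w + scalar_prod (one_vec s) (one_vec q)"
    unfolding inv_form_def using scalar_prod_append[OF u _ wc, of "one_vec s" 1 "one_vec q"] by simp
  also have "\<dots> = scalar_prod u w0 - q * scalar_prod u w1 + s * q"
    using sp[OF u] by (simp add: scalar_prod_def)
  finally show ?thesis
    by (simp add: inv_form_def q_def w0_def[symmetric] w1_def[symmetric] den'_def[symmetric])
       (simp add: field_simps den'(2))
qed

lemma post_cov_snoc: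
  assumes sym: "\<And>z w. z \<in> D \<Longrightarrow> w \<in> D \<Longrightarrow> k z w = k w z"
    and d: "Determinant.det (reg_gram k \<sigma> xs) \<noteq> 0"
    and den: "post_var k \<sigma> xs x + \<sigma>\<^sup>2 \<noteq> 0"
    and D: "set xs \<subseteq> D" "x \<in> D" "z \<in> D" "z' \<in> D"
  shows "post_cov k \<sigma> (xs @ [x]) z z' =
    post_cov k \<sigma> xs z z' - post_cov k \<sigma> xs z x * post_cov k \<sigma> xs x z' / (post_var k \<sigma> xs x + \<sigma>\<^sup>2)"
proof -
  have "k x w = k w x" if "w \<in> set xs" for w using sym D that by blast
  from inv_form_snoc[of xs k x, OF this d den kvec_carrier[of k xs z] kvec_carrier[of k xs z'], of "k x z" "k x z'"]
  show ?thesis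
    using sym[of x z] D
    by (simp add: post_cov_def kvec_snoc inv_form_def[symmetric])
qed

lemma post_mean_snoc:
  assumes sym: "\<And>z w. z \<in> D \<Longrightarrow> w \<in> D \<Longrightarrow> k z w = k w z"
    and d: "Determinant.det (reg_gram k \<sigma> xs) \<noteq> 0"
    and den: "post_var k \<sigma> xs x + \<sigma>\<^sup>2 \<noteq> 0"
    and D: "set xs \<subseteq> D" "x \<in> D" "z \<in> D" and l: "length ys = length xs"
  shows "post_mean k \<sigma> (xs @ [x]) (ys @ [y]) z = post_mean k \<sigma> xs ys z +
    post_cov k \<sigma> xs z x / (post_var k \<sigma> xs x + \<sigma>\<^sup>2) * (y - post_mean k \<sigma> xs ys x)"
proof -
  have s: "k x w = k w x" if "w \<in> set xs" for w using sym D that by blast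
  have v: "vec_of_list ys \<in> carrier_vec (length xs)" using l by (simp add: carrier_vecI)
  from inv_form_snoc[of xs k x, OF s d den kvec_carrier[of k xs z] v, of "k x z" y]
  show ?thesis
    using sym[of x z] D
    by (simp add: post_mean_def post_cov_def kvec_snoc vec_of_list_snoc inv_form_def[symmetric])
qed

section \<open>Finite linear functionals and positive semidefinite kernels\<close>

text \<open>A list of weighted points stands for the functional \<open>F \<mapsto> \<Sum> a * F p\<close>. Lists, unlike finite sets
  with coefficients, allow a point to occur twice, so adding one more weighted point needs no case
  distinction.\<close>

definition lsum :: "(real \<times> 'a) list \<Rightarrow> ('a \<Rightarrow> real) \<Rightarrow> real" where
  "lsum ps F = (\<Sum>(a, p)\<leftarrow>ps. a * F p)"

definition quad :: "('a \<Rightarrow> 'a \<Rightarrow> real) \<Rightarrow> (real \<times> 'a) list \<Rightarrow> real" where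
  "quad k ps = lsum ps (\<lambda>p. lsum ps (k p))"

definition psd_on :: "'a set \<Rightarrow> ('a \<Rightarrow> 'a \<Rightarrow> real) \<Rightarrow> bool" where
  "psd_on D k \<longleftrightarrow> (\<forall>x\<in>D. \<forall>y\<in>D. k x y = k y x) \<and> (\<forall>ps. snd ` set ps \<subseteq> D \<longrightarrow> 0 \<le> quad k ps)"

lemma lsum_Nil [simp]: "lsum [] F = 0"
  by (simp add: lsum_def)

lemma lsum_Cons [simp]: "lsum ((a, p) # ps) F = a * F p + lsum ps F"
  by (simp add: lsum_def)

lemma lsum_add: "lsum ps (\<lambda>p. F p + G p) = lsum ps F + lsum ps G"
  by (induction ps) (auto simp: algebra_simps)

lemma lsum_diff: "lsum ps (\<lambda>p. F p - G p) = lsum ps F - lsum ps G"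
  by (induction ps) (auto simp: algebra_simps)

lemma lsum_mult_left: "lsum ps (\<lambda>p. c * F p) = c * lsum ps F"
  by (induction ps) (auto simp: algebra_simps)

lemma lsum_mult_right: "lsum ps (\<lambda>p. F p * c) = lsum ps F * c"
  by (induction ps) (auto simp: algebra_simps)

lemma lsum_divide: "lsum ps (\<lambda>p. F p / c) = lsum ps F / c"
  by (induction ps) (auto simp: add_divide_distrib)

lemma lsum_cong: "(\<And>p. p \<in> snd ` set ps \<Longrightarrow> F p = G p) \<Longrightarrow> lsum ps F = lsum ps G"
  by (induction ps) auto

lemma quad_cong:
  "(\<And>p q. p \<in> snd ` set ps \<Longrightarrow> q \<in> snd ` set ps \<Longrightarrow> k p q = k' p q) \<Longrightarrow> quad k ps = quad k' ps"
  unfolding quad_def by (intro lsum_cong) auto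

lemma quad_Cons:
  assumes "\<And>p. p \<in> snd ` set ps \<Longrightarrow> k p z = k z p"
  shows "quad k ((t, z) # ps) = t\<^sup>2 * k z z + 2 * t * lsum ps (k z) + quad k ps"
proof -
  have "lsum ps (\<lambda>p. k p z) = lsum ps (k z)" by (rule lsum_cong) (use assms in auto)
  then show ?thesis
    by (simp add: quad_def lsum_add lsum_mult_left power2_eq_square algebra_simps)
qed

text \<open>Coefficients of repeated points are merged; this links lists to the finite-set form in which
  joint normality is stated.\<close>

lemma lsum_as_sum:
  "\<exists>c. \<forall>F. (\<Sum>x\<in>snd ` set ps. c x * F x) = lsum ps F"
proof (induction ps)
  case Nil then show ?case by simp
next
  case (Cons q ps)
  obtain a p where q: "q = (a, p)" by (cases q)
  from Cons obtain c where c: "\<And>F. (\<Sum>x\<in>snd ` set ps. c x * F x) = lsum ps F" by blast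
  let ?S = "snd ` set ps"
  define c' where "c' x = (if x \<in> ?S then c x else 0) + (if x = p then a else 0)" for x
  have "(\<Sum>x\<in>insert p ?S. c' x * F x) = lsum (q # ps) F" for F
  proof -
    have "(\<Sum>x\<in>insert p ?S. c' x * F x) =
        (\<Sum>x\<in>insert p ?S. (if x \<in> ?S then c x * F x else 0)) + (\<Sum>x\<in>insert p ?S. (if x = p then a * F x else 0))"
      unfolding sum.distrib[symmetric] by (intro sum.cong) (auto simp: c'_def algebra_simps)
    also have "(\<Sum>x\<in>insert p ?S. (if x \<in> ?S then c x * F x else 0)) = (\<Sum>x\<in>?S. c x * F x)"
      by (rule sum.mono_neutral_cong_right) auto
    also have "(\<Sum>x\<in>insert p ?S. (if x = p then a * F x else 0)) = a * F p"
      by simp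
    finally show ?thesis by (simp add: c q)
  qed
  then show ?case by (intro exI[of _ c']) (simp add: q)
qed

lemma psd_onD_sym: "psd_on D k \<Longrightarrow> x \<in> D \<Longrightarrow> y \<in> D \<Longrightarrow> k x y = k y x"
  by (auto simp: psd_on_def)

lemma psd_onD_quad: "psd_on D k \<Longrightarrow> snd ` set ps \<subseteq> D \<Longrightarrow> 0 \<le> quad k ps"
  by (auto simp: psd_on_def)

lemma psd_on_quad_Cons:
  "psd_on D k \<Longrightarrow> snd ` set ps \<subseteq> D \<Longrightarrow> z \<in> D \<Longrightarrow>
    quad k ((t, z) # ps) = t\<^sup>2 * k z z + 2 * t * lsum ps (k z) + quad k ps"
  by (rule quad_Cons) (auto intro: psd_onD_sym)

lemma psd_on_diag: "psd_on D k \<Longrightarrow> x \<in> D \<Longrightarrow> 0 \<le> k x x"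
  using psd_onD_quad[of D k "[(1, x)]"] by (simp add: quad_def)

text \<open>The quadratic form is nonnegative at \<open>ps\<close> with an extra point \<open>z\<close> of arbitrary weight \<open>t\<close>; the
  claim is the resulting discriminant condition.\<close>

lemma psd_on_Cauchy_Schwarz:
  assumes "psd_on D k" "snd ` set ps \<subseteq> D" "z \<in> D"
  shows "(lsum ps (k z))\<^sup>2 \<le> quad k ps * k z z"
proof -
  have pos: "0 \<le> t\<^sup>2 * k z z + 2 * t * lsum ps (k z) + quad k ps" for t
    using psd_onD_quad[OF assms(1), of "(t, z) # ps"] psd_on_quad_Cons[OF assms] assms by simp
  show ?thesis
  proof (cases "k z z = 0")
    case True
    have "lsum ps (k z) = 0"
    proof (rule ccontr)
      assume n: "lsum ps (k z) \<noteq> 0"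
      have "0 \<le> 2 * (- (quad k ps + 1) / (2 * lsum ps (k z))) * lsum ps (k z) + quad k ps"
        using pos[of "- (quad k ps + 1) / (2 * lsum ps (k z))"] True by simp
      also have "\<dots> = -1" using n by (simp add: field_simps)
      finally show False by simp
    qed
    then show ?thesis using True by simp
  next
    case False
    then have kz: "k z z > 0" using psd_on_diag[OF assms(1,3)] by simp
    have "0 \<le> k z z * ((- lsum ps (k z) / k z z)\<^sup>2 * k z z + 2 * (- lsum ps (k z) / k z z) * lsum ps (k z) + quad k ps)"
      using pos[of "- lsum ps (k z) / k z z"] kz by (intro mult_nonneg_nonneg) auto
    also have "\<dots> = quad k ps * k z z - (lsum ps (k z))\<^sup>2"
      using kz by (simp add: field_simps power2_eq_square)
    finally show ?thesis by simp
  qed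
qed

lemma psd_on_abs_le:
  assumes "psd_on D k" "x \<in> D" "y \<in> D"
  shows "\<bar>k x y\<bar> \<le> sqrt (k x x) * sqrt (k y y)"
proof -
  have "(k x y)\<^sup>2 \<le> k y y * k x x"
    using psd_on_Cauchy_Schwarz[OF assms(1), of "[(1, y)]" x] assms by (simp add: quad_def)
  then have "sqrt ((k x y)\<^sup>2) \<le> sqrt (k y y * k x x)" by (rule real_sqrt_le_mono)
  then show ?thesis by (simp add: real_sqrt_mult mult.commute)
qed

text \<open>The distance between \<open>x\<close> and \<open>y\<close> in the feature space of the kernel.\<close>

definition kdist :: "('a \<Rightarrow> 'a \<Rightarrow> real) \<Rightarrow> 'a \<Rightarrow> 'a \<Rightarrow> real" where
  "kdist k x y = sqrt (k x x - 2 * k x y + k y y)"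

lemma quad_pair:
  "k x y = k y x \<Longrightarrow> quad k [(1, x), (-1, y)] = k x x - 2 * k x y + k y y"
  by (simp add: quad_def)

lemma psd_on_diff_le:
  assumes "psd_on D k" "x \<in> D" "y \<in> D" "z \<in> D"
  shows "\<bar>k z x - k z y\<bar> \<le> kdist k x y * sqrt (k z z)"
proof -
  have "(k z x - k z y)\<^sup>2 \<le> (k x x - 2 * k x y + k y y) * k z z"
    using psd_on_Cauchy_Schwarz[OF assms(1), of "[(1, x), (-1, y)]" z] assms
      quad_pair[of k x y, OF psd_onD_sym[OF assms(1-3)]] by simp
  then have "sqrt ((k z x - k z y)\<^sup>2) \<le> sqrt ((k x x - 2 * k x y + k y y) * k z z)" by (rule real_sqrt_le_mono)
  then show ?thesis by (simp add: real_sqrt_mult kdist_def)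
qed

lemma psd_on_sqrt_diff_le:
  assumes "psd_on D k" "x \<in> D" "y \<in> D"
  shows "\<bar>sqrt (k x x) - sqrt (k y y)\<bar> \<le> kdist k x y"
proof -
  have n: "0 \<le> k x x" "0 \<le> k y y" using psd_on_diag assms by metis+
  have "(sqrt (k x x) - sqrt (k y y))\<^sup>2 = k x x - 2 * (sqrt (k x x) * sqrt (k y y)) + k y y"
    using n by (simp add: power2_diff)
  also have "\<dots> \<le> k x x - 2 * k x y + k y y"
    using psd_on_abs_le[OF assms] by linarith
  finally have "sqrt ((sqrt (k x x) - sqrt (k y y))\<^sup>2) \<le> kdist k x y"
    unfolding kdist_def by (rule real_sqrt_le_mono)
  then show ?thesis by simp
qed

lemma psd_on_kdist_nonneg:
  assumes "psd_on D k" "x \<in> D" "y \<in> D"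
  shows "0 \<le> k x x - 2 * k x y + k y y" "0 \<le> kdist k x y"
    "(kdist k x y)\<^sup>2 = k x x - 2 * k x y + k y y"
proof -
  show 1: "0 \<le> k x x - 2 * k x y + k y y"
    using psd_onD_quad[OF assms(1), of "[(1, x), (-1, y)]"] assms
      quad_pair[of k x y, OF psd_onD_sym[OF assms(1-3)]] by simp
  then show "0 \<le> kdist k x y" "(kdist k x y)\<^sup>2 = k x x - 2 * k x y + k y y"
    by (simp_all add: kdist_def)
qed

lemma quad_rank_one_update:
  assumes "psd_on D k" "snd ` set ps \<subseteq> D" "z \<in> D"
  shows "quad (\<lambda>x y. k x y - k x z * k z y / c) ps = quad k ps - (lsum ps (k z))\<^sup>2 / c"
proof -
  have "lsum ps (\<lambda>p. k p z) = lsum ps (k z)"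
    by (rule lsum_cong) (use assms in \<open>auto intro: psd_onD_sym\<close>)
  then show ?thesis
    by (simp add: quad_def lsum_diff lsum_divide lsum_mult_left lsum_mult_right power2_eq_square)
qed

text \<open>Observing at \<open>z\<close> with noise variance \<open>s\<close> leaves a covariance: by Cauchy-Schwarz the subtracted
  square is at most the quadratic form itself.\<close>

lemma psd_on_rank_one_update:
  assumes k: "psd_on D k" and z: "z \<in> D" and s: "0 < s"
  shows "psd_on D (\<lambda>x y. k x y - k x z * k z y / (k z z + s))"
  unfolding psd_on_def
proof (intro conjI ballI allI impI)
  fix x y assume "x \<in> D" "y \<in> D"
  then show "k x y - k x z * k z y / (k z z + s) = k y x - k y z * k z x / (k z z + s)"
    using psd_onD_sym[OF k] z by (metis mult.commute)
next
  fix ps :: "(real \<times> 'a) list" assume ps: "snd ` set ps \<subseteq> D"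
  have c: "0 < k z z + s" using psd_on_diag[OF k z] s by simp
  have "(lsum ps (k z))\<^sup>2 \<le> quad k ps * (k z z + s)"
    using psd_on_Cauchy_Schwarz[OF k ps z] mult_nonneg_nonneg[OF psd_onD_quad[OF k ps] less_imp_le[OF s]]
    by (simp add: distrib_left)
  then have "(lsum ps (k z))\<^sup>2 / (k z z + s) \<le> quad k ps" using c by (simp add: field_simps)
  then show "0 \<le> quad (\<lambda>x y. k x y - k x z * k z y / (k z z + s)) ps"
    using quad_rank_one_update[OF k ps z] by simp
qed

lemma psd_on_cong: "(\<And>x y. x \<in> D \<Longrightarrow> y \<in> D \<Longrightarrow> k x y = k' x y) \<Longrightarrow> psd_on D k = psd_on D k'"
  unfolding psd_on_def using quad_cong[of _ k k'] by (metis subsetD)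

section \<open>Properties of the posterior\<close>

text \<open>Positive semidefiniteness makes posterior variances nonnegative, hence all Gram determinants
  positive, hence the update formulas applicable. The two facts are proved together by induction on
  the sample list.\<close>

locale gp_prior =
  fixes D :: "'a set" and k :: "'a \<Rightarrow> 'a \<Rightarrow> real" and \<sigma> :: real
  assumes psd: "psd_on D k" and noise_pos: "0 < \<sigma>"
begin

lemma post_cov_Nil [simp]: "post_cov k \<sigma> [] = k"
  by (intro ext) (simp add: post_cov_def kvec_def scalar_prod_def)

lemma reg_gram_det_pos_psd:
  assumes "set xs \<subseteq> D"
  shows "0 < Determinant.det (reg_gram k \<sigma> xs) \<and> psd_on D (post_cov k \<sigma> xs)"
  using assms
proof (induction xs rule: rev_induct)
  case Nil
  show ?case using psd det_dim_zero[of "reg_gram k \<sigma> []"] reg_gram_carrier[of k \<sigma> "[]"] by simp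
next
  case (snoc x xs)
  then have d: "0 < Determinant.det (reg_gram k \<sigma> xs)" and p: "psd_on D (post_cov k \<sigma> xs)" and x: "x \<in> D"
    and xs: "set xs \<subseteq> D" by auto
  have den: "0 < post_var k \<sigma> xs x + \<sigma>\<^sup>2"
    using psd_on_diag[OF p x] noise_pos unfolding post_var_def by (simp add: add_nonneg_pos)
  have sym: "k x w = k w x" if "w \<in> set xs" for w using psd_onD_sym[OF psd x] that xs by auto
  have "psd_on D (post_cov k \<sigma> (xs @ [x]))"
  proof (rule iffD2[OF psd_on_cong])
    show "psd_on D (\<lambda>z w. post_cov k \<sigma> xs z w -
        post_cov k \<sigma> xs z x * post_cov k \<sigma> xs x w / (post_cov k \<sigma> xs x x + \<sigma>\<^sup>2))"
      by (rule psd_on_rank_one_update[OF p x]) (use noise_pos in simp)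
    show "post_cov k \<sigma> (xs @ [x]) z w = post_cov k \<sigma> xs z w -
        post_cov k \<sigma> xs z x * post_cov k \<sigma> xs x w / (post_cov k \<sigma> xs x x + \<sigma>\<^sup>2)"
      if "z \<in> D" "w \<in> D" for z w
      using post_cov_snoc[of D k \<sigma> xs x z w] psd_onD_sym[OF psd] d den xs x that
      unfolding post_var_def by auto
  qed
  moreover have "0 < Determinant.det (reg_gram k \<sigma> (xs @ [x]))"
    using det_reg_gram_snoc[of xs k x \<sigma>, OF sym] d den by simp
  ultimately show ?case by blast
qed

lemma psd_post_cov: "set xs \<subseteq> D \<Longrightarrow> psd_on D (post_cov k \<sigma> xs)"
  using reg_gram_det_pos_psd by blast

lemma post_var_nonneg: "set xs \<subseteq> D \<Longrightarrow> x \<in> D \<Longrightarrow> 0 \<le> post_var k \<sigma> xs x"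
  unfolding post_var_def by (rule psd_on_diag[OF psd_post_cov])

lemma post_var_noise_pos: "set xs \<subseteq> D \<Longrightarrow> x \<in> D \<Longrightarrow> 0 < post_var k \<sigma> xs x + \<sigma>\<^sup>2"
  using post_var_nonneg[of xs x] noise_pos by (simp add: add_nonneg_pos)

lemma post_cov_update:
  assumes "set xs \<subseteq> D" "x \<in> D" "z \<in> D" "z' \<in> D"
  shows "post_cov k \<sigma> (xs @ [x]) z z' =
    post_cov k \<sigma> xs z z' - post_cov k \<sigma> xs z x * post_cov k \<sigma> xs x z' / (post_var k \<sigma> xs x + \<sigma>\<^sup>2)"
  using post_cov_snoc[of D k \<sigma> xs x z z'] psd_onD_sym[OF psd] reg_gram_det_pos_psd[of xs]
    post_var_noise_pos[of xs x] assms by auto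

lemma post_mean_update:
  assumes "set xs \<subseteq> D" "x \<in> D" "z \<in> D" "length ys = length xs"
  shows "post_mean k \<sigma> (xs @ [x]) (ys @ [y]) z = post_mean k \<sigma> xs ys z +
    post_cov k \<sigma> xs z x / (post_var k \<sigma> xs x + \<sigma>\<^sup>2) * (y - post_mean k \<sigma> xs ys x)"
  using post_mean_snoc[of D k \<sigma> xs x z ys y] psd_onD_sym[OF psd] reg_gram_det_pos_psd[of xs]
    post_var_noise_pos[of xs x] assms by auto

lemma post_mean_Nil [simp]: "post_mean k \<sigma> [] ys z = 0"
proof -
  have "reg_inverse k \<sigma> [] \<in> carrier_mat 0 0"
    using reg_inverse_carrier[of k \<sigma> "[]"] reg_gram_det_pos_psd[of "[]"] by simp
  then show ?thesis by (simp add: post_mean_def scalar_prod_def)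
qed

text \<open>For one point this is the monotonicity of posterior variances; for a difference of two points it
  transfers the Lipschitz continuity of the prior to every posterior.\<close>

lemma quad_post_cov_snoc_le:
  assumes "set xs \<subseteq> D" "x \<in> D" "snd ` set ps \<subseteq> D"
  shows "quad (post_cov k \<sigma> (xs @ [x])) ps \<le> quad (post_cov k \<sigma> xs) ps"
proof -
  have "quad (post_cov k \<sigma> (xs @ [x])) ps =
      quad (\<lambda>z z'. post_cov k \<sigma> xs z z' - post_cov k \<sigma> xs z x * post_cov k \<sigma> xs x z' / (post_var k \<sigma> xs x + \<sigma>\<^sup>2)) ps"
    using assms by (intro quad_cong post_cov_update) auto
  also have "\<dots> = quad (post_cov k \<sigma> xs) ps - (lsum ps (post_cov k \<sigma> xs x))\<^sup>2 / (post_var k \<sigma> xs x + \<sigma>\<^sup>2)"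
    using quad_rank_one_update[OF psd_post_cov[OF assms(1)] assms(3,2)] .
  also have "\<dots> \<le> quad (post_cov k \<sigma> xs) ps"
    using post_var_noise_pos[OF assms(1,2)] by simp
  finally show ?thesis .
qed

lemma quad_post_cov_le:
  assumes "set xs \<subseteq> D" "snd ` set ps \<subseteq> D"
  shows "quad (post_cov k \<sigma> xs) ps \<le> quad k ps"
  using assms
proof (induction xs rule: rev_induct)
  case (snoc x xs) then show ?case using quad_post_cov_snoc_le[of xs x ps] by auto
qed simp

lemma post_var_snoc_le:
  "set xs \<subseteq> D \<Longrightarrow> x \<in> D \<Longrightarrow> z \<in> D \<Longrightarrow> post_var k \<sigma> (xs @ [x]) z \<le> post_var k \<sigma> xs z"
  using quad_post_cov_snoc_le[of xs x "[(1, z)]"] by (simp add: quad_def post_var_def)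

lemma post_var_le_prior: "set xs \<subseteq> D \<Longrightarrow> z \<in> D \<Longrightarrow> post_var k \<sigma> xs z \<le> k z z"
  using quad_post_cov_le[of xs "[(1, z)]"] by (simp add: quad_def post_var_def)

lemma kdist_post_cov_le:
  "set xs \<subseteq> D \<Longrightarrow> x \<in> D \<Longrightarrow> y \<in> D \<Longrightarrow> kdist (post_cov k \<sigma> xs) x y \<le> kdist k x y"
  using quad_post_cov_le[of xs "[(1, x), (-1, y)]"] psd_onD_sym[OF psd, of x y]
    psd_onD_sym[OF psd_post_cov, of xs x y]
  by (simp add: kdist_def quad_pair)

lemma post_cov_abs_le:
  "set xs \<subseteq> D \<Longrightarrow> x \<in> D \<Longrightarrow> y \<in> D \<Longrightarrow>
    \<bar>post_cov k \<sigma> xs x y\<bar> \<le> sqrt (post_var k \<sigma> xs x) * sqrt (post_var k \<sigma> xs y)"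
  unfolding post_var_def by (rule psd_on_abs_le[OF psd_post_cov])

lemma post_cov_diff_le:
  assumes "set xs \<subseteq> D" "x \<in> D" "y \<in> D" "z \<in> D"
  shows "\<bar>post_cov k \<sigma> xs x z - post_cov k \<sigma> xs y z\<bar> \<le> kdist k x y * sqrt (post_var k \<sigma> xs z)"
proof -
  have "\<bar>post_cov k \<sigma> xs z x - post_cov k \<sigma> xs z y\<bar> \<le> kdist (post_cov k \<sigma> xs) x y * sqrt (post_var k \<sigma> xs z)"
    unfolding post_var_def by (rule psd_on_diff_le[OF psd_post_cov]) (use assms in auto)
  also have "\<dots> \<le> kdist k x y * sqrt (post_var k \<sigma> xs z)"
    using assms by (intro mult_right_mono kdist_post_cov_le) (auto simp: post_var_nonneg)
  finally show ?thesis
    using psd_onD_sym[OF psd_post_cov[OF assms(1)]] assms by simp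
qed

lemma post_std_diff_le:
  assumes "set xs \<subseteq> D" "x \<in> D" "y \<in> D"
  shows "\<bar>sqrt (post_var k \<sigma> xs x) - sqrt (post_var k \<sigma> xs y)\<bar> \<le> kdist k x y"
  using psd_on_sqrt_diff_le[OF psd_post_cov[OF assms(1)] assms(2,3)] kdist_post_cov_le[OF assms]
  unfolding post_var_def by linarith

text \<open>Posterior covariances with the sampled point are bounded by its posterior standard deviation, so one
  observation hardly moves the posterior mean anywhere if the process is already well known at the
  sampled point. This is what makes tracking the moving maximum affordable.\<close>

lemma post_mean_step_le:
  assumes "set xs \<subseteq> D" "x \<in> D" "z \<in> D" "length ys = length xs" "k z z \<le> 1"
  shows "\<bar>post_mean k \<sigma> (xs @ [x]) (ys @ [y]) z - post_mean k \<sigma> xs ys z\<bar> \<le>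
    sqrt (post_var k \<sigma> xs x) * \<bar>y - post_mean k \<sigma> xs ys x\<bar> / \<sigma>\<^sup>2"
proof -
  let ?v = "post_var k \<sigma> xs x"
  have v: "0 \<le> ?v" by (rule post_var_nonneg[OF assms(1,2)])
  have "sqrt (post_var k \<sigma> xs z) \<le> 1"
    using post_var_le_prior[OF assms(1,3)] assms(5) by simp
  then have "\<bar>post_cov k \<sigma> xs z x\<bar> \<le> sqrt ?v"
    using post_cov_abs_le[OF assms(1,3,2)] v
      mult_right_mono[of "sqrt (post_var k \<sigma> xs z)" 1 "sqrt ?v"] by simp
  moreover have "\<sigma>\<^sup>2 \<le> ?v + \<sigma>\<^sup>2" using v by simp
  ultimately have "\<bar>post_cov k \<sigma> xs z x\<bar> / (?v + \<sigma>\<^sup>2) \<le> sqrt ?v / \<sigma>\<^sup>2"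
    using noise_pos v by (intro frac_le) auto
  then have "\<bar>post_cov k \<sigma> xs z x\<bar> / (?v + \<sigma>\<^sup>2) * \<bar>y - post_mean k \<sigma> xs ys x\<bar> \<le> sqrt ?v / \<sigma>\<^sup>2 * \<bar>y - post_mean k \<sigma> xs ys x\<bar>"
    by (rule mult_right_mono) simp
  then show ?thesis
    using post_mean_update[OF assms(1-4)] post_var_noise_pos[OF assms(1,2)] by (simp add: abs_mult)
qed

lemma post_mean_step_Lipschitz:
  assumes "set xs \<subseteq> D" "x \<in> D" "z \<in> D" "z' \<in> D" "length ys = length xs" "k x x \<le> 1"
  shows "\<bar>post_mean k \<sigma> (xs @ [x]) (ys @ [y]) z - post_mean k \<sigma> (xs @ [x]) (ys @ [y]) z'\<bar> \<le>
    \<bar>post_mean k \<sigma> xs ys z - post_mean k \<sigma> xs ys z'\<bar> + kdist k z z' * \<bar>y - post_mean k \<sigma> xs ys x\<bar> / \<sigma>\<^sup>2"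
proof -
  let ?v = "post_var k \<sigma> xs x" and ?r = "y - post_mean k \<sigma> xs ys x"
  have v: "0 \<le> ?v" by (rule post_var_nonneg[OF assms(1,2)])
  have "sqrt ?v \<le> 1" using post_var_le_prior[OF assms(1,2)] assms(6) by simp
  then have "kdist k z z' * sqrt ?v \<le> kdist k z z'"
    using psd_on_kdist_nonneg(2)[OF psd assms(3,4)] by (simp add: mult_left_le)
  then have c: "\<bar>post_cov k \<sigma> xs z x - post_cov k \<sigma> xs z' x\<bar> \<le> kdist k z z'"
    using post_cov_diff_le[OF assms(1,3,4,2)] by linarith
  have "\<bar>post_cov k \<sigma> xs z x - post_cov k \<sigma> xs z' x\<bar> / (?v + \<sigma>\<^sup>2) \<le> kdist k z z' / \<sigma>\<^sup>2"
    using c noise_pos v by (intro frac_le) (auto intro: order_trans[OF abs_ge_zero])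
  from mult_right_mono[OF this, of "\<bar>?r\<bar>"]
  have d: "\<bar>(post_cov k \<sigma> xs z x - post_cov k \<sigma> xs z' x) / (?v + \<sigma>\<^sup>2) * ?r\<bar> \<le> kdist k z z' / \<sigma>\<^sup>2 * \<bar>?r\<bar>"
    using post_var_noise_pos[OF assms(1,2)] by (simp add: abs_mult)
  have eq: "post_mean k \<sigma> (xs @ [x]) (ys @ [y]) z - post_mean k \<sigma> (xs @ [x]) (ys @ [y]) z' =
      (post_mean k \<sigma> xs ys z - post_mean k \<sigma> xs ys z') + (post_cov k \<sigma> xs z x - post_cov k \<sigma> xs z' x) / (?v + \<sigma>\<^sup>2) * ?r"
    using post_mean_update[OF assms(1,2,3,5)] post_mean_update[OF assms(1,2,4,5)]
    by (simp add: diff_divide_distrib algebra_simps)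
  show ?thesis unfolding eq by (rule order_trans[OF abs_triangle_ineq]) (use d in simp)
qed

lemma dim_gram [simp]: "dim_row (gram k xs) = length xs" "dim_col (gram k xs) = length xs"
  by (simp_all add: gram_def)

lemma det_info_snoc:
  assumes "set xs \<subseteq> D" "x \<in> D"
  shows "Determinant.det (1\<^sub>m (Suc (length xs)) + (1 / \<sigma>\<^sup>2) \<cdot>\<^sub>m gram k (xs @ [x])) =
    Determinant.det (1\<^sub>m (length xs) + (1 / \<sigma>\<^sup>2) \<cdot>\<^sub>m gram k xs) * (1 + post_var k \<sigma> xs x / \<sigma>\<^sup>2)"
proof -
  have s: "reg_gram k \<sigma> zs = \<sigma>\<^sup>2 \<cdot>\<^sub>m (1\<^sub>m (length zs) + (1 / \<sigma>\<^sup>2) \<cdot>\<^sub>m gram k zs)" for zs :: "'a list"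
    using noise_pos by (intro eq_matI) (auto simp: reg_gram_def gram_def algebra_simps)
  have c: "1\<^sub>m (length zs) + (1 / \<sigma>\<^sup>2) \<cdot>\<^sub>m gram k zs \<in> carrier_mat (length zs) (length zs)" for zs :: "'a list"
    by (simp add: gram_def)
  have e: "Determinant.det (reg_gram k \<sigma> zs) =
      (\<sigma>\<^sup>2) ^ length zs * Determinant.det (1\<^sub>m (length zs) + (1 / \<sigma>\<^sup>2) \<cdot>\<^sub>m gram k zs)" for zs :: "'a list"
    unfolding s using c[of zs] by simp
  have sym: "k x w = k w x" if "w \<in> set xs" for w using psd_onD_sym[OF psd] assms that by auto
  have "Determinant.det (reg_gram k \<sigma> (xs @ [x])) =
      Determinant.det (reg_gram k \<sigma> xs) * (post_var k \<sigma> xs x + \<sigma>\<^sup>2)"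
    using det_reg_gram_snoc[of xs k x \<sigma>, OF sym] reg_gram_det_pos_psd[OF assms(1)] by simp
  moreover define A B where "A = Determinant.det (1\<^sub>m (Suc (length xs)) + (1 / \<sigma>\<^sup>2) \<cdot>\<^sub>m gram k (xs @ [x]))"
    and "B = Determinant.det (1\<^sub>m (length xs) + (1 / \<sigma>\<^sup>2) \<cdot>\<^sub>m gram k xs)"
  ultimately have "(\<sigma>\<^sup>2) ^ length xs * (\<sigma>\<^sup>2 * A) = (\<sigma>\<^sup>2) ^ length xs * (B * (post_var k \<sigma> xs x + \<sigma>\<^sup>2))"
    unfolding e by (simp add: mult_ac)
  then have "\<sigma>\<^sup>2 * A = B * (post_var k \<sigma> xs x + \<sigma>\<^sup>2)" using noise_pos by simp
  then have "A = B * (1 + post_var k \<sigma> xs x / \<sigma>\<^sup>2)" using noise_pos by (simp add: field_simps)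
  then show ?thesis by (simp only: A_def B_def)
qed

text \<open>The chain rule for the mutual information between the observations and the process.\<close>

lemma det_info_eq_prod:
  assumes "set xs \<subseteq> D"
  shows "Determinant.det (1\<^sub>m (length xs) + (1 / \<sigma>\<^sup>2) \<cdot>\<^sub>m gram k xs) =
    (\<Prod>i<length xs. 1 + post_var k \<sigma> (take i xs) (xs ! i) / \<sigma>\<^sup>2)"
  using assms
proof (induction xs rule: rev_induct)
  case Nil
  show ?case by (simp add: gram_def det_dim_zero[of "_ :: real mat"])
next
  case (snoc x xs)
  then show ?case by (simp add: det_info_snoc nth_append)
qed

end

section \<open>Gaussian laws and characteristic functions\<close>

lemma char_normal_distribution:
  assumes "0 < \<sigma>"
  shows "char (density lborel (normal_density \<mu> \<sigma>)) t =
    exp (\<i> * complex_of_real (t * \<mu>) - complex_of_real (\<sigma>\<^sup>2 * t\<^sup>2 / 2))"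
proof -
  let ?N = "density lborel (normal_density \<mu> \<sigma>)"
  interpret N: prob_space ?N using assms by (rule prob_space_normal_density)
  have "distributed ?N lborel (\<lambda>x. x) (normal_density \<mu> \<sigma>)"
    unfolding distributed_def by (auto simp: distr_id2)
  then have d: "distributed ?N lborel (\<lambda>x. (x - \<mu>) / \<sigma>) std_normal_density"
    using N.normal_standard_normal_convert[OF assms, of "\<lambda>x. x" \<mu>] by simp
  have "complex_of_real (exp (- (\<sigma> * t)\<^sup>2 / 2)) = char std_normal_distribution (\<sigma> * t)"
    by (simp add: char_std_normal_distribution)
  also have "\<dots> = char (distr ?N lborel (\<lambda>x. (x - \<mu>) / \<sigma>)) (\<sigma> * t)"
    using distributed_distr_eq_density[OF d] by simp
  also have "\<dots> = (CLINT x|?N. iexp (\<sigma> * t * ((x - \<mu>) / \<sigma>)))"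
    unfolding char_def by (rule integral_distr) simp_all
  also have "\<dots> = (CLINT x|?N. iexp (t * x) * iexp (- (t * \<mu>)))"
    using assms by (intro Bochner_Integration.integral_cong)
      (simp_all add: exp_add[symmetric] algebra_simps diff_divide_distrib)
  also have "\<dots> = char ?N t * iexp (- (t * \<mu>))"
    unfolding char_def by simp
  finally have "char ?N t * iexp (- (t * \<mu>)) * iexp (t * \<mu>) =
      complex_of_real (exp (- (\<sigma> * t)\<^sup>2 / 2)) * iexp (t * \<mu>)" by simp
  moreover have "iexp (- (t * \<mu>)) * iexp (t * \<mu>) = 1"
    by (simp add: exp_add[symmetric])
  ultimately have "char ?N t = complex_of_real (exp (- (\<sigma> * t)\<^sup>2 / 2)) * iexp (t * \<mu>)"
    by (metis mult.assoc mult.right_neutral)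
  also have "\<dots> = exp (complex_of_real (- (\<sigma> * t)\<^sup>2 / 2) + \<i> * complex_of_real (t * \<mu>))"
    unfolding exp_of_real[symmetric] exp_add ..
  finally show ?thesis by (simp add: power_mult_distrib algebra_simps)
qed

lemma normal_rv_iexp:
  assumes "prob_space M" "normal_rv M m v X"
  shows "(CLINT \<omega>|M. iexp (X \<omega>)) = exp (\<i> * complex_of_real m - complex_of_real (v / 2))"
proof (cases "v = 0")
  case True
  interpret prob_space M by fact
  have "AE \<omega> in M. iexp (X \<omega>) = iexp m"
    using assms(2) True by (auto simp: normal_rv_def)
  then have "(CLINT \<omega>|M. iexp (X \<omega>)) = (CLINT \<omega>|M. iexp m)"
    using assms(2) by (intro integral_cong_AE) (auto simp: normal_rv_def)
  then show ?thesis using True by (simp add: prob_space)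
next
  case False
  interpret prob_space M by fact
  have v: "0 < v" and d: "distributed M lborel X (normal_density m (sqrt v))"
    using assms(2) False by (auto simp: normal_rv_def)
  have X[measurable]: "X \<in> borel_measurable M" using assms(2) by (simp add: normal_rv_def)
  have "(CLINT \<omega>|M. iexp (X \<omega>)) = (CLINT x|distr M lborel X. iexp x)"
    by (rule integral_distr[symmetric]) simp_all
  also have "\<dots> = char (density lborel (normal_density m (sqrt v))) 1"
    unfolding char_def distributed_distr_eq_density[OF d] by simp
  also have "\<dots> = exp (\<i> * complex_of_real m - complex_of_real (v / 2))"
    using v by (subst char_normal_distribution) simp_all
  finally show ?thesis .
qed

text \<open>Chernoff bound: right of \<open>m + a * s\<close> the density is dominated by \<open>exp (- a\<^sup>2 / 2)\<close> times the density
  shifted by \<open>a * s\<close>.\<close>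

lemma normal_upper_tail:
  assumes "0 < s" "0 \<le> a"
  shows "measure (density lborel (normal_density m s)) {x. m + a * s < x} \<le> exp (- a\<^sup>2 / 2)"
proof -
  let ?N = "density lborel (normal_density m s)"
  interpret N: prob_space ?N using assms(1) by (rule prob_space_normal_density)
  have le: "normal_density m s x \<le> exp (- a\<^sup>2 / 2) * normal_density (m + a * s) s x"
    if "m + a * s < x" for x
  proof -
    have "0 \<le> a * s * (x - m - a * s)" using assms that by auto
    then have "- (x - m)\<^sup>2 \<le> - a\<^sup>2 * s\<^sup>2 - (x - (m + a * s))\<^sup>2"
      by (simp add: power2_eq_square algebra_simps)
    then have "- (x - m)\<^sup>2 / (2 * s\<^sup>2) \<le> (- a\<^sup>2 * s\<^sup>2 - (x - (m + a * s))\<^sup>2) / (2 * s\<^sup>2)"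
      by (rule divide_right_mono) simp
    also have "\<dots> = - a\<^sup>2 / 2 + - (x - (m + a * s))\<^sup>2 / (2 * s\<^sup>2)"
      using assms by (simp add: diff_divide_distrib add_divide_distrib)
    finally have "exp (- (x - m)\<^sup>2 / (2 * s\<^sup>2)) \<le> exp (- a\<^sup>2 / 2) * exp (- (x - (m + a * s))\<^sup>2 / (2 * s\<^sup>2))"
      unfolding exp_add[symmetric] by simp
    then show ?thesis unfolding normal_density_def
      using mult_left_mono[of _ _ "1 / sqrt (2 * pi * s\<^sup>2)"] by (simp add: mult_ac)
  qed
  have "emeasure ?N {x. m + a * s < x} = (\<integral>\<^sup>+x. ennreal (normal_density m s x) * indicator {x. m + a * s < x} x \<partial>lborel)"
    by (subst emeasure_density) auto
  also have "\<dots> \<le> (\<integral>\<^sup>+x. ennreal (exp (- a\<^sup>2 / 2)) * ennreal (normal_density (m + a * s) s x) \<partial>lborel)"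
    using le by (intro nn_integral_mono) (auto simp: indicator_def ennreal_mult[symmetric] intro!: ennreal_leI)
  also have "\<dots> = ennreal (exp (- a\<^sup>2 / 2))"
    using assms by (subst nn_integral_cmult) (auto simp: nn_integral_eq_integral)
  finally show ?thesis by (simp add: N.emeasure_eq_measure)
qed

lemma normal_lower_tail:
  assumes "0 < s" "0 \<le> a"
  shows "measure (density lborel (normal_density m s)) {x. x < m - a * s} \<le> exp (- a\<^sup>2 / 2)"
proof -
  let ?N = "density lborel (normal_density m s)"
  interpret N: prob_space ?N using assms(1) by (rule prob_space_normal_density)
  have "distributed ?N lborel (\<lambda>x. x) (normal_density m s)"
    unfolding distributed_def by (auto simp: distr_id2)
  from N.normal_density_affine[OF this assms(1), of "-1" 0]
  have d: "distributed ?N lborel uminus (normal_density (- m) s)" by simp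
  have "measure ?N {x. x < m - a * s} = measure (distr ?N lborel uminus) {x. - m + a * s < x}"
    by (subst measure_distr) (auto intro!: arg_cong[where f="measure _"])
  also have "\<dots> \<le> exp (- a\<^sup>2 / 2)"
    unfolding distributed_distr_eq_density[OF d] by (rule normal_upper_tail[OF assms])
  finally show ?thesis .
qed

lemma normal_abs_tail:
  assumes "0 < s" "0 \<le> a"
  shows "measure (density lborel (normal_density m s)) {x. a * s < \<bar>x - m\<bar>} \<le> 2 * exp (- a\<^sup>2 / 2)"
proof -
  let ?N = "density lborel (normal_density m s)"
  interpret N: prob_space ?N using assms(1) by (rule prob_space_normal_density)
  have "{x. a * s < \<bar>x - m\<bar>} = {x. m + a * s < x} \<union> {x. x < m - a * s}" by auto
  then have "measure ?N {x. a * s < \<bar>x - m\<bar>} \<le> measure ?N {x. m + a * s < x} + measure ?N {x. x < m - a * s}"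
    by (simp add: measure_Un_le)
  then show ?thesis using normal_upper_tail[OF assms, of m] normal_lower_tail[OF assms, of m] by simp
qed

text \<open>After normalisation, the weight \<open>w\<close> defines a probability measure under which \<open>X\<close> has a Gaussian
  characteristic function, so by uniqueness \<open>X\<close> is normal (a point mass if \<open>v = 0\<close>) and the normal
  tail bound applies.\<close>

lemma Gaussian_char_tail:
  fixes X w :: "'w \<Rightarrow> real"
  assumes M: "prob_space M" and X[measurable]: "X \<in> borel_measurable M" and w[measurable]: "w \<in> borel_measurable M"
    and w0: "\<And>\<omega>. 0 \<le> w \<omega>" and wC: "\<And>\<omega>. w \<omega> \<le> C" and c: "0 < c" and v: "0 \<le> v" and a: "0 \<le> a"
    and ch: "\<And>t. (CLINT \<omega>|M. complex_of_real (w \<omega>) * iexp (t * X \<omega>)) =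
      complex_of_real c * exp (\<i> * complex_of_real (t * m) - complex_of_real (v * t\<^sup>2 / 2))"
  shows "(\<integral>\<^sup>+\<omega>. ennreal (w \<omega>) * indicator {\<omega>. a * sqrt v < \<bar>X \<omega> - m\<bar>} \<omega> \<partial>M) \<le>
    ennreal (2 * exp (- a\<^sup>2 / 2)) * (\<integral>\<^sup>+\<omega>. ennreal (w \<omega>) \<partial>M)"
proof -
  interpret prob_space M by fact
  have wi: "integrable M w"
    using w0 wC by (intro integrable_const_bound[where B=C]) auto
  have "(CLINT \<omega>|M. complex_of_real (w \<omega>)) = complex_of_real c" using ch[of 0] by simp
  then have wc: "(\<integral>\<omega>. w \<omega> \<partial>M) = c" by simp
  have nn: "(\<integral>\<^sup>+\<omega>. ennreal (w \<omega>) \<partial>M) = ennreal c"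
    using nn_integral_eq_integral[OF wi] w0 wc by simp
  define M' where "M' = density M (\<lambda>\<omega>. ennreal (w \<omega> / c))"
  have [measurable_cong]: "sets M' = sets M" by (simp add: M'_def)
  have M': "prob_space M'"
  proof (rule prob_spaceI)
    have "emeasure M' (space M') = (\<integral>\<^sup>+\<omega>. ennreal (w \<omega> / c) \<partial>M)"
      unfolding M'_def by (auto simp: emeasure_density intro!: nn_integral_cong)
    also have "\<dots> = ennreal 1"
      using wi w0 c wc by (subst nn_integral_eq_integral) auto
    finally show "emeasure M' (space M') = 1" by simp
  qed
  interpret M': prob_space M' by fact
  define N where "N = (if v = 0 then return borel m else density lborel (normal_density m (sqrt v)))"
  have rN: "real_distribution N"
  proof (cases "v = 0")
    case True then show ?thesis
      unfolding N_def by (auto intro!: real_distribution.intro prob_space_return simp: real_distribution_axioms_def)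
  next
    case False then show ?thesis using v
      unfolding N_def by (auto intro!: real_distribution.intro prob_space_normal_density simp: real_distribution_axioms_def)
  qed
  have "char (distr M' borel X) = char N"
  proof
    fix t
    have "char (distr M' borel X) t = (CLINT \<omega>|M'. iexp (t * X \<omega>))"
      unfolding char_def by (rule integral_distr) simp_all
    also have "\<dots> = (CLINT \<omega>|M. (w \<omega> / c) *\<^sub>R iexp (t * X \<omega>))"
      unfolding M'_def using w0 c by (intro integral_density) auto
    also have "\<dots> = (CLINT \<omega>|M. (complex_of_real (w \<omega>) * iexp (t * X \<omega>)) / complex_of_real c)"
      by (intro Bochner_Integration.integral_cong) (simp_all add: scaleR_conv_of_real)
    also have "\<dots> = exp (\<i> * complex_of_real (t * m) - complex_of_real (v * t\<^sup>2 / 2))"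
      using ch[of t] c by simp
    also have "\<dots> = char N t"
    proof (cases "v = 0")
      case True then show ?thesis by (simp add: N_def char_def integral_return)
    next
      case False then show ?thesis using v by (simp add: N_def char_normal_distribution)
    qed
    finally show "char (distr M' borel X) t = char N t" .
  qed
  then have NX: "distr M' borel X = N"
    by (intro Levy_uniqueness[OF _ rN] real_distribution.intro M'.prob_space_distr)
      (auto simp: real_distribution_axioms_def)
  have tail: "measure N {x. a * sqrt v < \<bar>x - m\<bar>} \<le> 2 * exp (- a\<^sup>2 / 2)"
  proof (cases "v = 0")
    case True then show ?thesis by (simp add: N_def measure_return)
  next
    case False then show ?thesis using v a normal_abs_tail[of "sqrt v" a m] by (simp add: N_def)
  qed
  have "(\<integral>\<^sup>+\<omega>. ennreal (w \<omega>) * indicator {\<omega>. a * sqrt v < \<bar>X \<omega> - m\<bar>} \<omega> \<partial>M) =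
      ennreal c * (\<integral>\<^sup>+\<omega>. ennreal (w \<omega> / c) * indicator {\<omega>\<in>space M. a * sqrt v < \<bar>X \<omega> - m\<bar>} \<omega> \<partial>M)"
    using c w0
    by (subst nn_integral_cmult[symmetric])
      (auto intro!: nn_integral_cong simp: ennreal_mult[symmetric] mult.assoc[symmetric] indicator_def)
  also have "\<dots> = ennreal c * emeasure M' {\<omega>\<in>space M. a * sqrt v < \<bar>X \<omega> - m\<bar>}"
    unfolding M'_def by (subst emeasure_density) auto
  also have "emeasure M' {\<omega>\<in>space M. a * sqrt v < \<bar>X \<omega> - m\<bar>} = emeasure (distr M' borel X) {x. a * sqrt v < \<bar>x - m\<bar>}"
    by (subst emeasure_distr) (auto intro!: arg_cong[where f="emeasure _"] simp: M'_def)
  also have "ennreal c * \<dots> \<le> ennreal c * ennreal (2 * exp (- a\<^sup>2 / 2))"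
    unfolding NX using tail rN
    by (intro mult_left_mono) (simp_all add: finite_measure.emeasure_eq_measure prob_space.finite_measure real_distribution.axioms(1) ennreal_leI)
  finally show ?thesis unfolding nn by (simp add: mult.commute)
qed

section \<open>Conditioning a Gaussian process on a noisy observation\<close>

text \<open>Under the measure with density \<open>w\<close>, the process is Gaussian with mean \<open>m\<close> and covariance \<open>k\<close>, up to
  the total mass \<open>c\<close>. Stating this through characteristic functions of finite linear combinations
  covers degenerate covariances uniformly and avoids normalising after each observation.\<close>

definition weighted_gp ::
  "'w measure \<Rightarrow> 'a set \<Rightarrow> ('w \<Rightarrow> 'a \<Rightarrow> real) \<Rightarrow> ('w \<Rightarrow> real) \<Rightarrow> real \<Rightarrow> ('a \<Rightarrow> real) \<Rightarrow> ('a \<Rightarrow> 'a \<Rightarrow> real) \<Rightarrow> bool" where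
  "weighted_gp M D U w c m k \<longleftrightarrow> (\<forall>ps. snd ` set ps \<subseteq> D \<longrightarrow>
     (CLINT \<omega>|M. complex_of_real (w \<omega>) * iexp (lsum ps (U \<omega>))) =
       complex_of_real c * exp (\<i> * complex_of_real (lsum ps m) - complex_of_real (quad k ps / 2)))"

lemma gaussian_process_measurable:
  assumes "gaussian_process M D m k U" "x \<in> D"
  shows "(\<lambda>\<omega>. U \<omega> x) \<in> borel_measurable M"
  using assms(1)[unfolded gaussian_process_def, THEN conjunct2, rule_format, of "{x}" "\<lambda>_. 1"] assms(2)
  by (simp add: normal_rv_def)

lemma gaussian_process_lsum:
  assumes "gaussian_process M D m k U" "snd ` set ps \<subseteq> D"
  shows "normal_rv M (lsum ps m) (quad k ps) (\<lambda>\<omega>. lsum ps (U \<omega>))"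
proof -
  obtain c where c: "\<And>F. (\<Sum>x\<in>snd ` set ps. c x * F x) = lsum ps F"
    using lsum_as_sum[of ps] by blast
  have "normal_rv M (\<Sum>x\<in>snd ` set ps. c x * m x)
      (\<Sum>x\<in>snd ` set ps. \<Sum>y\<in>snd ` set ps. c x * c y * k x y) (\<lambda>\<omega>. \<Sum>x\<in>snd ` set ps. c x * U \<omega> x)"
    using assms(1)[unfolded gaussian_process_def, THEN conjunct2, rule_format, of "snd ` set ps" c] assms(2) by simp
  moreover have "(\<Sum>x\<in>snd ` set ps. \<Sum>y\<in>snd ` set ps. c x * c y * k x y) = quad k ps"
    by (simp add: quad_def mult.assoc sum_distrib_left[symmetric] c)
  ultimately show ?thesis by (simp add: c)
qed

lemma gaussian_process_psd:
  assumes "gaussian_process M D m k U"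
  shows "psd_on D k"
  unfolding psd_on_def
proof (intro conjI allI impI)
  show "\<forall>x\<in>D. \<forall>y\<in>D. k x y = k y x" using assms by (simp add: gaussian_process_def)
  show "0 \<le> quad k ps" if "snd ` set ps \<subseteq> D" for ps
    using gaussian_process_lsum[OF assms that] by (simp only: normal_rv_def)
qed

lemma gaussian_process_weighted:
  assumes "prob_space M" "gaussian_process M D m k U"
  shows "weighted_gp M D U (\<lambda>_. 1) 1 m k"
  unfolding weighted_gp_def
  using normal_rv_iexp[OF assms(1) gaussian_process_lsum[OF assms(2)]] by simp

lemma weighted_gp_cong:
  assumes "weighted_gp M D U w c m k" "\<And>x. x \<in> D \<Longrightarrow> m x = m' x"
    "\<And>x y. x \<in> D \<Longrightarrow> y \<in> D \<Longrightarrow> k x y = k' x y"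
  shows "weighted_gp M D U w c m' k'"
proof -
  have "lsum ps m = lsum ps m'" if "snd ` set ps \<subseteq> D" for ps
    by (rule lsum_cong) (use that assms(2) in blast)
  moreover have "quad k ps = quad k' ps" if "snd ` set ps \<subseteq> D" for ps
    by (rule quad_cong) (use that assms(3) in blast)
  ultimately show ?thesis using assms(1) by (simp add: weighted_gp_def)
qed

lemma lsum_measurable:
  assumes "\<And>x. x \<in> D \<Longrightarrow> (\<lambda>\<omega>. U \<omega> x) \<in> borel_measurable M" "snd ` set ps \<subseteq> D"
  shows "(\<lambda>\<omega>. lsum ps (U \<omega>)) \<in> borel_measurable M"
  using assms(2) by (induction ps) (auto intro!: borel_measurable_add borel_measurable_times assms(1))

text \<open>Bayes' rule for one observation. The likelihood, a Gaussian density in the residual, is a mixture of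
  characters \<open>iexp (\<tau> * (U z - y))\<close> with Gaussian mixing law, so by Fubini the new characteristic
  function is an integral over \<open>\<tau>\<close> of the old one with the point \<open>z\<close> of weight \<open>\<tau>\<close> added. The old one is
  the exponential of a quadratic polynomial, and completing the square in \<open>\<tau>\<close> yields exactly the
  rank-one update of mean and covariance.\<close>

lemma weighted_gp_observe:
  fixes U :: "'w \<Rightarrow> 'a \<Rightarrow> real"
  assumes M: "prob_space M" and s: "0 < \<sigma>" and z: "z \<in> D" and k: "psd_on D k"
    and U: "\<And>x. x \<in> D \<Longrightarrow> (\<lambda>\<omega>. U \<omega> x) \<in> borel_measurable M"
    and w[measurable]: "w \<in> borel_measurable M" and w0: "\<And>\<omega>. 0 \<le> w \<omega>" and wC: "\<And>\<omega>. w \<omega> \<le> C"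
    and gp: "weighted_gp M D U w c m k"
  shows "weighted_gp M D U (\<lambda>\<omega>. w \<omega> * normal_density 0 \<sigma> (y - U \<omega> z))
    (c * normal_density (m z) (sqrt (k z z + \<sigma>\<^sup>2)) y)
    (\<lambda>x. m x + k x z / (k z z + \<sigma>\<^sup>2) * (y - m z))
    (\<lambda>x x'. k x x' - k x z * k z x' / (k z z + \<sigma>\<^sup>2))"
  unfolding weighted_gp_def
proof (intro allI impI)
  fix ps :: "(real \<times> 'a) list" assume ps: "snd ` set ps \<subseteq> D"
  interpret prob_space M by fact
  define A where "A = k z z + \<sigma>\<^sup>2"
  have A: "0 < A" using psd_on_diag[OF k z] s by (simp add: A_def add_nonneg_pos)
  define b where "b = lsum ps (k z)"
  define q where "q = quad k ps"
  define u where "u = m z - y"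
  define Q where "Q = density lborel (normal_density 0 (1 / \<sigma>))"
  have [measurable_cong]: "sets Q = sets borel" by (simp add: Q_def)
  have Q: "prob_space Q" unfolding Q_def using s by (intro prob_space_normal_density) simp
  interpret Q: prob_space Q by fact
  interpret MQ: pair_prob_space M Q ..
  have [measurable]: "(\<lambda>\<omega>. U \<omega> z) \<in> borel_measurable M" "(\<lambda>\<omega>. lsum ps (U \<omega>)) \<in> borel_measurable M"
    using U[OF z] lsum_measurable[OF U ps] by auto
  have ps': "snd ` set ((\<tau>, z) # ps) \<subseteq> D" for \<tau> using ps z by simp
  \<comment> \<open>the Gaussian likelihood as a mixture of characters\<close>
  have four: "complex_of_real (normal_density 0 \<sigma> x) =
      complex_of_real (1 / sqrt (2 * pi * \<sigma>\<^sup>2)) * (CLINT \<tau>|Q. iexp (\<tau> * (- x)))" for x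
  proof -
    have "(CLINT \<tau>|Q. iexp (\<tau> * (- x))) = char Q (- x)" by (simp add: char_def mult.commute)
    also have "\<dots> = complex_of_real (exp (- (x\<^sup>2 / (2 * \<sigma>\<^sup>2))))"
      unfolding Q_def exp_of_real[symmetric] using s
      by (subst char_normal_distribution) (auto simp: power_divide mult.commute)
    finally show ?thesis by (simp add: normal_density_def)
  qed
  define g where "g \<omega> \<tau> = complex_of_real (w \<omega>) * iexp (\<tau> * (- (y - U \<omega> z))) * iexp (lsum ps (U \<omega>))" for \<omega> \<tau>
  have gm: "(\<lambda>p. g (fst p) (snd p)) \<in> borel_measurable (M \<Otimes>\<^sub>M Q)"
    unfolding g_def by measurable
  have gi: "integrable (M \<Otimes>\<^sub>M Q) (\<lambda>(\<omega>, \<tau>). g \<omega> \<tau>)"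
  proof (rule MQ.integrable_const_bound[where B=C])
    show "AE p in M \<Otimes>\<^sub>M Q. norm (case p of (\<omega>, \<tau>) \<Rightarrow> g \<omega> \<tau>) \<le> C"
      using w0 wC by (auto simp: g_def norm_mult)
  qed (use gm in \<open>simp add: case_prod_beta'\<close>)
  have "(CLINT \<omega>|M. complex_of_real (w \<omega> * normal_density 0 \<sigma> (y - U \<omega> z)) * iexp (lsum ps (U \<omega>))) =
      (CLINT \<omega>|M. complex_of_real (1 / sqrt (2 * pi * \<sigma>\<^sup>2)) * (CLINT \<tau>|Q. g \<omega> \<tau>))"
    by (intro Bochner_Integration.integral_cong) (simp_all add: g_def four mult_ac)
  also have "\<dots> = complex_of_real (1 / sqrt (2 * pi * \<sigma>\<^sup>2)) * (CLINT \<omega>|M. (CLINT \<tau>|Q. g \<omega> \<tau>))"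
    by simp
  also have "(CLINT \<omega>|M. (CLINT \<tau>|Q. g \<omega> \<tau>)) = (CLINT \<tau>|Q. (CLINT \<omega>|M. g \<omega> \<tau>))"
    using MQ.Fubini_integral[OF gi] by simp
  also have "(CLINT \<tau>|Q. (CLINT \<omega>|M. g \<omega> \<tau>)) = (CLINT \<tau>|Q. complex_of_real c *
      exp (\<i> * complex_of_real (lsum ps m) - complex_of_real (q / 2)) *
      (complex_of_real (exp (- (\<tau>\<^sup>2 * k z z + 2 * \<tau> * b) / 2)) * iexp (u * \<tau>)))"
  proof (rule Bochner_Integration.integral_cong[OF refl])
    fix \<tau>
    have "(CLINT \<omega>|M. g \<omega> \<tau>) = (CLINT \<omega>|M. iexp (- (\<tau> * y)) * (complex_of_real (w \<omega>) * iexp (lsum ((\<tau>, z) # ps) (U \<omega>))))"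
    proof (rule Bochner_Integration.integral_cong[OF refl])
      fix \<omega>
      have "iexp (\<tau> * (- (y - U \<omega> z))) * iexp (lsum ps (U \<omega>)) = iexp (- (\<tau> * y)) * iexp (lsum ((\<tau>, z) # ps) (U \<omega>))"
        unfolding exp_add[symmetric] by (rule arg_cong[where f=exp]) (simp add: algebra_simps)
      then show "g \<omega> \<tau> = iexp (- (\<tau> * y)) * (complex_of_real (w \<omega>) * iexp (lsum ((\<tau>, z) # ps) (U \<omega>)))"
        by (simp only: g_def mult.assoc mult.left_commute)
    qed
    also have "\<dots> = iexp (- (\<tau> * y)) * (complex_of_real c *
        exp (\<i> * complex_of_real (lsum ((\<tau>, z) # ps) m) - complex_of_real (quad k ((\<tau>, z) # ps) / 2)))"
      using gp[unfolded weighted_gp_def, rule_format, OF ps'[of \<tau>]] by (simp only: integral_mult_right_zero)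
    also have "\<dots> = iexp (- (\<tau> * y)) * (complex_of_real c *
        exp (\<i> * complex_of_real (\<tau> * m z + lsum ps m) - complex_of_real ((\<tau>\<^sup>2 * k z z + 2 * \<tau> * b + q) / 2)))"
      by (simp only: psd_on_quad_Cons[OF k ps z] lsum_Cons b_def q_def)
    also have "\<dots> = complex_of_real c *
        (exp (\<i> * complex_of_real (lsum ps m) - complex_of_real (q / 2)) *
        (exp (complex_of_real (- (\<tau>\<^sup>2 * k z z + 2 * \<tau> * b) / 2)) * iexp (u * \<tau>)))"
      unfolding exp_add[symmetric] mult.left_commute[of "iexp (- (\<tau> * y))"]
      by (intro arg_cong2[where f="(*)"] arg_cong[where f=exp] refl)
        (simp add: u_def algebra_simps add_divide_distrib diff_divide_distrib)
    finally show "(CLINT \<omega>|M. g \<omega> \<tau>) = complex_of_real c *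
      exp (\<i> * complex_of_real (lsum ps m) - complex_of_real (q / 2)) *
      (complex_of_real (exp (- (\<tau>\<^sup>2 * k z z + 2 * \<tau> * b) / 2)) * iexp (u * \<tau>))"
      by (simp only: exp_of_real mult.assoc)
  qed
  also have "\<dots> = complex_of_real c * exp (\<i> * complex_of_real (lsum ps m) - complex_of_real (q / 2)) *
      (CLINT \<tau>|Q. complex_of_real (exp (- (\<tau>\<^sup>2 * k z z + 2 * \<tau> * b) / 2)) * iexp (u * \<tau>))"
    by simp
  also have "(CLINT \<tau>|Q. complex_of_real (exp (- (\<tau>\<^sup>2 * k z z + 2 * \<tau> * b) / 2)) * iexp (u * \<tau>)) =
      (CLINT \<tau>|lborel. normal_density 0 (1 / \<sigma>) \<tau> *\<^sub>R (complex_of_real (exp (- (\<tau>\<^sup>2 * k z z + 2 * \<tau> * b) / 2)) * iexp (u * \<tau>)))"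
    unfolding Q_def by (intro integral_density) auto
  also have "\<dots> = (CLINT \<tau>|lborel. complex_of_real (\<sigma> / sqrt A * exp (b\<^sup>2 / (2 * A))) *
      (normal_density (- b / A) (1 / sqrt A) \<tau> *\<^sub>R iexp (u * \<tau>)))"
  \<comment> \<open>completing the square: the linear term \<open>b\<close> only shifts the mixing law by the real number \<open>- b / A\<close>\<close>
  proof (rule Bochner_Integration.integral_cong[OF refl])
    fix \<tau>
    have e: "- (\<tau> - 0)\<^sup>2 / (2 * (1 / \<sigma>)\<^sup>2) + - (\<tau>\<^sup>2 * k z z + 2 * \<tau> * b) / 2 =
        b\<^sup>2 / (2 * A) + - (\<tau> - - b / A)\<^sup>2 / (2 * (1 / sqrt A)\<^sup>2)"
    proof -
      have "- (\<tau> - - b / A)\<^sup>2 / (2 * (1 / sqrt A)\<^sup>2) = - A * (\<tau> + b / A)\<^sup>2 / 2"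
        using A by (simp add: power_divide)
      also have "\<dots> = - A * \<tau>\<^sup>2 / 2 - \<tau> * b - b\<^sup>2 / (2 * A)"
        using A by (simp add: power2_eq_square field_simps)
      finally show ?thesis using s by (simp add: A_def power_divide field_simps)
    qed
    have n: "1 / sqrt (2 * pi * (1 / \<sigma>)\<^sup>2) = \<sigma> / sqrt A * (1 / sqrt (2 * pi * (1 / sqrt A)\<^sup>2))"
      using s A by (simp add: power_divide real_sqrt_divide real_sqrt_mult)
    have "normal_density 0 (1 / \<sigma>) \<tau> * exp (- (\<tau>\<^sup>2 * k z z + 2 * \<tau> * b) / 2) =
        \<sigma> / sqrt A * exp (b\<^sup>2 / (2 * A)) * normal_density (- b / A) (1 / sqrt A) \<tau>"
      unfolding normal_density_def n using e by (simp add: exp_add[symmetric] mult.assoc mult.left_commute[of "exp _"])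
    then have "complex_of_real (normal_density 0 (1 / \<sigma>) \<tau>) * complex_of_real (exp (- (\<tau>\<^sup>2 * k z z + 2 * \<tau> * b) / 2)) =
        complex_of_real (\<sigma> / sqrt A * exp (b\<^sup>2 / (2 * A))) * complex_of_real (normal_density (- b / A) (1 / sqrt A) \<tau>)"
      unfolding of_real_mult[symmetric] by simp
    then show "normal_density 0 (1 / \<sigma>) \<tau> *\<^sub>R (complex_of_real (exp (- (\<tau>\<^sup>2 * k z z + 2 * \<tau> * b) / 2)) * iexp (u * \<tau>)) =
      complex_of_real (\<sigma> / sqrt A * exp (b\<^sup>2 / (2 * A))) * (normal_density (- b / A) (1 / sqrt A) \<tau> *\<^sub>R iexp (u * \<tau>))"
      unfolding scaleR_conv_of_real mult.assoc[symmetric] by simp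
  qed
  also have "\<dots> = complex_of_real (\<sigma> / sqrt A * exp (b\<^sup>2 / (2 * A))) *
      (CLINT \<tau>|lborel. normal_density (- b / A) (1 / sqrt A) \<tau> *\<^sub>R iexp (u * \<tau>))"
    by (rule integral_mult_right_zero)
  also have "(CLINT \<tau>|lborel. normal_density (- b / A) (1 / sqrt A) \<tau> *\<^sub>R iexp (u * \<tau>)) =
      char (density lborel (normal_density (- b / A) (1 / sqrt A))) u"
    unfolding char_def by (intro integral_density[symmetric]) auto
  also have "\<dots> = exp (\<i> * complex_of_real (u * (- b / A)) - complex_of_real (u\<^sup>2 / (2 * A)))"
    using A by (subst char_normal_distribution) (simp_all add: power_divide mult.commute)
  finally have "(CLINT \<omega>|M. complex_of_real (w \<omega> * normal_density 0 \<sigma> (y - U \<omega> z)) * iexp (lsum ps (U \<omega>))) =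
      complex_of_real (1 / sqrt (2 * pi * \<sigma>\<^sup>2)) *
      (complex_of_real c * exp (\<i> * complex_of_real (lsum ps m) - complex_of_real (q / 2)) *
       (complex_of_real (\<sigma> / sqrt A * exp (b\<^sup>2 / (2 * A))) *
        exp (\<i> * complex_of_real (u * (- b / A)) - complex_of_real (u\<^sup>2 / (2 * A)))))" .
  also have "\<dots> = complex_of_real c * complex_of_real (1 / sqrt (2 * pi * \<sigma>\<^sup>2) * (\<sigma> / sqrt A)) *
      exp ((\<i> * complex_of_real (lsum ps m) - complex_of_real (q / 2)) + complex_of_real (b\<^sup>2 / (2 * A)) +
        (\<i> * complex_of_real (u * (- b / A)) - complex_of_real (u\<^sup>2 / (2 * A))))"
    unfolding exp_add exp_of_real of_real_mult by (simp only: mult_ac)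
  also have "\<dots> = complex_of_real c * complex_of_real (1 / sqrt (2 * pi * A)) *
      exp (complex_of_real (- u\<^sup>2 / (2 * A)) +
        (\<i> * complex_of_real (lsum ps m + b / A * (y - m z)) - complex_of_real ((q - b\<^sup>2 / A) / 2)))"
  proof (intro arg_cong2[where f="(*)"] arg_cong[where f=exp] refl)
    have "1 / sqrt (2 * pi * \<sigma>\<^sup>2) * (\<sigma> / sqrt A) = 1 / sqrt (2 * pi * A)"
      using s A by (simp add: real_sqrt_mult)
    then show "complex_of_real (1 / sqrt (2 * pi * \<sigma>\<^sup>2) * (\<sigma> / sqrt A)) = complex_of_real (1 / sqrt (2 * pi * A))"
      by simp
    have "u * (- b / A) = b / A * (y - m z)" by (simp add: u_def algebra_simps diff_divide_distrib)
    then show "(\<i> * complex_of_real (lsum ps m) - complex_of_real (q / 2)) + complex_of_real (b\<^sup>2 / (2 * A)) +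
        (\<i> * complex_of_real (u * (- b / A)) - complex_of_real (u\<^sup>2 / (2 * A))) =
      complex_of_real (- u\<^sup>2 / (2 * A)) +
        (\<i> * complex_of_real (lsum ps m + b / A * (y - m z)) - complex_of_real ((q - b\<^sup>2 / A) / 2))"
      by (simp add: algebra_simps diff_divide_distrib)
  qed
  also have "\<dots> = complex_of_real (c * (1 / sqrt (2 * pi * A) * exp (- u\<^sup>2 / (2 * A)))) *
      exp (\<i> * complex_of_real (lsum ps m + b / A * (y - m z)) - complex_of_real ((q - b\<^sup>2 / A) / 2))"
    unfolding exp_add exp_of_real of_real_mult by (simp only: mult_ac)
  also have "1 / sqrt (2 * pi * A) * exp (- u\<^sup>2 / (2 * A)) = normal_density (m z) (sqrt (k z z + \<sigma>\<^sup>2)) y"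
    using A unfolding A_def[symmetric] normal_density_def u_def by (simp add: power2_commute)
  also have "lsum ps m + b / A * (y - m z) = lsum ps (\<lambda>x. m x + k x z / (k z z + \<sigma>\<^sup>2) * (y - m z))"
  proof -
    have "lsum ps (\<lambda>p. k p z) = b"
      unfolding b_def by (rule lsum_cong) (use ps z k in \<open>auto intro: psd_onD_sym\<close>)
    then show ?thesis by (simp only: lsum_add lsum_mult_right lsum_divide A_def)
  qed
  also have "q - b\<^sup>2 / A = quad (\<lambda>x x'. k x x' - k x z * k z x' / (k z z + \<sigma>\<^sup>2)) ps"
    using quad_rank_one_update[OF k ps z] by (simp add: q_def b_def A_def)
  finally show "(CLINT \<omega>|M. complex_of_real (w \<omega> * normal_density 0 \<sigma> (y - U \<omega> z)) * iexp (lsum ps (U \<omega>))) =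
     complex_of_real (c * normal_density (m z) (sqrt (k z z + \<sigma>\<^sup>2)) y) *
     exp (\<i> * complex_of_real (lsum ps (\<lambda>x. m x + k x z / (k z z + \<sigma>\<^sup>2) * (y - m z))) -
       complex_of_real (quad (\<lambda>x x'. k x x' - k x z * k z x' / (k z z + \<sigma>\<^sup>2)) ps / 2))" .
qed

definition likelihood :: "real \<Rightarrow> 'a list \<Rightarrow> real list \<Rightarrow> ('a \<Rightarrow> real) \<Rightarrow> real" where
  "likelihood \<sigma> xs ys u = (\<Prod>i<length xs. normal_density 0 \<sigma> (ys ! i - u (xs ! i)))"

lemma likelihood_snoc:
  "length ys = length xs \<Longrightarrow>
    likelihood \<sigma> (xs @ [x]) (ys @ [y]) u = likelihood \<sigma> xs ys u * normal_density 0 \<sigma> (y - u x)"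
  by (simp add: likelihood_def nth_append)

lemma likelihood_nonneg: "0 \<le> likelihood \<sigma> xs ys u"
  by (simp add: likelihood_def prod_nonneg)

lemma normal_density_le: "0 < \<sigma> \<Longrightarrow> normal_density \<mu> \<sigma> x \<le> 1 / sqrt (2 * pi * \<sigma>\<^sup>2)"
  by (simp add: normal_density_def divide_right_mono)

lemma likelihood_le: "0 < \<sigma> \<Longrightarrow> likelihood \<sigma> xs ys u \<le> (1 / sqrt (2 * pi * \<sigma>\<^sup>2)) ^ length xs"
  unfolding likelihood_def
  using prod_mono[of "{..<length xs}" "\<lambda>i. normal_density 0 \<sigma> (ys ! i - u (xs ! i))" "\<lambda>_. 1 / sqrt (2 * pi * \<sigma>\<^sup>2)"]
  by (simp add: normal_density_le)

lemma likelihood_measurable: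
  assumes "\<And>x. x \<in> D \<Longrightarrow> (\<lambda>\<omega>. U \<omega> x) \<in> borel_measurable M" "set xs \<subseteq> D"
  shows "(\<lambda>\<omega>. likelihood \<sigma> xs ys (U \<omega>)) \<in> borel_measurable M"
proof -
  have "(\<lambda>\<omega>. U \<omega> (xs ! i)) \<in> borel_measurable M" if "i < length xs" for i
    using assms that nth_mem by blast
  then show ?thesis
    unfolding likelihood_def
    by (intro borel_measurable_prod measurable_compose[OF _ borel_measurable_normal_density] borel_measurable_diff) auto
qed

context gp_prior
begin

lemma weighted_gp_posterior:
  assumes M: "prob_space M" and gp: "gaussian_process M D (\<lambda>_. 0) k U"
    and "set xs \<subseteq> D" "length ys = length xs"
  shows "\<exists>c>0. weighted_gp M D U (\<lambda>\<omega>. likelihood \<sigma> xs ys (U \<omega>)) c (post_mean k \<sigma> xs ys) (post_cov k \<sigma> xs)"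
  using assms(3,4)
proof (induction xs arbitrary: ys rule: rev_induct)
  case Nil
  have "post_mean k \<sigma> [] ys = (\<lambda>_. 0)" by (intro ext) simp
  then show ?case
    using weighted_gp_cong[OF gaussian_process_weighted[OF M gp], of "post_mean k \<sigma> [] ys" "post_cov k \<sigma> []"]
    by (intro exI[of _ 1]) (simp add: likelihood_def)
next
  case (snoc x xs)
  then obtain ys' y where ys: "ys = ys' @ [y]" "length ys' = length xs"
    by (cases ys rule: rev_cases) auto
  have D: "set xs \<subseteq> D" "x \<in> D" using snoc.prems by auto
  obtain c where c: "c > 0" and
    IH: "weighted_gp M D U (\<lambda>\<omega>. likelihood \<sigma> xs ys' (U \<omega>)) c (post_mean k \<sigma> xs ys') (post_cov k \<sigma> xs)"
    using snoc.IH[OF D(1) ys(2)] by blast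
  note U = gaussian_process_measurable[OF gp]
  let ?A = "post_cov k \<sigma> xs x x + \<sigma>\<^sup>2"
  have A: "0 < ?A" using post_var_noise_pos[OF D] by (simp add: post_var_def)
  have "weighted_gp M D U (\<lambda>\<omega>. likelihood \<sigma> xs ys' (U \<omega>) * normal_density 0 \<sigma> (y - U \<omega> x))
    (c * normal_density (post_mean k \<sigma> xs ys' x) (sqrt ?A) y)
    (\<lambda>z. post_mean k \<sigma> xs ys' z + post_cov k \<sigma> xs z x / ?A * (y - post_mean k \<sigma> xs ys' x))
    (\<lambda>z z'. post_cov k \<sigma> xs z z' - post_cov k \<sigma> xs z x * post_cov k \<sigma> xs x z' / ?A)"
    by (rule weighted_gp_observe[OF M noise_pos D(2) psd_post_cov[OF D(1)] U
          likelihood_measurable[OF U D(1)] likelihood_nonneg likelihood_le[OF noise_pos] IH])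
  then have "weighted_gp M D U (\<lambda>\<omega>. likelihood \<sigma> (xs @ [x]) ys (U \<omega>))
    (c * normal_density (post_mean k \<sigma> xs ys' x) (sqrt ?A) y)
    (post_mean k \<sigma> (xs @ [x]) ys) (post_cov k \<sigma> (xs @ [x]))"
    unfolding likelihood_snoc[OF ys(2)] ys(1)
    by (rule weighted_gp_cong)
      (simp_all add: post_mean_update[OF D _ ys(2)] post_cov_update[OF D] post_var_def)
  moreover have "0 < c * normal_density (post_mean k \<sigma> xs ys' x) (sqrt ?A) y"
    using c A by (simp add: normal_density_pos)
  ultimately show ?case by blast
qed

text \<open>For a fixed design and fixed observations, integrating against the likelihood amounts, up to
  normalisation, to conditioning on the observations. This is the statement that the posterior at
  \<open>z\<close> is normal with the posterior mean and variance, in the form that survives adaptive designs.\<close>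

lemma posterior_tail:
  assumes M: "prob_space M" and gp: "gaussian_process M D (\<lambda>_. 0) k U"
    and xs: "set xs \<subseteq> D" and l: "length ys = length xs" and z: "z \<in> D" and a: "0 \<le> a"
  shows "(\<integral>\<^sup>+\<omega>. ennreal (likelihood \<sigma> xs ys (U \<omega>)) *
      indicator {\<omega>. a * sqrt (post_var k \<sigma> xs z) < \<bar>U \<omega> z - post_mean k \<sigma> xs ys z\<bar>} \<omega> \<partial>M) \<le>
    ennreal (2 * exp (- a\<^sup>2 / 2)) * (\<integral>\<^sup>+\<omega>. ennreal (likelihood \<sigma> xs ys (U \<omega>)) \<partial>M)"
proof -
  obtain c where c: "c > 0" and
    W: "weighted_gp M D U (\<lambda>\<omega>. likelihood \<sigma> xs ys (U \<omega>)) c (post_mean k \<sigma> xs ys) (post_cov k \<sigma> xs)"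
    using weighted_gp_posterior[OF M gp xs l] by blast
  note U = gaussian_process_measurable[OF gp]
  have "(CLINT \<omega>|M. complex_of_real (likelihood \<sigma> xs ys (U \<omega>)) * iexp (t * U \<omega> z)) =
      complex_of_real c * exp (\<i> * complex_of_real (t * post_mean k \<sigma> xs ys z) -
        complex_of_real (post_var k \<sigma> xs z * t\<^sup>2 / 2))" for t
    using W[unfolded weighted_gp_def, rule_format, of "[(t, z)]"] z
    by (simp add: quad_def post_var_def power2_eq_square mult_ac)
  from Gaussian_char_tail[OF M U[OF z] likelihood_measurable[OF U xs] likelihood_nonneg
      likelihood_le[OF noise_pos] c post_var_nonneg[OF xs z] a this]
  show ?thesis .
qed

end

section \<open>Adaptively chosen sampling points\<close>

text \<open>The Doob-Dynkin lemma: what is measurable with respect to the history is a measurable function of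
  the past observations. A real function \<open>f\<close> is recovered from the sets \<open>{f < q}\<close> for rational \<open>q\<close>, each of
  which is a preimage of some \<open>S q\<close>; the infimum is taken in the extended reals because off the
  range of \<open>h\<close> no \<open>S q\<close> need contain the argument.\<close>

lemma measurable_factor_real:
  fixes f :: "'w \<Rightarrow> real"
  assumes h: "h \<in> \<Omega> \<rightarrow> space N" and f: "f \<in> borel_measurable (vimage_algebra \<Omega> h N)"
  shows "\<exists>g\<in>borel_measurable N. \<forall>\<omega>\<in>\<Omega>. f \<omega> = g (h \<omega>)"
proof -
  have "\<exists>S\<in>sets N. {\<omega>\<in>\<Omega>. f \<omega> < of_rat q} = h -` S \<inter> \<Omega>" for q :: rat
  proof -
    have "{\<omega>\<in>space (vimage_algebra \<Omega> h N). f \<omega> < of_rat q} \<in> sets (vimage_algebra \<Omega> h N)"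
      using f by measurable
    then show ?thesis unfolding sets_vimage_algebra2[OF h] by auto
  qed
  then obtain S where S: "\<And>q. S q \<in> sets N" "\<And>q. {\<omega>\<in>\<Omega>. f \<omega> < of_rat q} = h -` S q \<inter> \<Omega>"
    by metis
  define G where "G y = (INF q::rat. if y \<in> S q then ereal (of_rat q) else \<infinity>)" for y
  have G: "G \<in> borel_measurable N" unfolding G_def using S(1) by measurable
  have "G (h \<omega>) = ereal (f \<omega>)" if \<omega>: "\<omega> \<in> \<Omega>" for \<omega>
  proof (rule antisym)
    have iff: "h \<omega> \<in> S q \<longleftrightarrow> f \<omega> < of_rat q" for q using S(2)[of q] \<omega> by auto
    show "ereal (f \<omega>) \<le> G (h \<omega>)"
      unfolding G_def by (rule INF_greatest) (auto simp: iff)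
    show "G (h \<omega>) \<le> ereal (f \<omega>)"
    proof (rule dense_ge)
      fix x :: ereal assume x: "ereal (f \<omega>) < x"
      have "\<exists>q::rat. f \<omega> < of_rat q \<and> ereal (of_rat q) \<le> x"
      proof (cases x)
        case (real r) then show ?thesis using x of_rat_dense[of "f \<omega>" r] by (auto intro: less_imp_le)
      next
        case PInf then show ?thesis using of_rat_dense[of "f \<omega>" "f \<omega> + 1"] by auto
      qed (use x in auto)
      then obtain q where q: "f \<omega> < of_rat q" "ereal (of_rat q) \<le> x" by blast
      have "G (h \<omega>) \<le> ereal (of_rat q)" unfolding G_def by (rule INF_lower2[of q]) (auto simp: iff q)
      then show "G (h \<omega>) \<le> x" using q by simp
    qed
  qed
  then have "f \<omega> = real_of_ereal (G (h \<omega>))" if "\<omega> \<in> \<Omega>" for \<omega> using that by simp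
  then show ?thesis using G by (intro bexI[of _ "\<lambda>y. real_of_ereal (G y)"]) auto
qed

lemma measurable_factor:
  fixes f :: "'w \<Rightarrow> 'a::euclidean_space"
  assumes h: "h \<in> \<Omega> \<rightarrow> space N" and f: "f \<in> borel_measurable (vimage_algebra \<Omega> h N)"
  shows "\<exists>g\<in>borel_measurable N. \<forall>\<omega>\<in>\<Omega>. f \<omega> = g (h \<omega>)"
proof -
  have "\<forall>b. \<exists>g. g \<in> borel_measurable N \<and> (\<forall>\<omega>\<in>\<Omega>. f \<omega> \<bullet> b = g (h \<omega>))"
    using measurable_factor_real[OF h borel_measurable_inner[OF f borel_measurable_const]] by blast
  from choice[OF this] obtain g where g: "\<And>b. g b \<in> borel_measurable N" "\<And>b \<omega>. \<omega> \<in> \<Omega> \<Longrightarrow> f \<omega> \<bullet> b = g b (h \<omega>)"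
    by blast
  show ?thesis
  proof (intro bexI ballI)
    show "f \<omega> = (\<Sum>b\<in>Basis. g b (h \<omega>) *\<^sub>R b)" if "\<omega> \<in> \<Omega>" for \<omega>
      using euclidean_representation[of "f \<omega>"] g(2)[OF that] by simp
    show "(\<lambda>y. \<Sum>b\<in>Basis. g b y *\<^sub>R b) \<in> borel_measurable N" using g(1) by measurable
  qed
qed

lemma measurable_factor_into:
  fixes f :: "'w \<Rightarrow> 'a::euclidean_space"
  assumes h: "h \<in> \<Omega> \<rightarrow> space N" and f: "f \<in> borel_measurable (vimage_algebra \<Omega> h N)"
    and D: "closed D" "D \<noteq> {}" "\<And>\<omega>. \<omega> \<in> \<Omega> \<Longrightarrow> f \<omega> \<in> D"
  shows "\<exists>g\<in>borel_measurable N. (\<forall>y. g y \<in> D) \<and> (\<forall>\<omega>\<in>\<Omega>. f \<omega> = g (h \<omega>))"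
proof -
  obtain g where g: "g \<in> borel_measurable N" "\<And>\<omega>. \<omega> \<in> \<Omega> \<Longrightarrow> f \<omega> = g (h \<omega>)"
    using measurable_factor[OF h f] by blast
  obtain x where x: "x \<in> D" using D by blast
  have [measurable]: "D \<in> sets borel" using D(1) by simp
  have "(\<lambda>y. if g y \<in> D then g y else x) \<in> borel_measurable N" using g(1) by measurable
  moreover have "f \<omega> = (if g (h \<omega>) \<in> D then g (h \<omega>) else x)" if "\<omega> \<in> \<Omega>" for \<omega>
    using g(2)[OF that] D(3)[OF that] by simp
  ultimately show ?thesis using x
    by (intro bexI[of _ "\<lambda>y. if g y \<in> D then g y else x"]) simp_all
qed

text \<open>\<open>Z\<close> is approximated by its first neighbour in an enumeration of a countable dense subset; the values
  at these countably many points are measurable, and continuity passes to the limit.\<close>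

lemma Caratheodory_measurable:
  fixes U :: "'w \<Rightarrow> 'a::euclidean_space \<Rightarrow> real"
  assumes c: "\<And>\<omega>. \<omega> \<in> space N \<Longrightarrow> continuous_on D (U \<omega>)"
    and m: "\<And>x. x \<in> D \<Longrightarrow> (\<lambda>\<omega>. U \<omega> x) \<in> borel_measurable N"
    and Z[measurable]: "Z \<in> borel_measurable N" and ZD: "\<And>\<omega>. \<omega> \<in> space N \<Longrightarrow> Z \<omega> \<in> D"
  shows "(\<lambda>\<omega>. U \<omega> (Z \<omega>)) \<in> borel_measurable N"
proof (cases "D = {}")
  case True
  then have "space N = {}" using ZD by auto
  then show ?thesis by (simp add: measurable_def)
next
  case False
  obtain C where C: "countable C" "C \<subseteq> D" "D \<subseteq> closure C" using separable[of D] by metis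
  then have C0: "C \<noteq> {}" using False by auto
  define q where "q = from_nat_into C"
  have qC: "q j \<in> C" for j unfolding q_def by (rule from_nat_into[OF C0])
  have qs: "\<exists>j. q j = y" if "y \<in> C" for y
    using from_nat_into_surj[OF C(1) that] by (auto simp: q_def)
  define J where "J m \<omega> = (LEAST j. dist (q j) (Z \<omega>) < 1 / real (Suc m))" for m \<omega>
  have J: "dist (q (J m \<omega>)) (Z \<omega>) < 1 / real (Suc m)" if "\<omega> \<in> space N" for m \<omega>
  proof -
    have "Z \<omega> \<in> closure C" using ZD[OF that] C by auto
    from this[unfolded closure_approachable, rule_format, of "1 / real (Suc m)"]
    obtain y where "y \<in> C" "dist y (Z \<omega>) < 1 / real (Suc m)" by auto
    then obtain j where "dist (q j) (Z \<omega>) < 1 / real (Suc m)" using qs by blast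
    then show ?thesis unfolding J_def by (rule LeastI)
  qed
  have [measurable]: "J m \<in> measurable N (count_space UNIV)" for m unfolding J_def by measurable
  have [measurable]: "(\<lambda>\<omega>. U \<omega> (q j)) \<in> borel_measurable N" for j using qC C(2) m by auto
  have 1: "(\<lambda>\<omega>. U \<omega> (q (J m \<omega>))) \<in> borel_measurable N" for m
    by (rule measurable_compose_countable[where f="\<lambda>j \<omega>. U \<omega> (q j)"]) measurable
  show ?thesis
  proof (rule borel_measurable_LIMSEQ_real[OF _ 1])
    fix \<omega> assume \<omega>: "\<omega> \<in> space N"
    have "(\<lambda>m. dist (q (J m \<omega>)) (Z \<omega>)) \<longlonglongrightarrow> 0"
      by (rule tendsto_sandwich[OF _ _ tendsto_const LIMSEQ_inverse_real_of_nat])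
        (use J[OF \<omega>] in \<open>auto intro!: always_eventually less_imp_le simp: inverse_eq_divide\<close>)
    then have "(\<lambda>m. q (J m \<omega>)) \<longlonglongrightarrow> Z \<omega>" by (rule tendsto_dist_iff[THEN iffD2])
    then show "(\<lambda>m. U \<omega> (q (J m \<omega>))) \<longlonglongrightarrow> U \<omega> (Z \<omega>)"
      using qC C(2) by (intro continuous_on_tendsto_compose[OF c[OF \<omega>] _ ZD[OF \<omega>]]) (auto intro!: always_eventually)
  qed
qed

text \<open>The observations as a function of the noise \<open>e\<close>, when the \<open>i\<close>-th observation is a function
  \<open>g i\<close> of the earlier ones plus \<open>e i\<close>. The start value \<open>undefined\<close> makes the result an element of the
  product space over \<open>{1..n}\<close>.\<close>

primrec traj :: "(nat \<Rightarrow> (nat \<Rightarrow> real) \<Rightarrow> real) \<Rightarrow> nat \<Rightarrow> (nat \<Rightarrow> real) \<Rightarrow> nat \<Rightarrow> real" where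
  "traj g 0 e = (\<lambda>_. undefined)"
| "traj g (Suc n) e = (traj g n e)(Suc n := g (Suc n) (traj g n e) + e (Suc n))"

lemma traj_cong: "(\<And>i. i \<in> {1..n} \<Longrightarrow> e i = e' i) \<Longrightarrow> traj g n e = traj g n e'"
  by (induction n) auto

lemma traj_measurable:
  assumes "\<And>i. 1 \<le> i \<Longrightarrow> (\<lambda>(\<omega>, y). g \<omega> i y) \<in> borel_measurable (N \<Otimes>\<^sub>M Pi\<^sub>M {1..<i} (\<lambda>_. borel))" "n \<le> m"
  shows "(\<lambda>(\<omega>, e). traj (g \<omega>) n e) \<in> measurable (N \<Otimes>\<^sub>M Pi\<^sub>M {1..m} (\<lambda>_. borel)) (Pi\<^sub>M {1..n} (\<lambda>_. borel))"
  using assms(2)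
proof (induction n)
  case 0
  show ?case by (auto intro!: measurable_PiM_single' simp: case_prod_beta')
next
  case (Suc n)
  have e: "{1..<Suc n} = {1..n}" by auto
  let ?N = "N \<Otimes>\<^sub>M Pi\<^sub>M {1..m} (\<lambda>_. borel :: real measure)"
  have IH[measurable]: "(\<lambda>p. traj (g (fst p)) n (snd p)) \<in> measurable ?N (Pi\<^sub>M {1..n} (\<lambda>_. borel))"
    using Suc by (simp add: case_prod_beta')
  have g[measurable]: "(\<lambda>p. g (fst p) (Suc n) (snd p)) \<in> borel_measurable (N \<Otimes>\<^sub>M Pi\<^sub>M {1..n} (\<lambda>_. borel))"
    using assms(1)[of "Suc n", unfolded e] by (simp add: case_prod_beta')
  have "(\<lambda>p. (fst p, traj (g (fst p)) n (snd p))) \<in> measurable ?N (N \<Otimes>\<^sub>M Pi\<^sub>M {1..n} (\<lambda>_. borel))"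
    by measurable
  from measurable_compose[OF this g]
  have g1: "(\<lambda>p. g (fst p) (Suc n) (traj (g (fst p)) n (snd p))) \<in> borel_measurable ?N" by simp
  have s1: "(\<lambda>p. snd p (Suc n)) \<in> borel_measurable ?N"
    using Suc.prems by (intro measurable_compose[OF measurable_snd] measurable_component_singleton) auto
  have "(\<lambda>p. (traj (g (fst p)) n (snd p))(Suc n := g (fst p) (Suc n) (traj (g (fst p)) n (snd p)) + snd p (Suc n)))
      \<in> measurable ?N (Pi\<^sub>M {1..Suc n} (\<lambda>_. borel))"
    by (rule measurable_fun_upd[OF _ IH borel_measurable_add[OF g1 s1]]) auto
  then show ?case unfolding case_prod_beta' traj.simps .
qed

text \<open>The map from noise to observations is a triangular system of translations, so it preserves
  Lebesgue measure. Hence, although the design reacts to the data, the observations have the density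
  of independent normal variables with means \<open>g i\<close> of the earlier observations.\<close>

lemma nn_integral_traj:
  fixes g :: "nat \<Rightarrow> (nat \<Rightarrow> real) \<Rightarrow> real"
  assumes s: "0 < \<sigma>"
    and g: "\<And>i. 1 \<le> i \<Longrightarrow> g i \<in> borel_measurable (Pi\<^sub>M {1..<i} (\<lambda>_. borel))"
    and h: "h \<in> borel_measurable (Pi\<^sub>M {1..n} (\<lambda>_. borel :: real measure))"
  shows "(\<integral>\<^sup>+e. h (traj g n e) \<partial>Pi\<^sub>M {1..n} (\<lambda>_. density lborel (normal_density 0 \<sigma>))) =
    (\<integral>\<^sup>+y. h y * ennreal (\<Prod>i\<in>{1..n}. normal_density 0 \<sigma> (y i - g i (restrict y {1..<i}))) \<partial>Pi\<^sub>M {1..n} (\<lambda>_. lborel))"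
  using h
proof (induction n arbitrary: h)
  case 0
  then show ?case by (simp add: nn_integral_count_space_finite PiM_empty)
next
  case (Suc n)
  let ?N = "density lborel (normal_density 0 \<sigma>)"
  interpret N: prob_space ?N using s by (rule prob_space_normal_density)
  interpret PN: product_sigma_finite "\<lambda>_::nat. ?N" ..
  interpret PL: product_sigma_finite "\<lambda>_::nat. lborel :: real measure" ..
  have ins: "{1..Suc n} = insert (Suc n) {1..n}" and e: "{1..<Suc n} = {1..n}" by auto
  have sN: "sets (Pi\<^sub>M I (\<lambda>_. ?N)) = sets (Pi\<^sub>M I (\<lambda>_. borel))"
    and sL: "sets (Pi\<^sub>M I (\<lambda>_. lborel)) = sets (Pi\<^sub>M I (\<lambda>_. borel :: real measure))" for I :: "nat set"
    by (auto intro!: sets_PiM_cong)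
  have h[measurable]: "h \<in> borel_measurable (Pi\<^sub>M (insert (Suc n) {1..n}) (\<lambda>_. borel))" using Suc.prems ins by simp
  have gn[measurable]: "g (Suc n) \<in> borel_measurable (Pi\<^sub>M {1..n} (\<lambda>_. borel))" using g[of "Suc n", unfolded e] by simp
  have gi: "(\<lambda>y. g i (restrict y {1..<i})) \<in> borel_measurable (Pi\<^sub>M {1..m} (\<lambda>_. borel))" if "i \<in> {1..m}" for i m
    using that by (intro measurable_compose[OF measurable_restrict_subset g]) auto
  define L where "L m y = (\<Prod>i\<in>{1..m}. normal_density 0 \<sigma> (y i - g i (restrict y {1..<i})))" for m y
  have Lm[measurable]: "L m \<in> borel_measurable (Pi\<^sub>M {1..m} (\<lambda>_. borel))" for m
    unfolding L_def
    by (intro borel_measurable_prod measurable_compose[OF _ borel_measurable_normal_density] borel_measurable_diff gi)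
      (auto intro: measurable_component_singleton)
  have upd: "(\<lambda>(y, s). y(Suc n := s)) \<in> measurable (Pi\<^sub>M {1..n} (\<lambda>_. borel) \<Otimes>\<^sub>M borel) (Pi\<^sub>M (insert (Suc n) {1..n}) (\<lambda>_. borel :: real measure))"
    using measurable_add_dim[of "Suc n" "{1..n}" "\<lambda>_. borel :: real measure"] by (simp add: case_prod_beta')
  have hu[measurable]: "(\<lambda>p. h ((fst p)(Suc n := snd p))) \<in> borel_measurable (Pi\<^sub>M {1..n} (\<lambda>_. borel) \<Otimes>\<^sub>M borel)"
    using measurable_compose[OF upd h] by (simp add: case_prod_beta')
  have LS: "L (Suc n) (y(Suc n := s)) = L n y * normal_density 0 \<sigma> (s - g (Suc n) y)"
    if "y \<in> space (Pi\<^sub>M {1..n} (\<lambda>_. borel))" for y s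
  proof -
    have "restrict (y(Suc n := s)) {1..<Suc n} = y"
      using that unfolding e by (auto simp: space_PiM PiE_def extensional_def)
    moreover have "(\<Prod>i\<in>{1..n}. normal_density 0 \<sigma> ((y(Suc n := s)) i - g i (restrict (y(Suc n := s)) {1..<i}))) = L n y"
      unfolding L_def
    proof (rule prod.cong[OF refl])
      fix i assume i: "i \<in> {1..n}"
      then have "restrict (y(Suc n := s)) {1..<i} = restrict y {1..<i}" by (auto simp: restrict_def)
      then show "normal_density 0 \<sigma> ((y(Suc n := s)) i - g i (restrict (y(Suc n := s)) {1..<i})) =
          normal_density 0 \<sigma> (y i - g i (restrict y {1..<i}))" using i by simp
    qed
    ultimately show ?thesis unfolding L_def[of "Suc n"] by simp
  qed
  define H where "H y = (\<integral>\<^sup>+s. h (y(Suc n := s)) * ennreal (normal_density 0 \<sigma> (s - g (Suc n) y)) \<partial>lborel)" for y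
  have Hm: "H \<in> borel_measurable (Pi\<^sub>M {1..n} (\<lambda>_. borel))"
    unfolding H_def
    by (rule sigma_finite_measure.borel_measurable_nn_integral[OF lborel.sigma_finite_measure_axioms]) measurable
  have tm: "traj g (Suc n) \<in> measurable (Pi\<^sub>M {1..Suc n} (\<lambda>_. borel)) (Pi\<^sub>M {1..Suc n} (\<lambda>_. borel))"
  proof -
    have "(\<lambda>(\<omega>::unit, e). traj ((\<lambda>_. g) \<omega>) (Suc n) e) \<in> measurable (count_space UNIV \<Otimes>\<^sub>M Pi\<^sub>M {1..Suc n} (\<lambda>_. borel)) (Pi\<^sub>M {1..Suc n} (\<lambda>_. borel))"
      by (rule traj_measurable) (use g in \<open>simp_all add: case_prod_beta' measurable_compose[OF measurable_snd]\<close>)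
    from measurable_compose[OF _ this, of "\<lambda>e. ((), e)" "Pi\<^sub>M {1..Suc n} (\<lambda>_. borel)"]
    show ?thesis by (simp del: traj.simps)
  qed
  have m1: "(\<lambda>e. h (traj g (Suc n) e)) \<in> borel_measurable (Pi\<^sub>M (insert (Suc n) {1..n}) (\<lambda>_. ?N))"
    using measurable_compose[OF tm Suc.prems] unfolding ins measurable_cong_sets[OF sN refl] .
  have m2: "(\<lambda>y. h y * ennreal (L (Suc n) y)) \<in> borel_measurable (Pi\<^sub>M (insert (Suc n) {1..n}) (\<lambda>_. lborel))"
    unfolding measurable_cong_sets[OF sL refl] using Lm[of "Suc n", unfolded ins] by measurable
  have "(\<integral>\<^sup>+e. h (traj g (Suc n) e) \<partial>Pi\<^sub>M {1..Suc n} (\<lambda>_. ?N)) =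
      (\<integral>\<^sup>+e. \<integral>\<^sup>+s. h (traj g (Suc n) (e(Suc n := s))) \<partial>?N \<partial>Pi\<^sub>M {1..n} (\<lambda>_. ?N))"
    unfolding ins
    by (rule PN.product_nn_integral_insert[OF _ _ m1]) auto
  also have "\<dots> = (\<integral>\<^sup>+e. H (traj g n e) \<partial>Pi\<^sub>M {1..n} (\<lambda>_. ?N))"
  proof (rule nn_integral_cong)
    fix e assume "e \<in> space (Pi\<^sub>M {1..n} (\<lambda>_. ?N))"
    have t: "traj g n (e(Suc n := s)) = traj g n e" for s by (rule traj_cong) auto
    have ts: "traj g n e \<in> space (Pi\<^sub>M {1..n} (\<lambda>_. borel))"
      by (induction n) (auto simp: space_PiM PiE_def extensional_def)
    define y where "y = traj g n e"
    have hs[measurable]: "(\<lambda>s. h (y(Suc n := s))) \<in> borel_measurable borel"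
      using measurable_compose[OF measurable_Pair1'[OF ts] hu] by (simp add: y_def)
    have "(\<integral>\<^sup>+s. h (traj g (Suc n) (e(Suc n := s))) \<partial>?N) = (\<integral>\<^sup>+s. h (y(Suc n := g (Suc n) y + s)) \<partial>?N)"
      by (simp add: t y_def)
    also have "\<dots> = (\<integral>\<^sup>+s. ennreal (normal_density 0 \<sigma> s) * h (y(Suc n := g (Suc n) y + s)) \<partial>lborel)"
      by (subst nn_integral_density) (auto intro!: measurable_compose[OF _ hs])
    also have "\<dots> = H y"
      unfolding H_def by (subst nn_integral_real_affine[where c=1 and t="g (Suc n) y"]) (auto simp: mult.commute)
    finally show "(\<integral>\<^sup>+s. h (traj g (Suc n) (e(Suc n := s))) \<partial>?N) = H (traj g n e)" by (simp add: y_def)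
  qed
  also have "\<dots> = (\<integral>\<^sup>+y. H y * ennreal (L n y) \<partial>Pi\<^sub>M {1..n} (\<lambda>_. lborel))"
    unfolding L_def by (rule Suc.IH[OF Hm])
  also have "\<dots> = (\<integral>\<^sup>+y. \<integral>\<^sup>+s. h (y(Suc n := s)) * ennreal (L (Suc n) (y(Suc n := s))) \<partial>lborel \<partial>Pi\<^sub>M {1..n} (\<lambda>_. lborel))"
  proof (rule nn_integral_cong)
    fix y assume "y \<in> space (Pi\<^sub>M {1..n} (\<lambda>_. lborel :: real measure))"
    then have y: "y \<in> space (Pi\<^sub>M {1..n} (\<lambda>_. borel))" by (simp add: space_PiM)
    have hs[measurable]: "(\<lambda>s. h (y(Suc n := s))) \<in> borel_measurable borel"
      using measurable_compose[OF measurable_Pair1'[OF y] hu] by simp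
    have "H y * ennreal (L n y) = (\<integral>\<^sup>+s. h (y(Suc n := s)) * ennreal (normal_density 0 \<sigma> (s - g (Suc n) y)) * ennreal (L n y) \<partial>lborel)"
      unfolding H_def by (rule nn_integral_multc[symmetric]) measurable
    also have "\<dots> = (\<integral>\<^sup>+s. h (y(Suc n := s)) * ennreal (L (Suc n) (y(Suc n := s))) \<partial>lborel)"
      by (intro nn_integral_cong) (simp add: LS[OF y] ennreal_mult'' mult_ac)
    finally show "H y * ennreal (L n y) = (\<integral>\<^sup>+s. h (y(Suc n := s)) * ennreal (L (Suc n) (y(Suc n := s))) \<partial>lborel)" .
  qed
  also have "\<dots> = (\<integral>\<^sup>+y. h y * ennreal (L (Suc n) y) \<partial>Pi\<^sub>M {1..Suc n} (\<lambda>_. lborel))"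
    unfolding ins
    by (rule PL.product_nn_integral_insert[OF _ _ m2, symmetric]) auto
  finally show ?case unfolding L_def .
qed

section \<open>Concentration of the posterior along an adaptive run\<close>

locale gp_run = gp_prior D k \<sigma>
  for D :: "'a::euclidean_space set" and k :: "'a \<Rightarrow> 'a \<Rightarrow> real" and \<sigma> :: real +
  fixes M :: "'w measure" and U :: "'w \<Rightarrow> 'a \<Rightarrow> real" and \<epsilon> :: "nat \<Rightarrow> 'w \<Rightarrow> real"
    and X :: "nat \<Rightarrow> 'w \<Rightarrow> 'a"
  assumes prob: "prob_space M"
    and gp: "gaussian_process M D (\<lambda>_. 0) k U"
    and U_continuous: "\<And>\<omega>. \<omega> \<in> space M \<Longrightarrow> continuous_on D (U \<omega>)"
    and k_continuous: "continuous_on (D \<times> D) (\<lambda>(x, y). k x y)"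
    and D_closed: "closed D" and D_nonempty: "D \<noteq> {}"
    and noise_normal: "\<And>i. 1 \<le> i \<Longrightarrow> normal_rv M 0 (\<sigma>\<^sup>2) (\<epsilon> i)"
    and noise_indep: "prob_space.indep_vars M (\<lambda>_. borel) \<epsilon> {1..}"
    and noise_indep_prior: "prob_space.indep_set M
      (sets (vimage_algebra (space M) (\<lambda>\<omega>. \<lambda>x\<in>D. U \<omega> x) (\<Pi>\<^sub>M x\<in>D. borel)))
      (sets (vimage_algebra (space M) (\<lambda>\<omega>. \<lambda>i\<in>{1..}. \<epsilon> i \<omega>) (\<Pi>\<^sub>M i\<in>{1..}. borel)))"
    and X_history: "\<And>n. 1 \<le> n \<Longrightarrow> X n \<in> measurable (history M (feedback U \<epsilon> X) n) borel"
    and X_in_D: "\<And>n \<omega>. 1 \<le> n \<Longrightarrow> \<omega> \<in> space M \<Longrightarrow> X n \<omega> \<in> D"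
begin

interpretation prob_space M by (rule prob)

abbreviation Y :: "nat \<Rightarrow> 'w \<Rightarrow> real" where "Y \<equiv> feedback U \<epsilon> X"

text \<open>The observations that are available when the \<open>n\<close>-th point is chosen.\<close>

definition Yvec :: "nat \<Rightarrow> 'w \<Rightarrow> nat \<Rightarrow> real" where
  "Yvec n \<omega> = (\<lambda>i\<in>{1..<n}. Y i \<omega>)"

text \<open>The sample space with the sigma-algebra of the unknown function stands for the space of functions, so
  that functions need no measurable structure of their own.\<close>

definition UA :: "'w measure" where
  "UA = vimage_algebra (space M) (\<lambda>\<omega>. \<lambda>x\<in>D. U \<omega> x) (\<Pi>\<^sub>M x\<in>D. borel)"

lemma space_UA [simp]: "space UA = space M"
  by (simp add: UA_def)

lemma U_measurable: "x \<in> D \<Longrightarrow> (\<lambda>\<omega>. U \<omega> x) \<in> borel_measurable M"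
  by (rule gaussian_process_measurable[OF gp])

lemma U_measurable_UA: "x \<in> D \<Longrightarrow> (\<lambda>\<omega>. U \<omega> x) \<in> borel_measurable UA"
proof -
  assume x: "x \<in> D"
  have "(\<lambda>\<omega>. \<lambda>x\<in>D. U \<omega> x) \<in> measurable UA (\<Pi>\<^sub>M x\<in>D. borel)"
    unfolding UA_def by (rule measurable_vimage_algebra1) (auto simp: space_PiM)
  from measurable_compose[OF this measurable_component_singleton[OF x]] x show ?thesis by simp
qed

lemma noise_measurable: "1 \<le> i \<Longrightarrow> \<epsilon> i \<in> borel_measurable M"
  using noise_normal by (auto simp: normal_rv_def)

lemma history_factor:
  assumes "Z \<in> measurable (history M Y n) borel" "\<And>\<omega>. \<omega> \<in> space M \<Longrightarrow> Z \<omega> \<in> D"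
  shows "\<exists>g\<in>borel_measurable (\<Pi>\<^sub>M i\<in>{1..<n}. borel). (\<forall>y. g y \<in> D) \<and> (\<forall>\<omega>\<in>space M. Z \<omega> = g (Yvec n \<omega>))"
  using measurable_factor_into[OF _ assms(1)[unfolded history_def] D_closed D_nonempty assms(2)]
  by (auto simp: Yvec_def space_PiM)

lemma U_compose_measurable:
  "Z \<in> borel_measurable M \<Longrightarrow> (\<And>\<omega>. \<omega> \<in> space M \<Longrightarrow> Z \<omega> \<in> D) \<Longrightarrow> (\<lambda>\<omega>. U \<omega> (Z \<omega>)) \<in> borel_measurable M"
  by (rule Caratheodory_measurable[OF U_continuous U_measurable])

lemma Y_measurable: "1 \<le> i \<Longrightarrow> Y i \<in> borel_measurable M"
proof (induction i rule: less_induct)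
  case (less n)
  have Yv: "Yvec n \<in> measurable M (\<Pi>\<^sub>M i\<in>{1..<n}. borel)"
    unfolding Yvec_def by (rule measurable_restrict) (use less in auto)
  obtain g where g: "g \<in> borel_measurable (\<Pi>\<^sub>M i\<in>{1..<n}. borel)" "\<And>\<omega>. \<omega> \<in> space M \<Longrightarrow> X n \<omega> = g (Yvec n \<omega>)"
    using history_factor[OF X_history[OF less.prems] X_in_D[OF less.prems]] by blast
  have "X n \<in> borel_measurable M"
    using measurable_compose[OF Yv g(1)] g(2) by (subst measurable_cong[of _ "X n" "\<lambda>\<omega>. g (Yvec n \<omega>)"]) auto
  from U_compose_measurable[OF this X_in_D[OF less.prems]] noise_measurable[OF less.prems]
  show ?case unfolding feedback_def[abs_def] by measurable
qed

lemma Yvec_measurable: "Yvec n \<in> measurable M (\<Pi>\<^sub>M i\<in>{1..<n}. borel)"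
  unfolding Yvec_def by (rule measurable_restrict) (use Y_measurable in auto)

lemma history_measurable:
  assumes "Z \<in> measurable (history M Y n) borel" "\<And>\<omega>. \<omega> \<in> space M \<Longrightarrow> Z \<omega> \<in> D"
  shows "Z \<in> borel_measurable M"
proof -
  obtain g where g: "g \<in> borel_measurable (\<Pi>\<^sub>M i\<in>{1..<n}. borel)" "\<And>\<omega>. \<omega> \<in> space M \<Longrightarrow> Z \<omega> = g (Yvec n \<omega>)"
    using history_factor[OF assms] by blast
  show ?thesis
    using measurable_compose[OF Yvec_measurable g(1)] g(2) by (subst measurable_cong[of _ Z "\<lambda>\<omega>. g (Yvec n \<omega>)"]) auto
qed

lemma X_measurable: "1 \<le> n \<Longrightarrow> X n \<in> borel_measurable M"
  by (rule history_measurable[OF X_history X_in_D])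

lemma k_measurable:
  assumes "z \<in> borel_measurable N" "z' \<in> borel_measurable N"
    "\<And>\<omega>. \<omega> \<in> space N \<Longrightarrow> z \<omega> \<in> D" "\<And>\<omega>. \<omega> \<in> space N \<Longrightarrow> z' \<omega> \<in> D"
  shows "(\<lambda>\<omega>. k (z \<omega>) (z' \<omega>)) \<in> borel_measurable N"
proof -
  have 1: "(\<lambda>p. k (fst p) (snd p)) \<in> borel_measurable (restrict_space borel (D \<times> D))"
    using borel_measurable_continuous_on_restrict[OF k_continuous] by (simp add: case_prod_beta')
  have "(\<lambda>\<omega>. (z \<omega>, z' \<omega>)) \<in> measurable N (restrict_space borel (D \<times> D))"
    by (rule measurable_restrict_space2) (use assms in \<open>auto intro: borel_measurable_Pair\<close>)
  from measurable_compose[OF this 1] show ?thesis by simp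
qed

text \<open>The rank-one updates exhibit the posterior as a measurable function of points and observations,
  which is not apparent from the matrix inverse.\<close>

lemma post_cov_measurable:
  assumes "\<And>p \<omega>. p \<in> set ps \<Longrightarrow> \<omega> \<in> space N \<Longrightarrow> p \<omega> \<in> D" "\<And>p. p \<in> set ps \<Longrightarrow> p \<in> borel_measurable N"
    and "z \<in> borel_measurable N" "z' \<in> borel_measurable N"
    "\<And>\<omega>. \<omega> \<in> space N \<Longrightarrow> z \<omega> \<in> D" "\<And>\<omega>. \<omega> \<in> space N \<Longrightarrow> z' \<omega> \<in> D"
  shows "(\<lambda>\<omega>. post_cov k \<sigma> (map (\<lambda>p. p \<omega>) ps) (z \<omega>) (z' \<omega>)) \<in> borel_measurable N"
  using assms
proof (induction ps arbitrary: z z' rule: rev_induct)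
  case Nil
  show ?case unfolding list.map post_cov_Nil by (rule k_measurable) (use Nil in auto)
next
  case (snoc p ps)
  have p: "p \<in> borel_measurable N" "\<And>\<omega>. \<omega> \<in> space N \<Longrightarrow> p \<omega> \<in> D" using snoc.prems by auto
  have ps: "\<And>q \<omega>. q \<in> set ps \<Longrightarrow> \<omega> \<in> space N \<Longrightarrow> q \<omega> \<in> D" "\<And>q. q \<in> set ps \<Longrightarrow> q \<in> borel_measurable N"
    using snoc.prems by auto
  have IH: "(\<lambda>\<omega>. post_cov k \<sigma> (map (\<lambda>p. p \<omega>) ps) (a \<omega>) (b \<omega>)) \<in> borel_measurable N"
    if "a \<in> borel_measurable N" "b \<in> borel_measurable N"
      "\<And>\<omega>. \<omega> \<in> space N \<Longrightarrow> a \<omega> \<in> D" "\<And>\<omega>. \<omega> \<in> space N \<Longrightarrow> b \<omega> \<in> D" for a b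
    by (rule snoc.IH) (use ps that in auto)
  have "(\<lambda>\<omega>. post_cov k \<sigma> (map (\<lambda>p. p \<omega>) ps) (z \<omega>) (z' \<omega>) -
      post_cov k \<sigma> (map (\<lambda>p. p \<omega>) ps) (z \<omega>) (p \<omega>) * post_cov k \<sigma> (map (\<lambda>p. p \<omega>) ps) (p \<omega>) (z' \<omega>) /
      (post_cov k \<sigma> (map (\<lambda>p. p \<omega>) ps) (p \<omega>) (p \<omega>) + \<sigma>\<^sup>2)) \<in> borel_measurable N"
    by (intro borel_measurable_diff borel_measurable_divide borel_measurable_times borel_measurable_add IH p snoc.prems(3-6)) auto
  moreover have "set (map (\<lambda>p. p \<omega>) ps) \<subseteq> D" if "\<omega> \<in> space N" for \<omega> using ps that by auto
  ultimately show ?case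
    using p(2) snoc.prems(5,6)
    by (subst measurable_cong, unfold map_append list.map, subst post_cov_update) (auto simp: post_var_def)
qed

lemma post_mean_measurable:
  assumes "\<And>p \<omega>. p \<in> set ps \<Longrightarrow> \<omega> \<in> space N \<Longrightarrow> p \<omega> \<in> D" "\<And>p. p \<in> set ps \<Longrightarrow> p \<in> borel_measurable N"
    and "\<And>f. f \<in> set fs \<Longrightarrow> f \<in> borel_measurable N" "length fs = length ps"
    and "z \<in> borel_measurable N" "\<And>\<omega>. \<omega> \<in> space N \<Longrightarrow> z \<omega> \<in> D"
  shows "(\<lambda>\<omega>. post_mean k \<sigma> (map (\<lambda>p. p \<omega>) ps) (map (\<lambda>f. f \<omega>) fs) (z \<omega>)) \<in> borel_measurable N"
  using assms
proof (induction ps arbitrary: fs z rule: rev_induct)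
  case Nil
  then show ?case by simp
next
  case (snoc p ps)
  obtain fs' f where fs: "fs = fs' @ [f]" "length fs' = length ps"
    using snoc.prems(4) by (cases fs rule: rev_cases) auto
  have p: "p \<in> borel_measurable N" "\<And>\<omega>. \<omega> \<in> space N \<Longrightarrow> p \<omega> \<in> D" using snoc.prems by auto
  have ps: "\<And>q \<omega>. q \<in> set ps \<Longrightarrow> \<omega> \<in> space N \<Longrightarrow> q \<omega> \<in> D" "\<And>q. q \<in> set ps \<Longrightarrow> q \<in> borel_measurable N"
    using snoc.prems by auto
  have f: "f \<in> borel_measurable N" "\<And>g. g \<in> set fs' \<Longrightarrow> g \<in> borel_measurable N" using snoc.prems(3) fs by auto
  have IH: "(\<lambda>\<omega>. post_mean k \<sigma> (map (\<lambda>p. p \<omega>) ps) (map (\<lambda>f. f \<omega>) fs') (a \<omega>)) \<in> borel_measurable N"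
    if "a \<in> borel_measurable N" "\<And>\<omega>. \<omega> \<in> space N \<Longrightarrow> a \<omega> \<in> D" for a
    by (rule snoc.IH) (use ps f fs that in auto)
  have C: "(\<lambda>\<omega>. post_cov k \<sigma> (map (\<lambda>p. p \<omega>) ps) (a \<omega>) (b \<omega>)) \<in> borel_measurable N"
    if "a \<in> borel_measurable N" "b \<in> borel_measurable N"
      "\<And>\<omega>. \<omega> \<in> space N \<Longrightarrow> a \<omega> \<in> D" "\<And>\<omega>. \<omega> \<in> space N \<Longrightarrow> b \<omega> \<in> D" for a b
    by (rule post_cov_measurable) (use ps that in auto)
  have "(\<lambda>\<omega>. post_mean k \<sigma> (map (\<lambda>p. p \<omega>) ps) (map (\<lambda>f. f \<omega>) fs') (z \<omega>) +
      post_cov k \<sigma> (map (\<lambda>p. p \<omega>) ps) (z \<omega>) (p \<omega>) / (post_cov k \<sigma> (map (\<lambda>p. p \<omega>) ps) (p \<omega>) (p \<omega>) + \<sigma>\<^sup>2) *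
      (f \<omega> - post_mean k \<sigma> (map (\<lambda>p. p \<omega>) ps) (map (\<lambda>f. f \<omega>) fs') (p \<omega>))) \<in> borel_measurable N"
    by (intro borel_measurable_diff borel_measurable_divide borel_measurable_times borel_measurable_add IH C p f(1) snoc.prems(5,6)) auto
  moreover have "set (map (\<lambda>p. p \<omega>) ps) \<subseteq> D" if "\<omega> \<in> space N" for \<omega> using ps that by auto
  ultimately show ?case
    using p(2) snoc.prems(6) fs
    by (subst measurable_cong, unfold fs(1) map_append list.map, subst post_mean_update) (auto simp: post_var_def)
qed

text \<open>Independence turns the joint law of the unknown function and the first \<open>n\<close> noise terms into a product,
  whose second factor is explicit.\<close>

lemma UA_noise_product:
  assumes n: "1 \<le> n"
    and H: "H \<in> borel_measurable (UA \<Otimes>\<^sub>M (\<Pi>\<^sub>M i\<in>{1..n}. borel))"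
  shows "(\<integral>\<^sup>+\<omega>. H (\<omega>, \<lambda>i\<in>{1..n}. \<epsilon> i \<omega>) \<partial>M) =
    (\<integral>\<^sup>+\<omega>. \<integral>\<^sup>+e. H (\<omega>, e) \<partial>(\<Pi>\<^sub>M i\<in>{1..n}. density lborel (normal_density 0 \<sigma>)) \<partial>distr M UA (\<lambda>\<omega>. \<omega>))"
proof -
  let ?B = "\<Pi>\<^sub>M i\<in>{1..n}. (borel :: real measure)" and ?N = "density lborel (normal_density 0 \<sigma>)"
  let ?E = "\<lambda>\<omega>. \<lambda>i\<in>{1..n}. \<epsilon> i \<omega>" and ?full = "\<lambda>\<omega>. \<lambda>i\<in>{1..}. \<epsilon> i \<omega>"
  have sub: "sets UA \<subseteq> events" "sets (vimage_algebra (space M) ?full (\<Pi>\<^sub>M i\<in>{1..}. borel)) \<subseteq> events"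
    using noise_indep_prior unfolding indep_sets2_eq UA_def by auto
  have id: "(\<lambda>\<omega>. \<omega>) \<in> measurable M UA"
    using sub(1) by (auto simp: measurable_def)
  have E: "?E \<in> measurable M ?B"
    by (rule measurable_restrict) (use noise_measurable in auto)
  have dE: "distr M ?B ?E = (\<Pi>\<^sub>M i\<in>{1..n}. ?N)"
  proof -
    have "indep_vars (\<lambda>_. borel) \<epsilon> {1..n}"
      by (rule indep_vars_subset[OF noise_indep]) auto
    then have "distr M ?B ?E = (\<Pi>\<^sub>M i\<in>{1..n}. distr M borel (\<epsilon> i))"
      using indep_vars_iff_distr_eq_PiM'[where I="{1..n}" and M'="\<lambda>_. borel" and X=\<epsilon>] noise_measurable n by auto
    also have "\<dots> = (\<Pi>\<^sub>M i\<in>{1..n}. ?N)"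
    proof (rule PiM_cong[OF refl])
      fix i assume "i \<in> {1..n}"
      then have "distributed M lborel (\<epsilon> i) (normal_density 0 \<sigma>)"
        using noise_normal[of i] noise_pos by (auto simp: normal_rv_def)
      from distributed_distr_eq_density[OF this] show "distr M borel (\<epsilon> i) = ?N"
        using distr_cong[of M M borel lborel "\<epsilon> i" "\<epsilon> i"] by simp
    qed
    finally show ?thesis .
  qed
  let ?V = "vimage_algebra (space M) ?full (\<Pi>\<^sub>M i\<in>{1..}. borel)"
  have EV: "?E -` B \<inter> space M \<in> sets ?V" if "B \<in> sets ?B" for B
  proof -
    have f: "?full \<in> measurable ?V (\<Pi>\<^sub>M i\<in>{1..}. borel)"
      by (rule measurable_vimage_algebra1) (auto simp: space_PiM)
    have "(\<lambda>y. restrict y {1..n}) \<in> measurable (\<Pi>\<^sub>M i\<in>{1..}. borel) ?B"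
      by (rule measurable_restrict_subset) auto
    from measurable_sets[OF measurable_compose[OF f this] that]
    have "(\<lambda>\<omega>. restrict (?full \<omega>) {1..n}) -` B \<inter> space M \<in> sets ?V" by simp
    moreover have "restrict (?full \<omega>) {1..n} = ?E \<omega>" for \<omega> by (auto simp: restrict_def fun_eq_iff)
    ultimately show ?thesis by simp
  qed
  interpret A: prob_space "distr M UA (\<lambda>\<omega>. \<omega>)" by (rule prob_space_distr[OF id])
  interpret E: prob_space "distr M ?B ?E" by (rule prob_space_distr[OF E])
  have P: "distr M UA (\<lambda>\<omega>. \<omega>) \<Otimes>\<^sub>M distr M ?B ?E = distr M (UA \<Otimes>\<^sub>M ?B) (\<lambda>\<omega>. (\<omega>, ?E \<omega>))"
  proof (rule pair_measure_eqI)
    show "sigma_finite_measure (distr M UA (\<lambda>\<omega>. \<omega>))" "sigma_finite_measure (distr M ?B ?E)"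
      by unfold_locales
    show "sets (distr M UA (\<lambda>\<omega>. \<omega>) \<Otimes>\<^sub>M distr M ?B ?E) = sets (distr M (UA \<Otimes>\<^sub>M ?B) (\<lambda>\<omega>. (\<omega>, ?E \<omega>)))"
      by (simp cong: sets_pair_measure_cong)
    fix A B assume A: "A \<in> sets (distr M UA (\<lambda>\<omega>. \<omega>))" and B: "B \<in> sets (distr M ?B ?E)"
    have AM: "A \<subseteq> space M" using A sets.sets_into_space[of A UA] by simp
    have "emeasure (distr M (UA \<Otimes>\<^sub>M ?B) (\<lambda>\<omega>. (\<omega>, ?E \<omega>))) (A \<times> B) =
        emeasure M ((\<lambda>\<omega>. (\<omega>, ?E \<omega>)) -` (A \<times> B) \<inter> space M)"
      using A B by (intro emeasure_distr measurable_Pair id E) auto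
    also have "(\<lambda>\<omega>. (\<omega>, ?E \<omega>)) -` (A \<times> B) \<inter> space M = A \<inter> (?E -` B \<inter> space M)" using AM by auto
    also have "emeasure M (A \<inter> (?E -` B \<inter> space M)) = emeasure M A * emeasure M (?E -` B \<inter> space M)"
    proof -
      have "?E -` B \<inter> space M \<in> sets ?V" by (rule EV) (use B in simp)
      then have "prob (A \<inter> (?E -` B \<inter> space M)) = prob A * prob (?E -` B \<inter> space M)"
        using noise_indep_prior A by (intro indep_setD) (auto simp: UA_def)
      then show ?thesis by (simp add: emeasure_eq_measure ennreal_mult'')
    qed
    also have "emeasure M (?E -` B \<inter> space M) = emeasure (distr M ?B ?E) B"
      using B by (subst emeasure_distr[OF E]) auto
    also have "emeasure M A = emeasure (distr M UA (\<lambda>\<omega>. \<omega>)) A"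
      using A AM by (subst emeasure_distr[OF id]) (auto simp: Int_absorb2)
    finally show "emeasure (distr M UA (\<lambda>\<omega>. \<omega>)) A * emeasure (distr M ?B ?E) B =
        emeasure (distr M (UA \<Otimes>\<^sub>M ?B) (\<lambda>\<omega>. (\<omega>, ?E \<omega>))) (A \<times> B)" ..
  qed
  have "(\<integral>\<^sup>+\<omega>. H (\<omega>, ?E \<omega>) \<partial>M) = (\<integral>\<^sup>+p. H p \<partial>distr M (UA \<Otimes>\<^sub>M ?B) (\<lambda>\<omega>. (\<omega>, ?E \<omega>)))"
    by (rule nn_integral_distr[symmetric]) (use id E H in auto)
  also have "\<dots> = (\<integral>\<^sup>+p. H p \<partial>(distr M UA (\<lambda>\<omega>. \<omega>) \<Otimes>\<^sub>M distr M ?B ?E))"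
    unfolding P ..
  also have "\<dots> = (\<integral>\<^sup>+\<omega>. \<integral>\<^sup>+e. H (\<omega>, e) \<partial>distr M ?B ?E \<partial>distr M UA (\<lambda>\<omega>. \<omega>))"
  proof (rule E.nn_integral_fst[symmetric])
    have "sets (distr M UA (\<lambda>\<omega>. \<omega>) \<Otimes>\<^sub>M distr M ?B ?E) = sets (UA \<Otimes>\<^sub>M ?B)"
      by (rule sets_pair_measure_cong) simp_all
    from measurable_cong_sets[OF this refl, of borel] H
    show "H \<in> borel_measurable (distr M UA (\<lambda>\<omega>. \<omega>) \<Otimes>\<^sub>M distr M ?B ?E)" by blast
  qed
  finally show ?thesis unfolding dE .
qed

text \<open>Adaptivity costs nothing in the Bayesian setting. The unknown function and the observations have a
  joint density, the likelihood, with respect to the law of the function times Lebesgue measure.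
  Exchanging the integrals fixes the observations first; then the design \<open>xs y\<close> and the test point
  \<open>\<zeta> y\<close> are fixed as well, and the tail bound for fixed designs applies for every \<open>y\<close>.\<close>

lemma adaptive_tail:
  assumes n: "1 \<le> n" and Z: "Z \<in> measurable (history M Y (Suc n)) borel"
    and ZD: "\<And>\<omega>. \<omega> \<in> space M \<Longrightarrow> Z \<omega> \<in> D" and a: "0 \<le> a"
  shows "{\<omega>\<in>space M. a * sqrt (posterior_var k \<sigma> X n \<omega> (Z \<omega>)) <
      \<bar>U \<omega> (Z \<omega>) - posterior_mean k \<sigma> U \<epsilon> X n \<omega> (Z \<omega>)\<bar>} \<in> sets M" (is "?bad \<in> _")
    and "measure M {\<omega>\<in>space M. a * sqrt (posterior_var k \<sigma> X n \<omega> (Z \<omega>)) <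
      \<bar>U \<omega> (Z \<omega>) - posterior_mean k \<sigma> U \<epsilon> X n \<omega> (Z \<omega>)\<bar>} \<le> 2 * exp (- a\<^sup>2 / 2)"
proof -
  let ?B = "\<Pi>\<^sub>M i\<in>{1..n}. (borel :: real measure)" and ?N = "density lborel (normal_density 0 \<sigma>)"
  let ?L = "\<Pi>\<^sub>M i\<in>{1..n}. (lborel :: real measure)" and ?E = "\<lambda>\<omega>. \<lambda>i\<in>{1..n}. \<epsilon> i \<omega>"
  define MA where "MA = distr M UA (\<lambda>\<omega>. \<omega>)"
  have e: "{1..<Suc n} = {1..n}" by auto
  have "\<forall>i. \<exists>g. 1 \<le> i \<longrightarrow> g \<in> borel_measurable (\<Pi>\<^sub>M i\<in>{1..<i}. borel) \<and> (\<forall>y. g y \<in> D) \<and> (\<forall>\<omega>\<in>space M. X i \<omega> = g (Yvec i \<omega>))"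
    using history_factor[OF X_history X_in_D] by blast
  from choice[OF this] obtain \<xi> where \<xi>: "\<And>i. 1 \<le> i \<Longrightarrow> \<xi> i \<in> borel_measurable (\<Pi>\<^sub>M i\<in>{1..<i}. borel)"
    "\<And>i y. 1 \<le> i \<Longrightarrow> \<xi> i y \<in> D" "\<And>i \<omega>. 1 \<le> i \<Longrightarrow> \<omega> \<in> space M \<Longrightarrow> X i \<omega> = \<xi> i (Yvec i \<omega>)"
    by blast
  obtain \<zeta> where \<zeta>: "\<zeta> \<in> borel_measurable ?B" "\<And>y. \<zeta> y \<in> D" "\<And>\<omega>. \<omega> \<in> space M \<Longrightarrow> Z \<omega> = \<zeta> (Yvec (Suc n) \<omega>)"
    using history_factor[OF Z ZD] unfolding e by blast
  define g where "g \<omega> i y = U \<omega> (\<xi> i y)" for \<omega> i y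
  define xs where "xs y = map (\<lambda>i. \<xi> i (restrict y {1..<i})) [1..<Suc n]" for y
  define ys where "ys y = map y [1..<Suc n]" for y :: "nat \<Rightarrow> real"
  have xsD: "set (xs y) \<subseteq> D" and lys: "length (ys y) = length (xs y)" for y
    using \<xi>(2) by (auto simp: xs_def ys_def)
  have traj: "Yvec (Suc m) \<omega> = traj (g \<omega>) m (?E \<omega>)" if "\<omega> \<in> space M" "m \<le> n" for \<omega> m
    using that(2)
  proof (induction m)
    case 0
    then show ?case by (auto simp: Yvec_def)
  next
    case (Suc m)
    have "Yvec (Suc (Suc m)) \<omega> = (Yvec (Suc m) \<omega>)(Suc m := Y (Suc m) \<omega>)"
      by (auto simp: Yvec_def restrict_def fun_eq_iff)
    also have "Y (Suc m) \<omega> = g \<omega> (Suc m) (Yvec (Suc m) \<omega>) + ?E \<omega> (Suc m)"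
      using \<xi>(3)[of "Suc m" \<omega>] that(1) Suc.prems by (simp add: feedback_def g_def)
    finally show ?case using Suc by simp
  qed
  have xsY: "data_upto (\<lambda>i. X i \<omega>) n = xs (Yvec (Suc n) \<omega>)" if "\<omega> \<in> space M" for \<omega>
  proof -
    have "X i \<omega> = \<xi> i (restrict (Yvec (Suc n) \<omega>) {1..<i})" if i: "i \<in> set [1..<Suc n]" for i
    proof -
      have "restrict (Yvec (Suc n) \<omega>) {1..<i} = Yvec i \<omega>"
        using i by (auto simp: Yvec_def restrict_def fun_eq_iff)
      then show ?thesis using \<xi>(3)[of i \<omega>] \<open>\<omega> \<in> space M\<close> i by auto
    qed
    then show ?thesis unfolding data_upto_def xs_def by (intro map_cong refl)
  qed
  have ysY: "data_upto (\<lambda>i. Y i \<omega>) n = ys (Yvec (Suc n) \<omega>)" for \<omega>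
    unfolding data_upto_def ys_def by (intro map_cong refl) (auto simp: Yvec_def)
  have lik: "(\<Prod>i\<in>{1..n}. normal_density 0 \<sigma> (y i - g \<omega> i (restrict y {1..<i}))) = likelihood \<sigma> (xs y) (ys y) (U \<omega>)" for y \<omega>
    unfolding likelihood_def g_def
    by (rule prod.reindex_bij_witness[where i="Suc" and j="\<lambda>i. i - 1"]) (auto simp: xs_def ys_def nth_append simp del: upt_Suc)
  have kmU: "(\<lambda>p. U (fst p) (f (snd p))) \<in> borel_measurable (UA \<Otimes>\<^sub>M P)"
    if "f \<in> borel_measurable P" "\<And>y. f y \<in> D" for f and P :: "(nat \<Rightarrow> real) measure"
  proof (rule Caratheodory_measurable[where U="\<lambda>p. U (fst p)" and Z="\<lambda>p. f (snd p)" and D=D])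
    show "continuous_on D (U (fst p))" if "p \<in> space (UA \<Otimes>\<^sub>M P)" for p
      using that U_continuous by (auto simp: space_pair_measure)
    show "(\<lambda>p. U (fst p) x) \<in> borel_measurable (UA \<Otimes>\<^sub>M P)" if "x \<in> D" for x
      by (rule measurable_compose[OF measurable_fst U_measurable_UA[OF that]])
    show "(\<lambda>p. f (snd p)) \<in> borel_measurable (UA \<Otimes>\<^sub>M P)"
      by (rule measurable_compose[OF measurable_snd that(1)])
  qed (use that in auto)
  have gm: "(\<lambda>(\<omega>, y). g \<omega> i y) \<in> borel_measurable (UA \<Otimes>\<^sub>M Pi\<^sub>M {1..<i} (\<lambda>_. borel))" if "1 \<le> i" for i
    using kmU[OF \<xi>(1)[OF that] \<xi>(2)[OF that]] by (simp add: g_def case_prod_beta')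
  have tm: "(\<lambda>p. traj (g (fst p)) n (snd p)) \<in> measurable (UA \<Otimes>\<^sub>M ?B) ?B"
    using traj_measurable[of g UA n n, OF gm] by (simp add: case_prod_beta')
  have g1: "g \<omega> i \<in> borel_measurable (Pi\<^sub>M {1..<i} (\<lambda>_. borel))" if "1 \<le> i" "\<omega> \<in> space M" for \<omega> i
    unfolding g_def
    by (rule Caratheodory_measurable[where U="\<lambda>_. U \<omega>" and D=D, OF _ _ \<xi>(1)[OF that(1)] \<xi>(2)[OF that(1)]]) (use U_continuous that in auto)
  have xm: "(\<lambda>y. \<xi> i (restrict y {1..<i})) \<in> borel_measurable ?B" if "i \<in> {1..n}" for i
    using that by (intro measurable_compose[OF measurable_restrict_subset \<xi>(1)]) auto
  have ym: "(\<lambda>y. y i) \<in> borel_measurable ?B" if "i \<in> {1..n}" for i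
    by (rule measurable_component_singleton[OF that])
  define Lk where "Lk p = (\<Prod>i\<in>{1..n}. normal_density 0 \<sigma> (snd p i - g (fst p) i (restrict (snd p) {1..<i})))" for p
  have Lklik: "Lk (\<omega>, y) = likelihood \<sigma> (xs y) (ys y) (U \<omega>)" for \<omega> y
    unfolding Lk_def fst_conv snd_conv by (rule lik)
  have Lkm: "Lk \<in> borel_measurable (UA \<Otimes>\<^sub>M ?B)"
    unfolding Lk_def
  proof (intro borel_measurable_prod measurable_compose[OF _ borel_measurable_normal_density] borel_measurable_diff)
    fix i assume i: "i \<in> {1..n}"
    show "(\<lambda>p. snd p i) \<in> borel_measurable (UA \<Otimes>\<^sub>M ?B)"
      by (rule measurable_compose[OF measurable_snd ym[OF i]])
    show "(\<lambda>p. g (fst p) i (restrict (snd p) {1..<i})) \<in> borel_measurable (UA \<Otimes>\<^sub>M ?B)"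
      using kmU[OF xm[OF i]] \<xi>(2) i by (simp add: g_def)
  qed
  have sL: "sets ?L = sets ?B" by (auto intro!: sets_PiM_cong)
  have sub: "sets UA \<subseteq> events"
    using noise_indep_prior unfolding indep_sets2_eq UA_def by auto
  have id: "(\<lambda>\<omega>. \<omega>) \<in> measurable M UA" using sub by (auto simp: measurable_def)
  interpret MA: prob_space MA unfolding MA_def by (rule prob_space_distr[OF id])
  interpret PL: product_sigma_finite "\<lambda>_::nat. lborel :: real measure" by unfold_locales
  interpret PLn: sigma_finite_measure "?L" by (rule PL.sigma_finite) simp
  interpret PP: pair_sigma_finite MA "?L" by unfold_locales
  have sML: "sets (MA \<Otimes>\<^sub>M ?L) = sets (UA \<Otimes>\<^sub>M ?B)"
    by (rule sets_pair_measure_cong[OF _ sL]) (simp add: MA_def)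
  \<comment> \<open>the joint density of the unknown function and the observations is the likelihood\<close>
  have star: "(\<integral>\<^sup>+\<omega>. h (\<omega>, Yvec (Suc n) \<omega>) \<partial>M) = (\<integral>\<^sup>+y. \<integral>\<^sup>+\<omega>. h (\<omega>, y) * ennreal (Lk (\<omega>, y)) \<partial>MA \<partial>?L)"
    if h: "h \<in> borel_measurable (UA \<Otimes>\<^sub>M ?B)" for h
  proof -
    have "(\<integral>\<^sup>+\<omega>. h (\<omega>, Yvec (Suc n) \<omega>) \<partial>M) = (\<integral>\<^sup>+\<omega>. h (\<omega>, traj (g \<omega>) n (?E \<omega>)) \<partial>M)"
      by (intro nn_integral_cong) (simp add: traj)
    also have "\<dots> = (\<integral>\<^sup>+\<omega>. \<integral>\<^sup>+e. h (\<omega>, traj (g \<omega>) n e) \<partial>(\<Pi>\<^sub>M i\<in>{1..n}. ?N) \<partial>MA)"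
    proof -
      have "(\<lambda>p. (fst p, traj (g (fst p)) n (snd p))) \<in> measurable (UA \<Otimes>\<^sub>M ?B) (UA \<Otimes>\<^sub>M ?B)"
        using tm by (intro measurable_Pair measurable_fst)
      from UA_noise_product[OF n measurable_compose[OF this h]] show ?thesis by (simp add: MA_def)
    qed
    also have "\<dots> = (\<integral>\<^sup>+\<omega>. \<integral>\<^sup>+y. h (\<omega>, y) * ennreal (Lk (\<omega>, y)) \<partial>?L \<partial>MA)"
    proof (rule nn_integral_cong)
      fix \<omega> assume "\<omega> \<in> space MA"
      then have \<omega>: "\<omega> \<in> space M" by (simp add: MA_def)
      have "(\<lambda>y. h (\<omega>, y)) \<in> borel_measurable ?B"
        by (rule measurable_compose[OF measurable_Pair1' h]) (simp add: \<omega>)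
      from nn_integral_traj[OF noise_pos g1[OF _ \<omega>] this]
      show "(\<integral>\<^sup>+e. h (\<omega>, traj (g \<omega>) n e) \<partial>(\<Pi>\<^sub>M i\<in>{1..n}. ?N)) = (\<integral>\<^sup>+y. h (\<omega>, y) * ennreal (Lk (\<omega>, y)) \<partial>?L)"
        by (simp add: Lk_def)
    qed
    also have "\<dots> = (\<integral>\<^sup>+y. \<integral>\<^sup>+\<omega>. h (\<omega>, y) * ennreal (Lk (\<omega>, y)) \<partial>MA \<partial>?L)"
    proof (rule PP.Fubini'[symmetric])
      have "(\<lambda>p. h p * ennreal (Lk p)) \<in> borel_measurable (UA \<Otimes>\<^sub>M ?B)" using h Lkm by measurable
      then show "(\<lambda>(\<omega>, y). h (\<omega>, y) * ennreal (Lk (\<omega>, y))) \<in> borel_measurable (MA \<Otimes>\<^sub>M ?L)"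
        unfolding measurable_cong_sets[OF sML refl] by (simp add: case_prod_beta')
    qed
    finally show ?thesis .
  qed
  define Q where "Q p \<longleftrightarrow> a * sqrt (post_var k \<sigma> (xs (snd p)) (\<zeta> (snd p))) <
      \<bar>U (fst p) (\<zeta> (snd p)) - post_mean k \<sigma> (xs (snd p)) (ys (snd p)) (\<zeta> (snd p))\<bar>" for p
  have pvm: "(\<lambda>y. post_var k \<sigma> (xs y) (\<zeta> y)) \<in> borel_measurable ?B"
  proof -
    have "(\<lambda>y. post_cov k \<sigma> (map (\<lambda>p. p y) (map (\<lambda>i y. \<xi> i (restrict y {1..<i})) [1..<Suc n])) (\<zeta> y) (\<zeta> y)) \<in> borel_measurable ?B"
      by (rule post_cov_measurable) (use \<zeta> \<xi>(2) xm in auto)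
    then show ?thesis by (simp only: map_map comp_def xs_def post_var_def)
  qed
  have psm: "(\<lambda>y. sqrt (post_var k \<sigma> (xs y) (\<zeta> y))) \<in> borel_measurable ?B" using pvm by measurable
  have pmm: "(\<lambda>y. post_mean k \<sigma> (xs y) (ys y) (\<zeta> y)) \<in> borel_measurable ?B"
  proof -
    have "(\<lambda>y. post_mean k \<sigma> (map (\<lambda>p. p y) (map (\<lambda>i y. \<xi> i (restrict y {1..<i})) [1..<Suc n]))
        (map (\<lambda>f. f y) (map (\<lambda>i y. y i) [1..<Suc n])) (\<zeta> y)) \<in> borel_measurable ?B"
      by (rule post_mean_measurable) (use \<zeta> \<xi>(2) xm ym in auto)
    then show ?thesis by (simp only: map_map comp_def xs_def ys_def)
  qed
  have Qm: "Measurable.pred (UA \<Otimes>\<^sub>M ?B) Q"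
    unfolding Q_def pred_def
    by (intro borel_measurable_less borel_measurable_times borel_measurable_abs borel_measurable_diff kmU \<zeta>(1,2)
        measurable_compose[OF measurable_snd pmm] measurable_compose[OF measurable_snd psm]
        borel_measurable_const)
  have QY: "Q (\<omega>, Yvec (Suc n) \<omega>) \<longleftrightarrow> \<omega> \<in> ?bad" if "\<omega> \<in> space M" for \<omega>
    using that by (simp add: Q_def posterior_var_def posterior_mean_def xsY ysY \<zeta>(3))
  have "(\<lambda>\<omega>. (\<omega>, Yvec (Suc n) \<omega>)) \<in> measurable M (UA \<Otimes>\<^sub>M ?B)"
    using Yvec_measurable[of "Suc n"] unfolding e by (intro measurable_Pair id)
  from measurable_compose[OF this Qm] have "{\<omega>\<in>space M. Q (\<omega>, Yvec (Suc n) \<omega>)} \<in> events"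
    by (rule predE)
  also have "{\<omega>\<in>space M. Q (\<omega>, Yvec (Suc n) \<omega>)} = ?bad" using QY by blast
  finally show bad: "?bad \<in> events" .
  let ?c = "ennreal (2 * exp (- a\<^sup>2 / 2))"
  have "emeasure M ?bad = (\<integral>\<^sup>+\<omega>. indicator {p. Q p} (\<omega>, Yvec (Suc n) \<omega>) \<partial>M)"
  proof -
    have "emeasure M ?bad = (\<integral>\<^sup>+\<omega>. indicator ?bad \<omega> \<partial>M)" using bad by simp
    also have "\<dots> = (\<integral>\<^sup>+\<omega>. indicator {p. Q p} (\<omega>, Yvec (Suc n) \<omega>) \<partial>M)"
      by (intro nn_integral_cong) (use QY in \<open>auto simp: indicator_def\<close>)
    finally show ?thesis .
  qed
  also have "\<dots> = (\<integral>\<^sup>+y. \<integral>\<^sup>+\<omega>. indicator {p. Q p} (\<omega>, y) * ennreal (Lk (\<omega>, y)) \<partial>MA \<partial>?L)"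
    by (rule star) (use Qm in measurable)
  also have "\<dots> \<le> (\<integral>\<^sup>+y. ?c * (\<integral>\<^sup>+\<omega>. 1 * ennreal (Lk (\<omega>, y)) \<partial>MA) \<partial>?L)"
  proof (rule nn_integral_mono)
    fix y assume "y \<in> space ?L"
    then have y: "y \<in> space ?B" by (simp add: space_PiM)
    have p2: "(\<lambda>\<omega>. (\<omega>, y)) \<in> measurable UA (UA \<Otimes>\<^sub>M ?B)" by (rule measurable_Pair2'[OF y])
    have Lk2[measurable]: "(\<lambda>\<omega>. Lk (\<omega>, y)) \<in> borel_measurable UA" by (rule measurable_compose[OF p2 Lkm])
    have Q2[measurable]: "Measurable.pred UA (\<lambda>\<omega>. Q (\<omega>, y))" by (rule measurable_compose[OF p2 Qm])
    have i2: "(\<lambda>\<omega>. indicator {p. Q p} (\<omega>, y) :: ennreal) \<in> borel_measurable UA"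
      unfolding indicator_def by measurable
    have "(\<integral>\<^sup>+\<omega>. indicator {p. Q p} (\<omega>, y) * ennreal (Lk (\<omega>, y)) \<partial>MA) =
        (\<integral>\<^sup>+\<omega>. indicator {p. Q p} (\<omega>, y) * ennreal (Lk (\<omega>, y)) \<partial>M)"
      unfolding MA_def by (rule nn_integral_distr[OF id]) (use i2 in measurable)
    also have "\<dots> = (\<integral>\<^sup>+\<omega>. ennreal (likelihood \<sigma> (xs y) (ys y) (U \<omega>)) *
      indicator {\<omega>. a * sqrt (post_var k \<sigma> (xs y) (\<zeta> y)) < \<bar>U \<omega> (\<zeta> y) - post_mean k \<sigma> (xs y) (ys y) (\<zeta> y)\<bar>} \<omega> \<partial>M)"
      by (intro nn_integral_cong) (simp add: Lklik Q_def indicator_def)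
    also have "\<dots> \<le> ?c * (\<integral>\<^sup>+\<omega>. ennreal (likelihood \<sigma> (xs y) (ys y) (U \<omega>)) \<partial>M)"
      by (rule posterior_tail[OF prob gp xsD lys \<zeta>(2) a])
    also have "(\<integral>\<^sup>+\<omega>. ennreal (likelihood \<sigma> (xs y) (ys y) (U \<omega>)) \<partial>M) = (\<integral>\<^sup>+\<omega>. 1 * ennreal (Lk (\<omega>, y)) \<partial>M)"
      by (intro nn_integral_cong) (simp add: Lklik)
    also have "\<dots> = (\<integral>\<^sup>+\<omega>. 1 * ennreal (Lk (\<omega>, y)) \<partial>MA)"
      unfolding MA_def by (rule nn_integral_distr[OF id, symmetric]) measurable
    finally show "(\<integral>\<^sup>+\<omega>. indicator {p. Q p} (\<omega>, y) * ennreal (Lk (\<omega>, y)) \<partial>MA) \<le>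
        ?c * (\<integral>\<^sup>+\<omega>. 1 * ennreal (Lk (\<omega>, y)) \<partial>MA)" .
  qed
  also have "\<dots> = ?c * (\<integral>\<^sup>+y. \<integral>\<^sup>+\<omega>. 1 * ennreal (Lk (\<omega>, y)) \<partial>MA \<partial>?L)"
  proof (rule nn_integral_cmult)
    have "(\<lambda>p. 1 * ennreal (Lk p)) \<in> borel_measurable (MA \<Otimes>\<^sub>M ?L)"
      unfolding measurable_cong_sets[OF sML refl] using Lkm by measurable
    then have "(\<lambda>(y, \<omega>). 1 * ennreal (Lk (\<omega>, y))) \<in> borel_measurable (?L \<Otimes>\<^sub>M MA)"
      by (subst measurable_pair_swap_iff) (simp add: case_prod_beta')
    then show "(\<lambda>y. \<integral>\<^sup>+\<omega>. 1 * ennreal (Lk (\<omega>, y)) \<partial>MA) \<in> borel_measurable ?L"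
      by (rule MA.borel_measurable_nn_integral)
  qed
  also have "(\<integral>\<^sup>+y. \<integral>\<^sup>+\<omega>. 1 * ennreal (Lk (\<omega>, y)) \<partial>MA \<partial>?L) = (\<integral>\<^sup>+\<omega>. 1 \<partial>M)"
    by (rule star[symmetric]) simp
  also have "\<dots> = 1" by (simp add: emeasure_space_1)
  finally show "prob ?bad \<le> 2 * exp (- a\<^sup>2 / 2)"
    by (simp add: emeasure_eq_measure)
qed

end

section \<open>The kernel of a process with Lipschitz sample paths\<close>

text \<open>The normal density is at most \<open>1 / (2 * sqrt v)\<close>, so an interval of half-width \<open>\<rho>\<close> has mass at most
  \<open>\<rho> / sqrt v\<close>. A normal variable that is small with probability 3/4 thus has small variance.\<close>

lemma normal_rv_variance_le:
  assumes M: "prob_space M" and X: "normal_rv M 0 v X" and A: "A \<in> sets M" "3 / 4 \<le> measure M A"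
    and b: "\<And>\<omega>. \<omega> \<in> A \<Longrightarrow> \<bar>X \<omega>\<bar> \<le> \<rho>"
  shows "v \<le> (4 / 3 * \<rho>)\<^sup>2"
proof (cases "v = 0")
  case False
  interpret prob_space M by fact
  have v: "0 < v" and d: "distributed M lborel X (normal_density 0 (sqrt v))" and [measurable]: "X \<in> borel_measurable M"
    using X False by (auto simp: normal_rv_def)
  have "A \<noteq> {}" using A(2) by auto
  then have \<rho>: "0 \<le> \<rho>" using b by (force intro: order_trans[OF abs_ge_zero])
  have nd: "normal_density 0 (sqrt v) x \<le> 1 / (2 * sqrt v)" for x
  proof -
    have "normal_density 0 (sqrt v) x \<le> 1 / sqrt (2 * pi * (sqrt v)\<^sup>2)"
      using v by (intro normal_density_le) simp
    also have "sqrt (2 * pi * (sqrt v)\<^sup>2) \<ge> sqrt (2\<^sup>2 * v)"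
      using v pi_gt3 by (intro real_sqrt_le_mono) simp
    then have "1 / sqrt (2 * pi * (sqrt v)\<^sup>2) \<le> 1 / (2 * sqrt v)"
      using v by (intro divide_left_mono) (auto simp: real_sqrt_mult)
    finally show ?thesis .
  qed
  have "ennreal (3 / 4) \<le> emeasure M A" using A(2) by (simp add: emeasure_eq_measure)
  also have "\<dots> \<le> emeasure M (X -` {-\<rho>..\<rho>} \<inter> space M)"
    using b sets.sets_into_space[OF A(1)] by (intro emeasure_mono) (force simp: abs_le_iff)+
  also have "\<dots> = emeasure (distr M lborel X) {-\<rho>..\<rho>}" by (subst emeasure_distr) auto
  also have "\<dots> = (\<integral>\<^sup>+x. ennreal (normal_density 0 (sqrt v) x) * indicator {-\<rho>..\<rho>} x \<partial>lborel)"
    unfolding distributed_distr_eq_density[OF d] by (subst emeasure_density) auto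
  also have "\<dots> \<le> (\<integral>\<^sup>+x. ennreal (1 / (2 * sqrt v)) * indicator {-\<rho>..\<rho>} x \<partial>lborel)"
    by (intro nn_integral_mono mult_right_mono ennreal_leI nd) simp
  also have "\<dots> = ennreal (1 / (2 * sqrt v) * (2 * \<rho>))"
    using \<rho> v by (subst nn_integral_cmult_indicator) (auto simp: ennreal_mult''[symmetric])
  finally have "3 / 4 \<le> 1 / (2 * sqrt v) * (2 * \<rho>)" using \<rho> v by (subst (asm) ennreal_le_iff) auto
  then have "sqrt v \<le> 4 / 3 * \<rho>" using v by (simp add: field_simps)
  then have "(sqrt v)\<^sup>2 \<le> (4 / 3 * \<rho>)\<^sup>2" using v by (intro power_mono) auto
  then show ?thesis using v by simp
qed simp

lemma gradient_bound_Lipschitz: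
  fixes F :: "real ^ 'd \<Rightarrow> real"
  assumes "gradient_on D F G" "convex D" and B: "\<And>x j. x \<in> D \<Longrightarrow> \<bar>G x $ j\<bar> \<le> B"
    and "x \<in> D" "y \<in> D"
  shows "\<bar>F x - F y\<bar> \<le> real CARD('d) * B * norm (x - y)"
proof -
  have "norm (F x - F y) \<le> real CARD('d) * B * norm (x - y)"
  proof (rule differentiable_bound[OF assms(2) _ _ assms(4,5)])
    fix z assume z: "z \<in> D"
    show "(F has_derivative (\<lambda>h. inner (G z) h)) (at z within D)"
      using assms(1) z by (simp add: gradient_on_def)
    have "norm (G z) \<le> (\<Sum>j\<in>UNIV. \<bar>G z $ j\<bar>)" by (rule norm_le_l1_cart)
    also have "\<dots> \<le> (\<Sum>j\<in>(UNIV :: 'd set). B)" by (intro sum_mono B z)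
    finally have "norm (G z) \<le> real CARD('d) * B" by simp
    then have "norm (inner (G z) h) \<le> real CARD('d) * B * norm h" for h
      using Cauchy_Schwarz_ineq2[of "G z" h] mult_right_mono[of "norm (G z)" "real CARD('d) * B" "norm h"] by simp
    then show "onorm (\<lambda>h. inner (G z) h) \<le> real CARD('d) * B" by (rule onorm_le)
  qed
  then show ?thesis by simp
qed

lemma SUP_ereal_abs_leD:
  assumes "\<not> (SUP x\<in>D. ereal \<bar>f x\<bar>) > ereal B" "x \<in> D"
  shows "\<bar>f x\<bar> \<le> B"
proof -
  have "ereal \<bar>f x\<bar> \<le> (SUP x\<in>D. ereal \<bar>f x\<bar>)" by (rule SUP_upper[OF assms(2)])
  also have "\<dots> \<le> ereal B" using assms(1) by simp
  finally show ?thesis by simp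
qed

locale smooth_paths =
  fixes M :: "'w measure" and D :: "(real ^ 'd) set" and k :: "real ^ 'd \<Rightarrow> real ^ 'd \<Rightarrow> real"
    and U :: "'w \<Rightarrow> real ^ 'd \<Rightarrow> real" and gradU :: "'w \<Rightarrow> real ^ 'd \<Rightarrow> real ^ 'd" and a b r :: real
  assumes prob: "prob_space M" and gp: "gaussian_process M D (\<lambda>_. 0) k U"
    and k_le_1: "\<forall>x\<in>D. k x x \<le> 1"
    and r: "0 < r" and Dbox: "D \<subseteq> cbox 0 (\<chi> i. r)" and Dconvex: "convex D"
    and U_differentiable: "\<forall>\<omega>\<in>space M. gradient_on D (U \<omega>) (gradU \<omega>)"
    and U_tail: "0 < a" "0 < b"
      "\<forall>B>0. \<forall>j.
         {\<omega> \<in> space M. (SUP x\<in>D. ereal \<bar>gradU \<omega> x $ j\<bar>) > ereal B} \<in> sets M \<and>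
         measure M {\<omega> \<in> space M. (SUP x\<in>D. ereal \<bar>gradU \<omega> x $ j\<bar>) > ereal B} \<le> a * exp (- (B / b)\<^sup>2)"
begin

lemma psd: "psd_on D k"
  by (rule gaussian_process_psd[OF gp])

definition steep :: "real \<Rightarrow> 'w set" where
  "steep B = (\<Union>j. {\<omega> \<in> space M. (SUP x\<in>D. ereal \<bar>gradU \<omega> x $ j\<bar>) > ereal B})"

lemma steep_sets: "0 < B \<Longrightarrow> steep B \<in> sets M"
  unfolding steep_def using U_tail(3) by (intro sets.finite_UN) auto

lemma measure_steep: "0 < B \<Longrightarrow> measure M (steep B) \<le> real CARD('d) * a * exp (- (B / b)\<^sup>2)"
proof -
  assume B: "0 < B"
  interpret prob_space M by (rule prob)
  have "measure M (steep B) \<le> (\<Sum>j\<in>UNIV. measure M {\<omega> \<in> space M. (SUP x\<in>D. ereal \<bar>gradU \<omega> x $ j\<bar>) > ereal B})"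
    unfolding steep_def using U_tail(3) B by (intro finite_measure_subadditive_finite) auto
  also have "\<dots> \<le> (\<Sum>j\<in>(UNIV :: 'd set). a * exp (- (B / b)\<^sup>2))"
    using U_tail(3) B by (intro sum_mono) blast
  finally show ?thesis by simp
qed

lemma Lipschitz_off_steep:
  assumes "0 < B" "\<omega> \<in> space M - steep B" "x \<in> D" "y \<in> D"
  shows "\<bar>U \<omega> x - U \<omega> y\<bar> \<le> real CARD('d) * B * norm (x - y)"
proof (rule gradient_bound_Lipschitz[OF _ Dconvex _ assms(3,4)])
  show "gradient_on D (U \<omega>) (gradU \<omega>)" using U_differentiable assms(2) by blast
  fix z j assume "z \<in> D"
  then show "\<bar>gradU \<omega> z $ j\<bar> \<le> B"
    using SUP_ereal_abs_leD[where D=D and f="\<lambda>x. gradU \<omega> x $ j" and B=B and x=z] assms(2) by (auto simp: steep_def)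
qed

text \<open>Off the steep event an increment of the process is at most \<open>B\<close> times the distance, up to the
  dimension. As the increment is normal, this bounds its variance.\<close>

lemma kdist_le:
  assumes B: "0 < B" "real CARD('d) * a * exp (- (B / b)\<^sup>2) \<le> 1 / 4" and "x \<in> D" "y \<in> D"
  shows "kdist k x y \<le> 4 / 3 * (real CARD('d) * B * norm (x - y))"
proof -
  interpret prob_space M by (rule prob)
  have "normal_rv M (lsum [(1, x), (-1, y)] (\<lambda>_. 0)) (quad k [(1, x), (-1, y)]) (\<lambda>\<omega>. lsum [(1, x), (-1, y)] (U \<omega>))"
    by (rule gaussian_process_lsum[OF gp]) (use assms in auto)
  then have n: "normal_rv M 0 (k x x - 2 * k x y + k y y) (\<lambda>\<omega>. U \<omega> x - U \<omega> y)"
    using quad_pair[of k x y, OF psd_onD_sym[OF psd assms(3,4)]] by simp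
  have "k x x - 2 * k x y + k y y \<le> (4 / 3 * (real CARD('d) * B * norm (x - y)))\<^sup>2"
  proof (rule normal_rv_variance_le[OF prob n])
    show "space M - steep B \<in> events" using steep_sets[OF B(1)] by auto
    show "3 / 4 \<le> prob (space M - steep B)"
      using prob_compl[OF steep_sets[OF B(1)]] measure_steep[OF B(1)] B(2) by simp
  qed (rule Lipschitz_off_steep[OF B(1) _ assms(3,4)])
  then show ?thesis unfolding kdist_def using B
    by (intro real_le_lsqrt) (auto simp: psd_on_kdist_nonneg[OF psd assms(3,4)])
qed

lemma kdist_Lipschitz: "\<exists>C>0. \<forall>x\<in>D. \<forall>y\<in>D. kdist k x y \<le> C * norm (x - y)"
proof -
  have "((\<lambda>B. real CARD('d) * a * exp (- (B / b)\<^sup>2)) \<longlongrightarrow> 0) at_top"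
    using U_tail(2) by real_asymp
  then have "eventually (\<lambda>B. real CARD('d) * a * exp (- (B / b)\<^sup>2) < 1 / 4) at_top"
    by (rule order_tendstoD) simp
  from eventually_conj[OF this eventually_gt_at_top[of 0]]
  obtain B where "0 < B" "real CARD('d) * a * exp (- (B / b)\<^sup>2) < 1 / 4"
    using eventually_happens'[OF trivial_limit_at_top_linorder] by blast
  then show ?thesis using kdist_le[of B]
    by (intro exI[of _ "4 / 3 * (real CARD('d) * B)"]) (auto simp: mult.assoc)
qed

lemma kernel_diff_le:
  assumes "x \<in> D" "y \<in> D" "x' \<in> D" "y' \<in> D"
  shows "\<bar>k x y - k x' y'\<bar> \<le> kdist k x x' + kdist k y y'"
proof -
  have s: "sqrt (k x x) \<le> 1" "sqrt (k y' y') \<le> 1" using k_le_1 assms by auto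
  have "\<bar>k x y - k x y'\<bar> \<le> kdist k y y' * sqrt (k x x)" by (rule psd_on_diff_le[OF psd assms(2,4,1)])
  also have "\<dots> \<le> kdist k y y'" using s psd_on_kdist_nonneg[OF psd assms(2,4)] by (simp add: mult_left_le)
  finally have 1: "\<bar>k x y - k x y'\<bar> \<le> kdist k y y'" .
  have "\<bar>k y' x - k y' x'\<bar> \<le> kdist k x x' * sqrt (k y' y')" by (rule psd_on_diff_le[OF psd assms(1,3,4)])
  also have "\<dots> \<le> kdist k x x'" using s psd_on_kdist_nonneg[OF psd assms(1,3)] by (simp add: mult_left_le)
  finally have "\<bar>k x y' - k x' y'\<bar> \<le> kdist k x x'" using psd_onD_sym[OF psd] assms by metis
  with 1 show ?thesis by linarith
qed

lemma kernel_continuous: "continuous_on (D \<times> D) (\<lambda>(x, y). k x y)"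
proof -
  obtain C where C: "C > 0" "\<And>x y. x \<in> D \<Longrightarrow> y \<in> D \<Longrightarrow> kdist k x y \<le> C * norm (x - y)"
    using kdist_Lipschitz by blast
  show ?thesis
    unfolding continuous_on_def
  proof (intro ballI)
    fix p assume p: "p \<in> D \<times> D"
    have "((\<lambda>q. case q of (x, y) \<Rightarrow> k x y - k (fst p) (snd p)) \<longlongrightarrow> 0) (at p within D \<times> D)"
    proof (rule Lim_null_comparison)
      show "\<forall>\<^sub>F q in at p within D \<times> D. norm (case q of (x, y) \<Rightarrow> k x y - k (fst p) (snd p)) \<le>
          C * norm (fst q - fst p) + C * norm (snd q - snd p)"
        unfolding eventually_at_filter
      proof (intro always_eventually allI impI)
        fix q assume "q \<in> D \<times> D"
        then show "norm (case q of (x, y) \<Rightarrow> k x y - k (fst p) (snd p)) \<le> C * norm (fst q - fst p) + C * norm (snd q - snd p)"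
          using p kernel_diff_le[of "fst q" "snd q" "fst p" "snd p"] C(2)[of "fst q" "fst p"] C(2)[of "snd q" "snd p"]
          by (auto simp: case_prod_beta)
      qed
      have "((\<lambda>q. C * norm (fst q - fst p) + C * norm (snd q - snd p)) \<longlongrightarrow>
          C * norm (fst p - fst p) + C * norm (snd p - snd p)) (at p within D \<times> D)"
        by (intro tendsto_intros)
      then show "((\<lambda>q. C * norm (fst q - fst p) + C * norm (snd q - snd p)) \<longlongrightarrow> 0) (at p within D \<times> D)" by simp
    qed
    then have "((\<lambda>q. (case q of (x, y) \<Rightarrow> k x y) - k (fst p) (snd p)) \<longlongrightarrow> 0) (at p within D \<times> D)"
      by (simp add: case_prod_beta)
    then show "((\<lambda>(x, y). k x y) \<longlongrightarrow> (case p of (x, y) \<Rightarrow> k x y)) (at p within D \<times> D)"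
      by (subst (asm) LIM_zero_iff) (simp add: case_prod_beta)
  qed
qed

lemma AE_Lipschitz: "AE \<omega> in M. \<exists>L\<ge>0. \<forall>x\<in>D. \<forall>y\<in>D. \<bar>U \<omega> x - U \<omega> y\<bar> \<le> L * norm (x - y)"
proof -
  interpret prob_space M by (rule prob)
  let ?N = "\<Inter>m. steep (real (Suc m))"
  have m: "?N \<in> events" using steep_sets by (intro sets.countable_INT) auto
  have "prob ?N \<le> real CARD('d) * a * exp (- (real (Suc m) / b)\<^sup>2)" for m
  proof -
    have "prob ?N \<le> prob (steep (real (Suc m)))"
      using steep_sets[of "real (Suc m)"] by (intro finite_measure_mono) auto
    then show ?thesis using measure_steep[of "real (Suc m)"] by simp
  qed
  moreover have "(\<lambda>m. real CARD('d) * a * exp (- (real (Suc m) / b)\<^sup>2)) \<longlonglongrightarrow> 0"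
    using U_tail(2) by real_asymp
  ultimately have "prob ?N \<le> 0" by (intro LIMSEQ_le_const[of _ 0]) auto
  then have "prob ?N = 0" by (simp add: measure_le_0_iff)
  then have "?N \<in> null_sets M" using m by (simp add: null_sets_def emeasure_eq_measure)
  from this show ?thesis
  proof (rule AE_I', intro subsetI INT_I)
    fix \<omega> m assume "\<omega> \<in> {\<omega> \<in> space M. \<not> (\<exists>L\<ge>0. \<forall>x\<in>D. \<forall>y\<in>D. \<bar>U \<omega> x - U \<omega> y\<bar> \<le> L * norm (x - y))}"
    then have \<omega>: "\<omega> \<in> space M" and n: "\<not> (\<exists>L\<ge>0. \<forall>x\<in>D. \<forall>y\<in>D. \<bar>U \<omega> x - U \<omega> y\<bar> \<le> L * norm (x - y))"
      by auto
    show "\<omega> \<in> steep (real (Suc m))"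
    proof (rule ccontr)
      assume "\<omega> \<notin> steep (real (Suc m))"
      then have "\<forall>x\<in>D. \<forall>y\<in>D. \<bar>U \<omega> x - U \<omega> y\<bar> \<le> real CARD('d) * real (Suc m) * norm (x - y)"
        using Lipschitz_off_steep[of "real (Suc m)" \<omega>] \<omega> by simp
      moreover have "0 \<le> real CARD('d) * real (Suc m)" by simp
      ultimately show False using n by blast
    qed
  qed
qed

end

text \<open>If the kernel does not distinguish points, its integral operator has rank at most one: all
  eigenfunctions with nonzero eigenvalue are constant, and two constants are not orthonormal.\<close>

lemma nondegenerate_kdist:
  assumes k: "psd_on D k" and \<nu>: "space \<nu> = D" and e: "kernel_eigenbasis \<nu> k e l" "nondegenerate_spectrum l"
  shows "\<exists>x\<in>D. \<exists>y\<in>D. kdist k x y \<noteq> 0"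
proof (rule ccontr)
  assume "\<not> ?thesis"
  then have z: "\<And>x y. x \<in> D \<Longrightarrow> y \<in> D \<Longrightarrow> kdist k x y = 0" by blast
  have "\<exists>i j. l i \<noteq> 0 \<and> l j \<noteq> 0 \<and> i \<noteq> j"
  proof -
    have inf: "infinite {i. l i \<noteq> 0}" using e(2) by (simp add: nondegenerate_spectrum_def)
    then obtain i where "l i \<noteq> 0" using not_finite_existsD by blast
    moreover obtain j where "j \<in> {i. l i \<noteq> 0} - {i}" using inf by (metis finite.emptyI infinite_remove equals0I)
    ultimately show ?thesis by blast
  qed
  then obtain i j where ij: "l i \<noteq> 0" "l j \<noteq> 0" "i \<noteq> j" by blast
  have const: "e i x = e i y" if "l i \<noteq> 0" "x \<in> D" "y \<in> D" for i x y
  proof -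
    have "k x w = k y w" if "w \<in> D" for w
      using psd_on_diff_le[OF k \<open>x \<in> D\<close> \<open>y \<in> D\<close> that] z[OF \<open>x \<in> D\<close> \<open>y \<in> D\<close>]
        psd_onD_sym[OF k _ that] \<open>x \<in> D\<close> \<open>y \<in> D\<close> by simp
    then have "(\<integral>w. k x w * e i w \<partial>\<nu>) = (\<integral>w. k y w * e i w \<partial>\<nu>)"
      using \<nu> by (intro Bochner_Integration.integral_cong) auto
    then have "l i * e i x = l i * e i y"
      using e(1) that \<nu> unfolding kernel_eigenbasis_def by auto
    then show ?thesis using that by simp
  qed
  have orth: "(\<integral>x. e i x * e j x \<partial>\<nu>) = (if i = j then 1 else 0)" for i j
    using e(1) unfolding kernel_eigenbasis_def by blast
  have "D \<noteq> {}"
  proof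
    assume "D = {}"
    then have "(\<integral>x. e i x * e i x \<partial>\<nu>) = (\<integral>x. 0 \<partial>\<nu>)"
      using \<nu> by (intro Bochner_Integration.integral_cong) auto
    then show False using orth[of i i] by simp
  qed
  then obtain x where x: "x \<in> D" by blast
  have I: "(\<integral>w. e i' w * e j' w \<partial>\<nu>) = e i' x * e j' x * measure \<nu> (space \<nu>)" if "l i' \<noteq> 0" "l j' \<noteq> 0" for i' j'
  proof -
    have "(\<integral>w. e i' w * e j' w \<partial>\<nu>) = (\<integral>w. e i' x * e j' x \<partial>\<nu>)"
      using const[OF that(1) _ x] const[OF that(2) _ x] \<nu> by (intro Bochner_Integration.integral_cong) auto
    then show ?thesis by simp
  qed
  have "e i x * e i x * measure \<nu> (space \<nu>) = 1" "e j x * e j x * measure \<nu> (space \<nu>) = 1"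
    "e i x * e j x * measure \<nu> (space \<nu>) = 0"
    using I[OF ij(1) ij(1)] I[OF ij(2) ij(2)] I[OF ij(1,2)] orth[of i i] orth[of j j] orth[of i j] ij(3) by auto
  then show False by auto
qed

section \<open>Nets in a box\<close>

lemma box_net:
  fixes D :: "(real ^ 'd) set"
  assumes r: "0 < r" and D: "D \<subseteq> cbox 0 (\<chi> i. r)" and q: "1 \<le> (q::nat)"
  shows "\<exists>P. finite P \<and> P \<subseteq> D \<and> card P \<le> (q + 1) ^ CARD('d) \<and>
    (\<forall>x\<in>D. \<exists>p\<in>P. norm (x - p) \<le> real CARD('d) * r / real q)"
proof -
  define c where "c x = (\<lambda>i. nat \<lfloor>x $ i * real q / r\<rfloor>)" for x :: "real ^ 'd"
  have cD: "c ` D \<subseteq> (UNIV :: 'd set) \<rightarrow>\<^sub>E {..q}"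
  proof
    fix f assume "f \<in> c ` D"
    then obtain x where x: "x \<in> D" "f = c x" by blast
    have "f i \<le> q" for i
    proof -
      have "x $ i \<le> r" using x D by (auto simp: mem_box_cart subset_eq)
      then have "x $ i * real q / r \<le> real q" using r mult_right_mono[of "x $ i" r "real q"] by (simp add: field_simps)
      then show ?thesis unfolding x c_def by (simp add: nat_le_iff floor_le_iff)
    qed
    then show "f \<in> UNIV \<rightarrow>\<^sub>E {..q}" by auto
  qed
  have fin: "finite ((UNIV :: 'd set) \<rightarrow>\<^sub>E {..q})" by (intro finite_PiE) auto
  define s where "s f = (SOME x. x \<in> D \<and> c x = f)" for f
  have s: "s f \<in> D \<and> c (s f) = f" if "f \<in> c ` D" for f
    unfolding s_def by (rule someI_ex) (use that in auto)
  let ?P = "s ` (c ` D)"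
  show ?thesis
  proof (intro exI[of _ ?P] conjI ballI)
    show "finite ?P" using finite_subset[OF cD fin] by blast
    show "?P \<subseteq> D" using s by blast
    have "card ?P \<le> card (c ` D)" by (intro card_image_le finite_subset[OF cD fin])
    also have "\<dots> \<le> card ((UNIV :: 'd set) \<rightarrow>\<^sub>E {..q})" by (rule card_mono[OF fin cD])
    also have "\<dots> = (q + 1) ^ CARD('d)" by (subst card_PiE) auto
    finally show "card ?P \<le> (q + 1) ^ CARD('d)" .
    fix x assume x: "x \<in> D"
    define p where "p = s (c x)"
    have p: "p \<in> D" "c p = c x" using s[of "c x"] x by (auto simp: p_def)
    have "\<bar>(x - p) $ i\<bar> \<le> r / real q" for i
    proof -
      have nn: "0 \<le> x $ i * real q / r" "0 \<le> p $ i * real q / r"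
        using x p D r by (auto simp: mem_box_cart subset_eq)
      have "nat \<lfloor>x $ i * real q / r\<rfloor> = nat \<lfloor>p $ i * real q / r\<rfloor>"
        using fun_cong[OF p(2), of i] by (simp add: c_def)
      then have "\<lfloor>x $ i * real q / r\<rfloor> = \<lfloor>p $ i * real q / r\<rfloor>" using nn by (simp add: eq_nat_nat_iff)
      then have "\<bar>x $ i * real q / r - p $ i * real q / r\<bar> < 1" by linarith
      then have "\<bar>(x $ i - p $ i) * real q / r\<bar> < 1"
        by (simp add: left_diff_distrib diff_divide_distrib)
      then have "\<bar>x $ i - p $ i\<bar> * real q / r < 1" using r by (simp add: abs_mult)
      then show ?thesis using r q by (simp add: field_simps)
    qed
    then have "(\<Sum>i\<in>UNIV. \<bar>(x - p) $ i\<bar>) \<le> (\<Sum>i\<in>(UNIV :: 'd set). r / real q)" by (rule sum_mono)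
    then have "norm (x - p) \<le> real CARD('d) * r / real q" using norm_le_l1_cart[of "x - p"] by simp
    then show "\<exists>p\<in>?P. norm (x - p) \<le> real CARD('d) * r / real q" using x by (auto simp: p_def)
  qed
qed

section \<open>Information gain\<close>

text \<open>The mutual information between the process and noisy observations at the points of the list.\<close>

definition info :: "('a \<Rightarrow> 'a \<Rightarrow> real) \<Rightarrow> real \<Rightarrow> 'a list \<Rightarrow> real" where
  "info k \<sigma> xs = 1 / 2 * ln (Determinant.det (1\<^sub>m (length xs) + (1 / \<sigma>\<^sup>2) \<cdot>\<^sub>m gram k xs))"

context gp_prior
begin

lemma info_eq_sum:
  assumes "set xs \<subseteq> D"
  shows "info k \<sigma> xs = 1 / 2 * (\<Sum>i<length xs. ln (1 + post_var k \<sigma> (take i xs) (xs ! i) / \<sigma>\<^sup>2))"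
proof -
  have pv: "0 \<le> post_var k \<sigma> (take i xs) (xs ! i)" if "i < length xs" for i
    using assms that by (intro post_var_nonneg) (auto dest: in_set_takeD)
  have "1 + post_var k \<sigma> (take i xs) (xs ! i) / \<sigma>\<^sup>2 \<noteq> 0" if "i < length xs" for i
  proof -
    have "0 \<le> post_var k \<sigma> (take i xs) (xs ! i) / \<sigma>\<^sup>2"
      using pv[OF that] by simp
    then show ?thesis by linarith
  qed
  then have "ln (\<Prod>i<length xs. 1 + post_var k \<sigma> (take i xs) (xs ! i) / \<sigma>\<^sup>2) =
      (\<Sum>i<length xs. ln (1 + post_var k \<sigma> (take i xs) (xs ! i) / \<sigma>\<^sup>2))"
    by (intro ln_prod) auto
  then show ?thesis unfolding info_def det_info_eq_prod[OF assms] by simp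
qed

lemma info_snoc:
  assumes "set xs \<subseteq> D" "x \<in> D"
  shows "info k \<sigma> (xs @ [x]) = info k \<sigma> xs + 1 / 2 * ln (1 + post_var k \<sigma> xs x / \<sigma>\<^sup>2)"
  using assms by (simp add: info_eq_sum nth_append)

lemma post_var_le_1: "\<forall>x\<in>D. k x x \<le> 1 \<Longrightarrow> set xs \<subseteq> D \<Longrightarrow> z \<in> D \<Longrightarrow> post_var k \<sigma> xs z \<le> 1"
  using post_var_le_prior[of xs z] by force

lemma ln_info_bounds:
  assumes "0 \<le> v" "v \<le> 1"
  shows "ln (1 + v / \<sigma>\<^sup>2) \<le> v / \<sigma>\<^sup>2" "v \<le> (1 + \<sigma>\<^sup>2) * ln (1 + v / \<sigma>\<^sup>2)" "0 \<le> ln (1 + v / \<sigma>\<^sup>2)"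
proof -
  have s: "0 < \<sigma>\<^sup>2" using noise_pos by simp
  have w: "0 \<le> v / \<sigma>\<^sup>2" using assms by simp
  show "ln (1 + v / \<sigma>\<^sup>2) \<le> v / \<sigma>\<^sup>2" "0 \<le> ln (1 + v / \<sigma>\<^sup>2)" using w ln_add_one_self_le_self[OF w] by auto
  have "1 - 1 / (1 + v / \<sigma>\<^sup>2) \<le> ln (1 + v / \<sigma>\<^sup>2)"
    using ln_le_minus_one[of "1 / (1 + v / \<sigma>\<^sup>2)"] w by (simp add: ln_div)
  moreover have "1 - 1 / (1 + v / \<sigma>\<^sup>2) = v / (\<sigma>\<^sup>2 + v)"
  proof -
    have "0 < \<sigma>\<^sup>2 + v" using s assms(1) by linarith
    then have "\<sigma>\<^sup>2 + v \<noteq> 0" "\<sigma>\<^sup>2 \<noteq> 0" using s by auto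
    moreover from this have "1 + v / \<sigma>\<^sup>2 = (\<sigma>\<^sup>2 + v) / \<sigma>\<^sup>2" by (simp add: add_divide_distrib)
    ultimately show ?thesis by (simp add: field_simps)
  qed
  ultimately have "v / (\<sigma>\<^sup>2 + v) \<le> ln (1 + v / \<sigma>\<^sup>2)" by simp
  then have "(\<sigma>\<^sup>2 + v) * (v / (\<sigma>\<^sup>2 + v)) \<le> (1 + \<sigma>\<^sup>2) * ln (1 + v / \<sigma>\<^sup>2)"
    using s assms by (intro mult_mono) auto
  then show "v \<le> (1 + \<sigma>\<^sup>2) * ln (1 + v / \<sigma>\<^sup>2)" using s assms by simp
qed

lemma info_bounds:
  assumes k1: "\<forall>x\<in>D. k x x \<le> 1" and "set xs \<subseteq> D"
  shows "info k \<sigma> xs \<le> 1 / (2 * \<sigma>\<^sup>2) * (\<Sum>i<length xs. post_var k \<sigma> (take i xs) (xs ! i))"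
    and "(\<Sum>i<length xs. post_var k \<sigma> (take i xs) (xs ! i)) \<le> 2 * (1 + \<sigma>\<^sup>2) * info k \<sigma> xs"
    and "0 \<le> info k \<sigma> xs"
proof -
  have v: "0 \<le> post_var k \<sigma> (take i xs) (xs ! i)" "post_var k \<sigma> (take i xs) (xs ! i) \<le> 1" if "i < length xs" for i
    using assms that by (auto intro!: post_var_nonneg post_var_le_1 dest: in_set_takeD)
  have "(\<Sum>i<length xs. ln (1 + post_var k \<sigma> (take i xs) (xs ! i) / \<sigma>\<^sup>2)) \<le> (\<Sum>i<length xs. post_var k \<sigma> (take i xs) (xs ! i) / \<sigma>\<^sup>2)"
    using v by (intro sum_mono ln_info_bounds) auto
  then show "info k \<sigma> xs \<le> 1 / (2 * \<sigma>\<^sup>2) * (\<Sum>i<length xs. post_var k \<sigma> (take i xs) (xs ! i))"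
    unfolding info_eq_sum[OF assms(2)] sum_divide_distrib[symmetric] by simp
  have half: "2 * (1 + \<sigma>\<^sup>2) * (1 / 2 * S) = (1 + \<sigma>\<^sup>2) * S" for S :: real by simp
  have "(\<Sum>i<length xs. post_var k \<sigma> (take i xs) (xs ! i)) \<le> (\<Sum>i<length xs. (1 + \<sigma>\<^sup>2) * ln (1 + post_var k \<sigma> (take i xs) (xs ! i) / \<sigma>\<^sup>2))"
    using v by (intro sum_mono ln_info_bounds) auto
  then show "(\<Sum>i<length xs. post_var k \<sigma> (take i xs) (xs ! i)) \<le> 2 * (1 + \<sigma>\<^sup>2) * info k \<sigma> xs"
    unfolding info_eq_sum[OF assms(2)] sum_distrib_left[symmetric] by (simp only: half)
  have "0 \<le> (\<Sum>i<length xs. ln (1 + post_var k \<sigma> (take i xs) (xs ! i) / \<sigma>\<^sup>2))"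
    using v by (intro sum_nonneg ln_info_bounds(3)) auto
  then show "0 \<le> info k \<sigma> xs" unfolding info_eq_sum[OF assms(2)] by simp
qed

lemma info_Cons_ge:
  assumes k1: "\<forall>x\<in>D. k x x \<le> 1" and "set xs \<subseteq> D" "x \<in> D"
  shows "1 / 2 * ln (1 + k x x / \<sigma>\<^sup>2) \<le> info k \<sigma> (x # xs)"
  using assms(2)
proof (induction xs rule: rev_induct)
  case Nil
  then show ?case using info_snoc[of "[]" x] assms(3) info_eq_sum[of "[]"] by (simp add: post_var_def)
next
  case (snoc y ys)
  have D: "set (x # ys) \<subseteq> D" "y \<in> D" using snoc.prems assms(3) by auto
  have "0 \<le> ln (1 + post_var k \<sigma> (x # ys) y / \<sigma>\<^sup>2)"
    using ln_info_bounds(3)[OF post_var_nonneg[OF D] post_var_le_1[OF k1 D]] .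
  then show ?case using info_snoc[OF D] snoc by simp
qed

text \<open>Sampling at a point of large posterior variance reduces the posterior variance at the
  nearest point of a net by a fixed amount. The sum of the posterior variances over the net is a
  potential that pays for all such samples.\<close>

lemma sum_post_var_le:
  assumes k1: "\<forall>x\<in>D. k x x \<le> 1" and xs: "set xs \<subseteq> D"
    and P: "finite P" "P \<subseteq> D" and \<theta>: "0 < \<theta>"
    and net: "\<And>x. x \<in> D \<Longrightarrow> \<exists>p\<in>P. (kdist k x p)\<^sup>2 \<le> \<theta> / 2"
  shows "(\<Sum>i<length xs. post_var k \<sigma> (take i xs) (xs ! i)) \<le>
    \<theta> * real (length xs) + 16 * (1 + \<sigma>\<^sup>2) / \<theta>\<^sup>2 * real (card P)"
proof -
  define \<kappa> where "\<kappa> = \<theta>\<^sup>2 / (16 * (1 + \<sigma>\<^sup>2))"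
  have \<kappa>: "0 < \<kappa>" unfolding \<kappa>_def using \<theta> by (intro divide_pos_pos mult_pos_pos add_pos_nonneg) auto
  have "(\<Sum>i<length xs. post_var k \<sigma> (take i xs) (xs ! i)) \<le>
    \<theta> * real (length xs) + (real (card P) - (\<Sum>p\<in>P. post_var k \<sigma> xs p)) / \<kappa>"
    using xs
  proof (induction xs rule: rev_induct)
    case Nil
    have "(\<Sum>p\<in>P. post_var k \<sigma> [] p) \<le> (\<Sum>p\<in>P. 1)"
      using k1 P by (intro sum_mono) (auto simp: post_var_def)
    then show ?case using \<kappa> by simp
  next
    case (snoc x xs)
    have D: "set xs \<subseteq> D" "x \<in> D" using snoc.prems by auto
    let ?v = "post_var k \<sigma> xs x"
    have v: "0 \<le> ?v" "?v \<le> 1" using post_var_nonneg[OF D] post_var_le_1[OF k1 D] by auto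
    have dec: "post_var k \<sigma> (xs @ [x]) p \<le> post_var k \<sigma> xs p" if "p \<in> P" for p
      using post_var_snoc_le[OF D] that P by auto
    have step: "?v \<le> \<theta> + ((\<Sum>p\<in>P. post_var k \<sigma> xs p) - (\<Sum>p\<in>P. post_var k \<sigma> (xs @ [x]) p)) / \<kappa>"
    proof (cases "?v \<le> \<theta>")
      case True
      have "(\<Sum>p\<in>P. post_var k \<sigma> (xs @ [x]) p) \<le> (\<Sum>p\<in>P. post_var k \<sigma> xs p)" by (intro sum_mono dec)
      then have "0 \<le> ((\<Sum>p\<in>P. post_var k \<sigma> xs p) - (\<Sum>p\<in>P. post_var k \<sigma> (xs @ [x]) p)) / \<kappa>" using \<kappa> by simp
      then show ?thesis using True by linarith
    next
      case False
      obtain p where p: "p \<in> P" "(kdist k x p)\<^sup>2 \<le> \<theta> / 2" using net[OF D(2)] by blast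
      have pD: "p \<in> D" using p P by auto
      define c where "c = post_cov k \<sigma> xs p x"
      have sym: "post_cov k \<sigma> xs x p = c"
        using psd_onD_sym[OF psd_post_cov[OF D(1)] D(2) pD] by (simp add: c_def)
      have vp: "0 \<le> post_var k \<sigma> xs p" by (rule post_var_nonneg[OF D(1) pD])
      have "(kdist (post_cov k \<sigma> xs) x p)\<^sup>2 \<le> (kdist k x p)\<^sup>2"
        by (intro power_mono kdist_post_cov_le[OF D(1,2) pD] psd_on_kdist_nonneg[OF psd_post_cov[OF D(1)] D(2) pD])
      then have "?v - 2 * c + post_var k \<sigma> xs p \<le> \<theta> / 2"
        unfolding psd_on_kdist_nonneg(3)[OF psd_post_cov[OF D(1)] D(2) pD] sym using p(2)
        by (simp add: post_var_def)
      then have c: "\<theta> / 4 \<le> c" using False vp by linarith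
      have "(\<theta> / 4)\<^sup>2 / (1 + \<sigma>\<^sup>2) \<le> c\<^sup>2 / (?v + \<sigma>\<^sup>2)"
        using c \<theta> v post_var_noise_pos[OF D] by (intro frac_le power_mono) auto
      then have "\<kappa> \<le> c * c / (?v + \<sigma>\<^sup>2)" by (simp add: \<kappa>_def power2_eq_square)
      then have dp: "post_var k \<sigma> (xs @ [x]) p \<le> post_var k \<sigma> xs p - \<kappa>"
        using post_cov_update[OF D pD pD] sym by (simp add: post_var_def c_def)
      have "(\<Sum>q\<in>P. post_var k \<sigma> (xs @ [x]) q) =
          post_var k \<sigma> (xs @ [x]) p + (\<Sum>q\<in>P - {p}. post_var k \<sigma> (xs @ [x]) q)"
        using P(1) p(1) by (rule sum.remove)
      also have "\<dots> \<le> (post_var k \<sigma> xs p - \<kappa>) + (\<Sum>q\<in>P - {p}. post_var k \<sigma> xs q)"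
        using dec by (intro add_mono dp sum_mono) auto
      also have "\<dots> = (\<Sum>q\<in>P. post_var k \<sigma> xs q) - \<kappa>"
        using sum.remove[OF P(1) p(1), of "post_var k \<sigma> xs"] by simp
      finally have "1 \<le> ((\<Sum>p\<in>P. post_var k \<sigma> xs p) - (\<Sum>p\<in>P. post_var k \<sigma> (xs @ [x]) p)) / \<kappa>"
        using \<kappa> by (simp add: field_simps)
      then show ?thesis using v(2) \<theta> by linarith
    qed
    have "(\<Sum>i<length (xs @ [x]). post_var k \<sigma> (take i (xs @ [x])) ((xs @ [x]) ! i)) =
        (\<Sum>i<length xs. post_var k \<sigma> (take i xs) (xs ! i)) + ?v"
      by (simp add: nth_append)
    then show ?case using step snoc.IH[OF D(1)] by (simp add: diff_divide_distrib algebra_simps)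
  qed
  also have "\<dots> \<le> \<theta> * real (length xs) + real (card P) / \<kappa>"
  proof -
    have "0 \<le> (\<Sum>p\<in>P. post_var k \<sigma> xs p)" using P xs by (intro sum_nonneg post_var_nonneg) auto
    then show ?thesis using \<kappa> by (simp add: divide_right_mono)
  qed
  finally show ?thesis by (simp add: \<kappa>_def mult.commute)
qed

end

text \<open>The determinant is a polynomial in the entries.\<close>

lemma det_tendsto:
  fixes A :: "nat \<Rightarrow> real mat"
  assumes "\<And>m. A m \<in> carrier_mat n n" "B \<in> carrier_mat n n"
    and "\<And>i j. i < n \<Longrightarrow> j < n \<Longrightarrow> (\<lambda>m. A m $$ (i, j)) \<longlonglongrightarrow> B $$ (i, j)"
  shows "(\<lambda>m. Determinant.det (A m)) \<longlonglongrightarrow> Determinant.det B"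
  unfolding det_def'[OF assms(1)] det_def'[OF assms(2)]
proof (intro tendsto_sum tendsto_mult tendsto_const tendsto_prod)
  fix p i assume "p \<in> {p. p permutes {0..<n}}" "i \<in> {0..<n}"
  then show "(\<lambda>m. A m $$ (i, p i)) \<longlonglongrightarrow> B $$ (i, p i)"
    using permutes_in_image[of p "{0..<n}" i] by (intro assms(3)) auto
qed

text \<open>The algorithm may revisit points, while the information gain is a supremum over sets. Since the
  determinant is continuous, it is enough to separate repeated points by arbitrarily small moves.\<close>

lemma distinct_approximation:
  fixes D :: "'a::metric_space set"
  assumes "\<And>x. x \<in> D \<Longrightarrow> x islimpt D" "set xs \<subseteq> D" "0 < \<epsilon>"
  shows "\<exists>ys. distinct ys \<and> set ys \<subseteq> D \<and> length ys = length xs \<and> (\<forall>i<length xs. dist (ys ! i) (xs ! i) < \<epsilon>)"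
  using assms(2)
proof (induction xs rule: rev_induct)
  case Nil
  then show ?case by simp
next
  case (snoc x xs)
  then obtain ys where ys: "distinct ys" "set ys \<subseteq> D" "length ys = length xs" "\<forall>i<length xs. dist (ys ! i) (xs ! i) < \<epsilon>"
    by auto
  have "infinite (D \<inter> ball x \<epsilon>)"
    using assms(1)[of x] snoc.prems assms(3) islimpt_eq_infinite_ball[of x D] by auto
  then have "infinite (D \<inter> ball x \<epsilon> - set ys)" by simp
  then obtain y where "y \<in> D" "dist x y < \<epsilon>" "y \<notin> set ys"
    by (metis DiffD1 DiffD2 IntD1 IntD2 finite.emptyI equals0I mem_ball)
  then show ?case using ys by (intro exI[of _ "ys @ [y]"]) (auto simp: nth_append dist_commute less_Suc_eq)
qed

locale gp_prior_continuum = gp_prior D k \<sigma>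
  for D :: "'a::metric_space set" and k :: "'a \<Rightarrow> 'a \<Rightarrow> real" and \<sigma> :: real +
  assumes k_le_1: "\<forall>x\<in>D. k x x \<le> 1"
    and k_continuous: "continuous_on (D \<times> D) (\<lambda>(x, y). k x y)"
    and perfect: "\<And>x. x \<in> D \<Longrightarrow> x islimpt D"
begin

lemma info_le_length:
  assumes "set xs \<subseteq> D"
  shows "info k \<sigma> xs \<le> 1 / (2 * \<sigma>\<^sup>2) * real (length xs)"
proof -
  have "(\<Sum>i<length xs. post_var k \<sigma> (take i xs) (xs ! i)) \<le> (\<Sum>i<length xs. 1)"
    using assms by (intro sum_mono post_var_le_1[OF k_le_1]) (auto dest: in_set_takeD)
  then have "1 / (2 * \<sigma>\<^sup>2) * (\<Sum>i<length xs. post_var k \<sigma> (take i xs) (xs ! i)) \<le> 1 / (2 * \<sigma>\<^sup>2) * real (length xs)"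
    by (intro mult_left_mono) auto
  then show ?thesis using info_bounds(1)[OF k_le_1 assms] by linarith
qed

lemma info_gain_eq: "info_gain k \<sigma> D T = (SUP xs\<in>{xs. distinct xs \<and> set xs \<subseteq> D \<and> length xs = T}. info k \<sigma> xs)"
  unfolding info_gain_def info_def by (intro SUP_cong refl) auto

lemma info_gain_upper:
  assumes "distinct xs" "set xs \<subseteq> D"
  shows "info k \<sigma> xs \<le> info_gain k \<sigma> D (length xs)"
  unfolding info_gain_eq
proof (rule cSUP_upper)
  show "bdd_above (info k \<sigma> ` {ys. distinct ys \<and> set ys \<subseteq> D \<and> length ys = length xs})"
    by (rule bdd_aboveI2[where M="1 / (2 * \<sigma>\<^sup>2) * real (length xs)"]) (use info_le_length in force)
qed (use assms in auto)

lemma info_le_info_gain: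
  assumes "set xs \<subseteq> D"
  shows "info k \<sigma> xs \<le> info_gain k \<sigma> D (length xs)"
proof -
  let ?n = "length xs"
  have "\<forall>m. \<exists>ys. distinct ys \<and> set ys \<subseteq> D \<and> length ys = ?n \<and> (\<forall>i<?n. dist (ys ! i) (xs ! i) < inverse (real (Suc m)))"
    using distinct_approximation[OF perfect assms] by simp
  from choice[OF this] obtain ys where ys: "\<And>m. distinct (ys m)" "\<And>m. set (ys m) \<subseteq> D" "\<And>m. length (ys m) = ?n"
    "\<And>m i. i < ?n \<Longrightarrow> dist (ys m ! i) (xs ! i) < inverse (real (Suc m))" by blast
  have lim: "(\<lambda>m. ys m ! i) \<longlonglongrightarrow> xs ! i" if "i < ?n" for i
  proof (rule tendsto_dist_iff[THEN iffD2])
    show "(\<lambda>m. dist (ys m ! i) (xs ! i)) \<longlonglongrightarrow> 0"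
      by (rule tendsto_sandwich[OF _ _ tendsto_const LIMSEQ_inverse_real_of_nat])
        (use ys(4)[OF that] in \<open>auto intro!: always_eventually less_imp_le\<close>)
  qed
  have yD: "ys m ! i \<in> D" if "i < ?n" for m i using ys(2)[of m] ys(3)[of m] that nth_mem[of i "ys m"] by auto
  have kl: "(\<lambda>m. k (ys m ! i) (ys m ! j)) \<longlonglongrightarrow> k (xs ! i) (xs ! j)" if ij: "i < ?n" "j < ?n" for i j
  proof -
    have "(xs ! i, xs ! j) \<in> D \<times> D" using assms ij nth_mem by blast
    moreover have "(\<lambda>m. (ys m ! i, ys m ! j)) \<longlonglongrightarrow> (xs ! i, xs ! j)" by (intro tendsto_Pair lim ij)
    ultimately have "(\<lambda>m. case (ys m ! i, ys m ! j) of (x, y) \<Rightarrow> k x y) \<longlonglongrightarrow> (case (xs ! i, xs ! j) of (x, y) \<Rightarrow> k x y)"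
      using yD ij by (intro continuous_on_tendsto_compose[OF k_continuous]) (auto intro!: always_eventually)
    then show ?thesis by simp
  qed
  define A where "A zs = 1\<^sub>m ?n + (1 / \<sigma>\<^sup>2) \<cdot>\<^sub>m gram k zs" for zs :: "'a list"
  have "(\<lambda>m. Determinant.det (A (ys m))) \<longlonglongrightarrow> Determinant.det (A xs)"
  proof (rule det_tendsto[of _ ?n])
    fix i j assume ij: "i < ?n" "j < ?n"
    have "A zs $$ (i, j) = (if i = j then 1 else 0) + 1 / \<sigma>\<^sup>2 * k (zs ! i) (zs ! j)" if "length zs = ?n" for zs
      using that ij by (auto simp: A_def gram_def)
    then show "(\<lambda>m. A (ys m) $$ (i, j)) \<longlonglongrightarrow> A xs $$ (i, j)"
      using ys(3) noise_pos by (auto intro!: tendsto_intros kl ij)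
  qed (use ys(3) in \<open>auto simp: A_def gram_def\<close>)
  moreover have d: "Determinant.det (A zs) > 0" if "set zs \<subseteq> D" "length zs = ?n" for zs
  proof -
    have "0 < 1 + post_var k \<sigma> (take i zs) (zs ! i) / \<sigma>\<^sup>2" if "i < length zs" for i
      using \<open>set zs \<subseteq> D\<close> that by (intro add_pos_nonneg divide_nonneg_nonneg post_var_nonneg) (auto dest: in_set_takeD)
    then show ?thesis using det_info_eq_prod[OF that(1)] that(2) by (auto simp: A_def intro!: prod_pos)
  qed
  ultimately have "(\<lambda>m. 1 / 2 * ln (Determinant.det (A (ys m)))) \<longlonglongrightarrow> 1 / 2 * ln (Determinant.det (A xs))"
    using d[OF assms refl] by (intro tendsto_intros) auto
  then have "(\<lambda>m. info k \<sigma> (ys m)) \<longlonglongrightarrow> info k \<sigma> xs" unfolding info_def A_def ys(3) .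
  then show ?thesis
    by (rule LIMSEQ_le_const2) (use info_gain_upper[OF ys(1,2)] ys(3) in auto)
qed

lemma info_gain_lower:
  assumes "x \<in> D" "1 \<le> T"
  shows "1 / 2 * ln (1 + k x x / \<sigma>\<^sup>2) \<le> info_gain k \<sigma> D T"
proof -
  have "set (replicate (T - 1) x) \<subseteq> D" using assms by auto
  from info_Cons_ge[OF k_le_1 this assms(1)] info_le_info_gain[of "x # replicate (T - 1) x"] this assms
  show ?thesis by auto
qed

lemma info_gain_le:
  assumes P: "finite P" "P \<subseteq> D" and \<theta>: "0 < \<theta>" and D: "D \<noteq> {}"
    and net: "\<And>x. x \<in> D \<Longrightarrow> \<exists>p\<in>P. (kdist k x p)\<^sup>2 \<le> \<theta> / 2"
  shows "info_gain k \<sigma> D T \<le> 1 / (2 * \<sigma>\<^sup>2) * (\<theta> * real T + 16 * (1 + \<sigma>\<^sup>2) / \<theta>\<^sup>2 * real (card P))"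
  unfolding info_gain_eq
proof (rule cSUP_least)
  obtain x where x: "x \<in> D" using D by blast
  have "set (replicate T x) \<subseteq> D" using x by auto
  from distinct_approximation[OF perfect this, of 1]
  show "{xs. distinct xs \<and> set xs \<subseteq> D \<and> length xs = T} \<noteq> {}" by auto
  fix xs assume "xs \<in> {xs. distinct xs \<and> set xs \<subseteq> D \<and> length xs = T}"
  then have xs: "set xs \<subseteq> D" "length xs = T" by auto
  have "info k \<sigma> xs \<le> 1 / (2 * \<sigma>\<^sup>2) * (\<Sum>i<length xs. post_var k \<sigma> (take i xs) (xs ! i))"
    by (rule info_bounds(1)[OF k_le_1 xs(1)])
  also have "\<dots> \<le> 1 / (2 * \<sigma>\<^sup>2) * (\<theta> * real T + 16 * (1 + \<sigma>\<^sup>2) / \<theta>\<^sup>2 * real (card P))"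
    using sum_post_var_le[OF k_le_1 xs(1) P \<theta> net] xs(2) by (intro mult_left_mono) auto
  finally show "info k \<sigma> xs \<le> 1 / (2 * \<sigma>\<^sup>2) * (\<theta> * real T + 16 * (1 + \<sigma>\<^sup>2) / \<theta>\<^sup>2 * real (card P))" .
qed

end

section \<open>Regret along one path\<close>

text \<open>Summing the recursion produces the sum itself with the factor \<open>\<eta>\<close> on the right, where it is absorbed.
  The term \<open>\<eta> * A T\<close> in the proof is the one left over at the upper end.\<close>

lemma contraction_sum_le:
  fixes A \<delta> :: "nat \<Rightarrow> real"
  assumes \<eta>: "0 \<le> \<eta>" "\<eta> < 1" and A0: "\<And>n. 0 \<le> A n" and \<delta>0: "\<And>n. 0 \<le> \<delta> n"
    and step: "\<And>n. N < n \<Longrightarrow> A n \<le> \<eta> * (A (n - 1) + \<delta> n)" and T: "N \<le> T"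
  shows "(\<Sum>n=Suc N..T. A n) \<le> 1 / (1 - \<eta>) * (A N + (\<Sum>n=Suc N..T. \<delta> n))"
proof -
  have "(1 - \<eta>) * (\<Sum>n=Suc N..T. A n) + \<eta> * A T \<le> A N + (\<Sum>n=Suc N..T. \<delta> n)"
    using T
  proof (induction T rule: dec_induct)
    case base
    then show ?case using mult_right_mono[of \<eta> 1 "A N"] \<eta> A0 by simp
  next
    case (step T)
    have "A (Suc T) \<le> \<eta> * A T + \<eta> * \<delta> (Suc T)" using assms(5)[of "Suc T"] step(1) by (simp add: distrib_left)
    moreover have "\<eta> * \<delta> (Suc T) \<le> \<delta> (Suc T)" using \<eta> \<delta>0[of "Suc T"] mult_right_mono[of \<eta> 1 "\<delta> (Suc T)"] by simp
    ultimately show ?case using step by (simp add: algebra_simps)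
  qed
  moreover have "0 \<le> \<eta> * A T" using \<eta> A0 by simp
  ultimately have "(1 - \<eta>) * (\<Sum>n=Suc N..T. A n) \<le> A N + (\<Sum>n=Suc N..T. \<delta> n)" by linarith
  then show ?thesis using \<eta> by (simp add: field_simps)
qed

lemma sum_inverse_sqrt_le: "(\<Sum>n=1..T. 1 / sqrt (real n)) \<le> 2 * sqrt (real T)"
proof (induction T)
  case (Suc T)
  have "1 / sqrt (real (Suc T)) \<le> 2 * (sqrt (real (Suc T)) - sqrt (real T))"
  proof -
    have "(sqrt (real (Suc T)) - sqrt (real T)) * (sqrt (real (Suc T)) + sqrt (real T)) = 1"
      by (simp add: algebra_simps)
    moreover have "(sqrt (real (Suc T)) - sqrt (real T)) * (sqrt (real (Suc T)) + sqrt (real T)) \<le>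
        (sqrt (real (Suc T)) - sqrt (real T)) * (2 * sqrt (real (Suc T)))"
      by (intro mult_left_mono) auto
    ultimately have "1 \<le> (sqrt (real (Suc T)) - sqrt (real T)) * (2 * sqrt (real (Suc T)))" by linarith
    then have "1 \<le> 2 * (sqrt (real (Suc T)) - sqrt (real T)) * sqrt (real (Suc T))" by (simp only: mult_ac)
    then show ?thesis by (subst divide_le_eq) simp
  qed
  then show ?case using Suc by simp
qed simp

lemma sum_mult_sqrt_le:
  fixes \<rho> :: "nat \<Rightarrow> real"
  assumes "\<And>n. 0 \<le> \<rho> n" "finite I" "card I \<le> T"
  shows "(\<Sum>n\<in>I. sqrt (\<rho> n)) \<le> sqrt (real T * (\<Sum>n\<in>I. \<rho> n))"
proof -
  have "(\<Sum>n\<in>I. sqrt (\<rho> n) * 1)\<^sup>2 \<le> (\<Sum>n\<in>I. (sqrt (\<rho> n))\<^sup>2) * (\<Sum>n\<in>I. 1\<^sup>2)"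
    by (rule Cauchy_Schwarz_ineq_sum)
  also have "\<dots> = (\<Sum>n\<in>I. \<rho> n) * real (card I)" using assms(1) by simp
  also have "\<dots> \<le> (\<Sum>n\<in>I. \<rho> n) * real T" using assms by (intro mult_left_mono sum_nonneg) auto
  finally show ?thesis by (intro real_le_rsqrt) (simp add: mult.commute)
qed

text \<open>One realisation of the algorithm: sampled points \<open>x\<close>, observations \<open>y\<close>, unknown function \<open>u\<close>, known
  function \<open>v n\<close> at the \<open>n\<close>-th sampling time and exploration weights \<open>s\<close>. The \<open>gap\<close> is the
  suboptimality of \<open>x n\<close> for the acquisition function \<open>\<phi> n\<close>, the \<open>loss\<close> its suboptimality for the
  true objective.\<close>

locale ucb_path = gp_prior D k \<sigma>
  for D :: "'a::real_normed_vector set" and k :: "'a \<Rightarrow> 'a \<Rightarrow> real" and \<sigma> :: real +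
  fixes x :: "nat \<Rightarrow> 'a" and y :: "nat \<Rightarrow> real" and u :: "'a \<Rightarrow> real" and v :: "nat \<Rightarrow> 'a \<Rightarrow> real"
    and s \<Delta> :: "nat \<Rightarrow> real" and \<eta> :: real
  assumes k_le_1: "\<forall>x\<in>D. k x x \<le> 1"
    and x_in_D: "\<And>n. x n \<in> D"
    and \<eta>: "0 \<le> \<eta>" "\<eta> < 1"
begin

definition mu :: "nat \<Rightarrow> 'a \<Rightarrow> real" where
  "mu n = post_mean k \<sigma> (data_upto x n) (data_upto y n)"
definition va :: "nat \<Rightarrow> 'a \<Rightarrow> real" where
  "va n = post_var k \<sigma> (data_upto x n)"
definition \<phi> :: "nat \<Rightarrow> 'a \<Rightarrow> real" where
  "\<phi> n z = v n z + (mu (n - 1) z + s n * sqrt (va (n - 1) z))"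
definition gap :: "nat \<Rightarrow> real" where
  "gap n = (SUP z\<in>D. \<phi> n z) - \<phi> n (x n)"
definition loss :: "nat \<Rightarrow> real" where
  "loss n = (SUP z\<in>D. v n z + u z) - (v n (x n) + u (x n))"

lemma data_D: "set (data_upto x n) \<subseteq> D"
  using x_in_D by (auto simp: data_upto_def)

lemma data_length: "length (data_upto y n) = length (data_upto x n)"
  by (simp add: data_upto_def)

lemma data_Suc: "data_upto f (Suc n) = data_upto f n @ [f (Suc n)]"
  by (simp add: data_upto_def)

lemma va_bounds: "z \<in> D \<Longrightarrow> 0 \<le> va n z" "z \<in> D \<Longrightarrow> va n z \<le> 1"
  unfolding va_def using post_var_nonneg[OF data_D] post_var_le_prior[OF data_D, of z n] k_le_1 by force+

lemma va_mono: "z \<in> D \<Longrightarrow> va (Suc n) z \<le> va n z"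
  unfolding va_def data_Suc by (rule post_var_snoc_le[OF data_D x_in_D])

lemma mu_step:
  "z \<in> D \<Longrightarrow> \<bar>mu (Suc n) z - mu n z\<bar> \<le> sqrt (va n (x (Suc n))) * \<bar>y (Suc n) - mu n (x (Suc n))\<bar> / \<sigma>\<^sup>2"
  unfolding mu_def va_def data_Suc
  by (rule post_mean_step_le[OF data_D x_in_D _ data_length]) (use k_le_1 in auto)

lemma mu_Lipschitz:
  assumes "z \<in> D" "z' \<in> D"
  shows "\<bar>mu n z - mu n z'\<bar> \<le> kdist k z z' * (\<Sum>i=1..n. \<bar>y i - mu (i - 1) (x i)\<bar>) / \<sigma>\<^sup>2"
proof (induction n)
  case 0
  then show ?case by (simp add: mu_def data_upto_def)
next
  case (Suc n)
  have "\<bar>mu (Suc n) z - mu (Suc n) z'\<bar> \<le> \<bar>mu n z - mu n z'\<bar> + kdist k z z' * \<bar>y (Suc n) - mu n (x (Suc n))\<bar> / \<sigma>\<^sup>2"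
    unfolding mu_def data_Suc
    by (rule post_mean_step_Lipschitz[OF data_D x_in_D assms data_length]) (use k_le_1 x_in_D in auto)
  then show ?case using Suc by (simp add: distrib_left add_divide_distrib)
qed

text \<open>The posterior variances met along the path are paid for by information.\<close>

lemma sum_va_le: "(\<Sum>n=1..T. va (n - 1) (x n)) \<le> 2 * (1 + \<sigma>\<^sup>2) * info k \<sigma> (data_upto x T)"
proof -
  have "(\<Sum>i<length (data_upto x T). post_var k \<sigma> (take i (data_upto x T)) (data_upto x T ! i)) = (\<Sum>n=1..T. va (n - 1) (x n))"
    by (rule sum.reindex_bij_witness[where i="\<lambda>n. n - 1" and j=Suc])
      (auto simp: data_upto_def va_def take_map nth_append simp del: upt_Suc)
  then show ?thesis using info_bounds(2)[OF k_le_1 data_D[of T]] by simp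
qed

text \<open>By the confidence bounds, the loss is at most the gap plus twice the confidence width at the sampled
  point. The gap contracts by \<open>\<eta>\<close> in each step, up to the change of the acquisition function since the
  last step. That change consists of the drift of \<open>v\<close>, the growth of \<open>s\<close>, and the change of the posterior
  caused by the last observation, which is again of the order of the confidence width at the last
  sampled point. Hence the sum of the widths along the path controls everything.

  The bounds are only required from time \<open>N\<close> on, since almost surely they hold only eventually.\<close>

lemma regret_le:
  assumes N: "1 \<le> N"
    and bdd: "\<And>n. 1 \<le> n \<Longrightarrow> bdd_above (\<phi> n ` D)"
    and opt: "\<And>n. 1 \<le> n \<Longrightarrow> gap n \<le> \<eta> * ((SUP z\<in>D. \<phi> n z) - \<phi> n (x (n - 1)))"
    and drift: "\<And>n z. 2 \<le> n \<Longrightarrow> z \<in> D \<Longrightarrow> \<bar>v n z - v (n - 1) z\<bar> \<le> \<Delta> n"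
    and s0: "\<And>n. N \<le> n \<Longrightarrow> 0 \<le> s n" and smono: "\<And>n. N \<le> n \<Longrightarrow> s n \<le> s (Suc n)"
    and noise: "\<And>n. N \<le> n \<Longrightarrow> \<bar>y n - u (x n)\<bar> \<le> s n * \<sigma>"
    and conf: "\<And>n. N \<le> n \<Longrightarrow> \<bar>u (x n) - mu (n - 1) (x n)\<bar> \<le> s n * sqrt (va (n - 1) (x n))"
    and upper: "\<And>n z. N \<le> n \<Longrightarrow> z \<in> D \<Longrightarrow> u z \<le> mu (n - 1) z + s n * sqrt (va (n - 1) z) + e n"
    and T: "N \<le> T"
  shows "(\<Sum>n=N..T. loss n) \<le> (1 + 1 / (1 - \<eta>)) * gap N + (\<Sum>n=N..T. e n) +
    1 / (1 - \<eta>) * (2 * (\<Sum>n=Suc N..T. \<Delta> n) + s T) +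
    (2 + (2 * (1 + \<sigma>) / \<sigma>\<^sup>2 + 1) / (1 - \<eta>)) * (\<Sum>n=N..T. s n * sqrt (va (n - 1) (x n)))"
proof -
  define c where "c = 2 * (1 + \<sigma>) / \<sigma>\<^sup>2 + 1"
  define \<rho> where "\<rho> n = s n * sqrt (va (n - 1) (x n))" for n
  define \<delta> where "\<delta> n = 2 * \<Delta> n + (s n - s (n - 1)) + c * \<rho> (n - 1)" for n
  define A where "A n = (if N \<le> n then gap n else 0)" for n
  define \<delta>' where "\<delta>' n = (if N < n then \<delta> n else 0)" for n
  have Dne: "D \<noteq> {}" using x_in_D by blast
  have gap0: "0 \<le> gap n" if "1 \<le> n" for n
    unfolding gap_def using cSUP_upper[OF x_in_D bdd[OF that], of n] by simp
  have c0: "0 \<le> c" using noise_pos by (simp add: c_def)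
  have \<rho>0: "0 \<le> \<rho> n" if "N \<le> n" for n
    unfolding \<rho>_def using s0[OF that] va_bounds(1)[OF x_in_D] by simp
  have \<Delta>0: "0 \<le> \<Delta> n" if "2 \<le> n" for n using drift[OF that x_in_D[of 0]] by linarith
  have \<delta>0: "0 \<le> \<delta> n" if "N < n" for n
  proof -
    have "s (n - 1) \<le> s n" using smono[of "n - 1"] that by simp
    then show ?thesis using \<Delta>0[of n] \<rho>0[of "n - 1"] c0 that N by (simp add: \<delta>_def)
  qed
  have step: "gap n \<le> \<eta> * (gap (n - 1) + \<delta> n)" if n: "N < n" for n
  proof -
    define m where "m = n - 2"
    have nm: "n = Suc (Suc m)" using n N by (simp add: m_def)
    have Nm: "N \<le> Suc m" using n nm by simp
    let ?w = "x (Suc m)"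
    have sm: "0 \<le> s (Suc m)" "s (Suc m) \<le> s n" using s0[OF Nm] smono[OF Nm] nm by auto
    have sv: "sqrt (va m ?w) \<le> 1" using va_bounds(2)[OF x_in_D] by simp
    have "\<bar>y (Suc m) - mu m ?w\<bar> \<le> s (Suc m) * \<sigma> + s (Suc m) * sqrt (va m ?w)"
      using noise[OF Nm] conf[OF Nm] by simp
    also have "\<dots> \<le> s (Suc m) * (1 + \<sigma>)"
      using mult_left_mono[OF sv sm(1)] by (simp add: distrib_left)
    finally have res: "\<bar>y (Suc m) - mu m ?w\<bar> \<le> s (Suc m) * (1 + \<sigma>)" .
    have dmu: "\<bar>mu (Suc m) z - mu m z\<bar> \<le> (1 + \<sigma>) / \<sigma>\<^sup>2 * \<rho> (Suc m)" if "z \<in> D" for z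
    proof -
      have "sqrt (va m ?w) * \<bar>y (Suc m) - mu m ?w\<bar> / \<sigma>\<^sup>2 \<le> sqrt (va m ?w) * (s (Suc m) * (1 + \<sigma>)) / \<sigma>\<^sup>2"
        using res va_bounds(1)[OF x_in_D] by (intro divide_right_mono mult_left_mono) auto
      then show ?thesis using mu_step[OF that, of m] by (simp add: \<rho>_def mult_ac)
    qed
    \<comment> \<open>from above uniformly, where the decrease of the posterior variance helps\<close>
    have up: "\<phi> n z \<le> (SUP z\<in>D. \<phi> (n - 1) z) + \<Delta> n + (1 + \<sigma>) / \<sigma>\<^sup>2 * \<rho> (Suc m) + (s n - s (Suc m))" if z: "z \<in> D" for z
    proof -
      have "\<phi> (n - 1) z \<le> (SUP z\<in>D. \<phi> (n - 1) z)" using N n by (intro cSUP_upper[OF z] bdd) simp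
      moreover have "s n * sqrt (va (Suc m) z) \<le> s (Suc m) * sqrt (va m z) + (s n - s (Suc m))"
      proof -
        have "s n * sqrt (va (Suc m) z) \<le> s n * sqrt (va m z)"
          using va_mono[OF z] sm by (intro mult_left_mono) auto
        also have "\<dots> = s (Suc m) * sqrt (va m z) + (s n - s (Suc m)) * sqrt (va m z)" by (simp add: algebra_simps)
        also have "(s n - s (Suc m)) * sqrt (va m z) \<le> (s n - s (Suc m)) * 1"
          using sm va_bounds(2)[OF z] by (intro mult_left_mono) auto
        finally show ?thesis by simp
      qed
      moreover have "v n z \<le> v (n - 1) z + \<Delta> n" using drift[of n z] z n N by force
      moreover have "mu (Suc m) z \<le> mu m z + (1 + \<sigma>) / \<sigma>\<^sup>2 * \<rho> (Suc m)" using dmu[OF z] by linarith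
      ultimately show ?thesis by (simp add: \<phi>_def nm)
    qed
    \<comment> \<open>from below only at the last sampled point, where the lost exploration bonus is the width itself\<close>
    have lo: "\<phi> (n - 1) ?w \<le> \<phi> n ?w + \<Delta> n + (1 + \<sigma>) / \<sigma>\<^sup>2 * \<rho> (Suc m) + \<rho> (Suc m)"
    proof -
      have "0 \<le> s n * sqrt (va (Suc m) ?w)" using sm va_bounds(1)[OF x_in_D] by simp
      moreover have "v (n - 1) ?w \<le> v n ?w + \<Delta> n" using drift[of n ?w] x_in_D n N by force
      moreover have "mu m ?w \<le> mu (Suc m) ?w + (1 + \<sigma>) / \<sigma>\<^sup>2 * \<rho> (Suc m)" using dmu[OF x_in_D[of "Suc m"]] by linarith
      ultimately show ?thesis by (simp add: \<phi>_def nm \<rho>_def)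
    qed
    have "(SUP z\<in>D. \<phi> n z) \<le> (SUP z\<in>D. \<phi> (n - 1) z) + \<Delta> n + (1 + \<sigma>) / \<sigma>\<^sup>2 * \<rho> (Suc m) + (s n - s (Suc m))"
      by (rule cSUP_least[OF Dne up])
    then have "(SUP z\<in>D. \<phi> n z) - \<phi> n (x (n - 1)) \<le> gap (n - 1) + \<delta> n"
      using lo unfolding gap_def \<delta>_def c_def by (simp add: nm distrib_right add_divide_distrib)
    then show ?thesis using opt[of n] \<eta>(1) N n by (meson le_trans less_imp_le mult_left_mono order_trans)
  qed
  have sA: "(\<Sum>n=Suc N..T. A n) \<le> 1 / (1 - \<eta>) * (A N + (\<Sum>n=Suc N..T. \<delta>' n))"
    using step gap0 \<delta>0 N by (intro contraction_sum_le[OF \<eta>] T) (auto simp: A_def \<delta>'_def)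
  have sums: "(\<Sum>n=Suc N..T. A n) = (\<Sum>n=Suc N..T. gap n)" "(\<Sum>n=Suc N..T. \<delta>' n) = (\<Sum>n=Suc N..T. \<delta> n)"
    by (auto simp: A_def \<delta>'_def intro!: sum.cong)
  have s\<delta>: "(\<Sum>n=Suc N..T. \<delta> n) \<le> 2 * (\<Sum>n=Suc N..T. \<Delta> n) + s T + c * (\<Sum>n=N..T. \<rho> n)"
  proof -
    have "(\<Sum>n=Suc N..T. s n - s (n - 1)) = s T - s N" using T
      by (induction T rule: dec_induct) auto
    moreover have "(\<Sum>n=Suc N..T. \<rho> (n - 1)) \<le> (\<Sum>n=N..T. \<rho> n)"
    proof -
      have "(\<Sum>n=Suc N..T. \<rho> (n - 1)) = (\<Sum>n\<in>{N..<T}. \<rho> n)"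
        by (rule sum.reindex_bij_witness[where i=Suc and j="\<lambda>n. n - 1"]) auto
      also have "\<dots> \<le> (\<Sum>n=N..T. \<rho> n)" using \<rho>0 by (intro sum_mono2) auto
      finally show ?thesis .
    qed
    then have "c * (\<Sum>n=Suc N..T. \<rho> (n - 1)) \<le> c * (\<Sum>n=N..T. \<rho> n)" by (rule mult_left_mono[OF _ c0])
    ultimately show ?thesis using s0[of N]
      by (simp add: \<delta>_def sum.distrib sum_distrib_left)
  qed
  have loss: "loss n \<le> gap n + 2 * \<rho> n + e n" if n: "N \<le> n" for n
  proof -
    have "v n z + u z \<le> (SUP z\<in>D. \<phi> n z) + e n" if z: "z \<in> D" for z
    proof -
      have "\<phi> n z \<le> (SUP z\<in>D. \<phi> n z)" using n N by (intro cSUP_upper[OF z] bdd) simp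
      then show ?thesis using upper[OF n z] by (simp add: \<phi>_def)
    qed
    then have "(SUP z\<in>D. v n z + u z) \<le> (SUP z\<in>D. \<phi> n z) + e n" by (rule cSUP_least[OF Dne])
    moreover have "\<phi> n (x n) - 2 * \<rho> n \<le> v n (x n) + u (x n)" using conf[OF n] by (simp add: \<phi>_def \<rho>_def)
    ultimately show ?thesis by (simp add: loss_def gap_def)
  qed
  have "(\<Sum>n=N..T. loss n) \<le> (\<Sum>n=N..T. gap n + 2 * \<rho> n + e n)" by (intro sum_mono loss) simp
  also have "\<dots> = gap N + (\<Sum>n=Suc N..T. gap n) + 2 * (\<Sum>n=N..T. \<rho> n) + (\<Sum>n=N..T. e n)"
    using T by (simp add: sum.distrib sum_distrib_left sum.atLeast_Suc_atMost)
  also have "(\<Sum>n=Suc N..T. gap n) \<le> 1 / (1 - \<eta>) * (gap N + (2 * (\<Sum>n=Suc N..T. \<Delta> n) + s T + c * (\<Sum>n=N..T. \<rho> n)))"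
  proof -
    have "1 / (1 - \<eta>) * (gap N + (\<Sum>n=Suc N..T. \<delta> n)) \<le> 1 / (1 - \<eta>) * (gap N + (2 * (\<Sum>n=Suc N..T. \<Delta> n) + s T + c * (\<Sum>n=N..T. \<rho> n)))"
      using s\<delta> \<eta> by (intro mult_left_mono add_left_mono) auto
    then show ?thesis using sA unfolding sums by (simp add: A_def)
  qed
  finally show ?thesis
    unfolding \<rho>_def[symmetric] c_def[symmetric] by (simp add: algebra_simps)
qed

text \<open>The unknown function, the posterior mean and the posterior standard deviation are Lipschitz
  continuous, so using the bound at the net point \<open>p\<close> costs at most the mesh \<open>w\<close> times the sum of the
  three constants.\<close>

lemma upper_confidence_everywhere:
  assumes n: "1 \<le> n" and s0: "0 \<le> s n"
    and z: "z \<in> D" and p: "p \<in> D"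
    and Lu: "\<bar>u z - u p\<bar> \<le> L * norm (z - p)" and Ck: "kdist k z p \<le> C * norm (z - p)" and L0: "0 \<le> L" and C0: "0 \<le> C"
    and near: "norm (z - p) \<le> w" and R: "(\<Sum>i=1..n-1. \<bar>y i - mu (i - 1) (x i)\<bar>) \<le> R"
    and conf: "\<bar>u p - mu (n - 1) p\<bar> \<le> s n * sqrt (va (n - 1) p)"
  shows "u z \<le> mu (n - 1) z + s n * sqrt (va (n - 1) z) + w * (L + C * (R / \<sigma>\<^sup>2 + s n))"
proof -
  have kd: "kdist k z p \<le> C * w" using Ck near C0 by (meson mult_left_mono order_trans)
  have kd0: "0 \<le> kdist k z p" by (rule psd_on_kdist_nonneg[OF psd z p])
  have R0: "0 \<le> (\<Sum>i=1..n-1. \<bar>y i - mu (i - 1) (x i)\<bar>)" by (intro sum_nonneg) auto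
  have 1: "u z \<le> u p + L * w" using Lu mult_left_mono[OF near L0] by linarith
  have "\<bar>mu (n - 1) z - mu (n - 1) p\<bar> \<le> kdist k z p * (\<Sum>i=1..n-1. \<bar>y i - mu (i - 1) (x i)\<bar>) / \<sigma>\<^sup>2"
    by (rule mu_Lipschitz[OF z p])
  also have "\<dots> \<le> C * w * R / \<sigma>\<^sup>2" using kd R R0 kd0 by (intro divide_right_mono mult_mono) auto
  finally have 2: "mu (n - 1) p \<le> mu (n - 1) z + C * w * R / \<sigma>\<^sup>2" by linarith
  have "\<bar>sqrt (va (n - 1) z) - sqrt (va (n - 1) p)\<bar> \<le> kdist k z p"
    unfolding va_def by (rule post_std_diff_le[OF data_D z p])
  then have "sqrt (va (n - 1) p) \<le> sqrt (va (n - 1) z) + C * w" using kd by linarith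
  then have 3: "s n * sqrt (va (n - 1) p) \<le> s n * sqrt (va (n - 1) z) + s n * (C * w)"
    using mult_left_mono[OF _ s0] by (metis distrib_left)
  have "u z \<le> mu (n - 1) z + C * w * R / \<sigma>\<^sup>2 + (s n * sqrt (va (n - 1) z) + s n * (C * w)) + L * w"
    using 1 2 3 conf by linarith
  also have "\<dots> = mu (n - 1) z + s n * sqrt (va (n - 1) z) + w * (L + C * (R / \<sigma>\<^sup>2 + s n))"
    by (simp add: algebra_simps)
  finally show ?thesis .
qed

end

section \<open>Growth rates\<close>

lemma Cesaro_smallo:
  fixes \<Delta> :: "nat \<Rightarrow> real"
  assumes lim: "\<Delta> \<longlonglongrightarrow> 0" and nn: "\<And>n. 2 \<le> n \<Longrightarrow> 0 \<le> \<Delta> n"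
  shows "(\<lambda>T. \<Sum>n=2..T. \<Delta> n) \<in> o(\<lambda>T. real T)"
proof (rule landau_o.smallI)
  fix c :: real assume c: "0 < c"
  have "eventually (\<lambda>n. \<Delta> n < c / 2) sequentially"
    by (rule order_tendstoD[OF lim]) (use c in simp)
  then obtain N where N: "\<And>n. N \<le> n \<Longrightarrow> \<Delta> n < c / 2" unfolding eventually_sequentially by blast
  define K where "K = (\<Sum>n=2..N. \<Delta> n)"
  have K0: "0 \<le> K" unfolding K_def by (intro sum_nonneg nn) auto
  have le: "(\<Sum>n=2..T. \<Delta> n) \<le> K + c / 2 * real T" for T
  proof (induction T)
    case 0 then show ?case using K0 by simp
  next
    case (Suc T)
    show ?case
    proof (cases "Suc T \<le> N")
      case True
      have "(\<Sum>n=2..Suc T. \<Delta> n) \<le> K" unfolding K_def using True nn by (intro sum_mono2) auto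
      then show ?thesis using c by (simp add: add_increasing2)
    next
      case False
      then have "\<Delta> (Suc T) \<le> c / 2" using N[of "Suc T"] by simp
      then show ?thesis using Suc c by (cases "2 \<le> Suc T") (auto simp: algebra_simps add_divide_distrib)
    qed
  qed
  have "eventually (\<lambda>T. K + c / 2 * real T \<le> c * real T) sequentially"
    using c by real_asymp
  then show "eventually (\<lambda>T. norm (\<Sum>n=2..T. \<Delta> n) \<le> c * norm (real T)) sequentially"
  proof eventually_elim
    case (elim T)
    have "0 \<le> (\<Sum>n=2..T. \<Delta> n)" by (intro sum_nonneg nn) auto
    then show ?case using elim le[of T] by simp
  qed
qed

text \<open>The inner sums satisfy \<open>A n = \<eta> * (A (n - 1) + \<Delta> n)\<close>.\<close>

lemma tracking_term_le:
  fixes \<Delta> :: "nat \<Rightarrow> real"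
  assumes \<eta>: "0 \<le> \<eta>" "\<eta> < 1" and nn: "\<And>n. 2 \<le> n \<Longrightarrow> 0 \<le> \<Delta> n"
  shows "tracking_term \<eta> \<Delta> T \<le> 2 / (1 - \<eta>) * (\<Sum>n=2..T. \<Delta> n)"
proof (cases "1 \<le> T")
  case True
  define A where "A n = (\<Sum>z=1..n-1. \<eta> ^ z * \<Delta> (n - z + 1))" for n
  define \<delta> where "\<delta> n = (if 2 \<le> n then \<Delta> n else 0)" for n
  have A0: "0 \<le> A n" for n
    unfolding A_def using \<eta> by (intro sum_nonneg mult_nonneg_nonneg nn) auto
  have A1: "A 1 = 0" by (simp add: A_def)
  have step: "A n \<le> \<eta> * (A (n - 1) + \<delta> n)" if n: "1 < n" for n
  proof -
    obtain m where m: "n = Suc (Suc m)" using n by (metis less_imp_Suc_add add_Suc_right add_0_right One_nat_def plus_1_eq_Suc)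
    have "A n = \<eta> * \<Delta> n + (\<Sum>z=Suc 1..Suc m. \<eta> ^ z * \<Delta> (n - z + 1))"
      unfolding A_def m by (simp add: sum.atLeast_Suc_atMost)
    also have "(\<Sum>z=Suc 1..Suc m. \<eta> ^ z * \<Delta> (n - z + 1)) = (\<Sum>z=1..m. \<eta> ^ Suc z * \<Delta> (n - Suc z + 1))"
      by (rule sum.shift_bounds_cl_Suc_ivl)
    also have "\<dots> = \<eta> * A (n - 1)"
      unfolding A_def sum_distrib_left m by (intro sum.cong) (auto simp: mult_ac)
    finally show ?thesis by (simp add: \<delta>_def m distrib_left)
  qed
  have "(\<Sum>n=Suc 1..T. A n) \<le> 1 / (1 - \<eta>) * (A 1 + (\<Sum>n=Suc 1..T. \<delta> n))"
  proof (rule contraction_sum_le[OF \<eta>])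
    show "0 \<le> A n" "0 \<le> \<delta> n" for n using A0 nn by (auto simp: \<delta>_def)
    show "1 < n \<Longrightarrow> A n \<le> \<eta> * (A (n - 1) + \<delta> n)" for n by (rule step)
  qed (rule True)
  moreover have "(\<Sum>n=1..T. A n) = (\<Sum>n=Suc 1..T. A n)" using True A1 by (simp add: sum.atLeast_Suc_atMost)
  moreover have "(\<Sum>n=Suc 1..T. \<delta> n) = (\<Sum>n=2..T. \<Delta> n)"
    by (intro sum.cong) (auto simp: \<delta>_def)
  ultimately have "(\<Sum>n=1..T. A n) \<le> 1 / (1 - \<eta>) * (\<Sum>n=2..T. \<Delta> n)" using A1 by simp
  then show ?thesis unfolding tracking_term_def A_def by simp
qed (simp add: tracking_term_def)

lemma sum_bigo_sqrt:
  fixes \<Delta> :: "nat \<Rightarrow> real"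
  assumes O: "\<Delta> \<in> O(\<lambda>n. 1 / sqrt (real n))" and nn: "\<And>n. 2 \<le> n \<Longrightarrow> 0 \<le> \<Delta> n"
  shows "(\<lambda>T. \<Sum>n=2..T. \<Delta> n) \<in> O(\<lambda>T. sqrt (real T))"
proof -
  obtain c where c: "c > 0" "eventually (\<lambda>n. norm (\<Delta> n) \<le> c * norm (1 / sqrt (real n))) sequentially"
    using landau_o.bigE[OF O] by blast
  then obtain N where N: "\<And>n. N \<le> n \<Longrightarrow> \<Delta> n \<le> c * (1 / sqrt (real n))"
    unfolding eventually_sequentially by force
  define K where "K = (\<Sum>n=2..N. \<Delta> n)"
  have K0: "0 \<le> K" unfolding K_def by (intro sum_nonneg nn) auto
  have le: "(\<Sum>n=2..T. \<Delta> n) \<le> K + c * (\<Sum>n=1..T. 1 / sqrt (real n))" for T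
  proof -
    have "(\<Sum>n=2..T. \<Delta> n) \<le> (\<Sum>n\<in>{2..N} \<union> {n\<in>{1..T}. N \<le> n \<and> 2 \<le> n}. \<Delta> n)"
      using nn by (intro sum_mono2) auto
    also have "\<dots> \<le> K + (\<Sum>n\<in>{n\<in>{1..T}. N \<le> n \<and> 2 \<le> n}. \<Delta> n)"
    proof -
      let ?B = "{n\<in>{1..T}. N \<le> n \<and> 2 \<le> n}"
      have "sum \<Delta> ({2..N} \<union> ?B) + sum \<Delta> ({2..N} \<inter> ?B) = K + sum \<Delta> ?B"
        unfolding K_def by (rule sum.union_inter) auto
      moreover have "0 \<le> sum \<Delta> ({2..N} \<inter> ?B)" by (intro sum_nonneg nn) auto
      ultimately show ?thesis by linarith
    qed
    also have "(\<Sum>n\<in>{n\<in>{1..T}. N \<le> n \<and> 2 \<le> n}. \<Delta> n) \<le> (\<Sum>n\<in>{n\<in>{1..T}. N \<le> n \<and> 2 \<le> n}. c * (1 / sqrt (real n)))"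
      using N by (intro sum_mono) auto
    also have "\<dots> \<le> (\<Sum>n=1..T. c * (1 / sqrt (real n)))"
      using c by (intro sum_mono2) auto
    finally show ?thesis by (simp add: sum_distrib_left)
  qed
  have "eventually (\<lambda>T. norm (\<Sum>n=2..T. \<Delta> n) \<le> (K + 2 * c) * norm (sqrt (real T))) sequentially"
    using eventually_ge_at_top[of 1]
  proof eventually_elim
    case (elim T)
    have "0 \<le> (\<Sum>n=2..T. \<Delta> n)" by (intro sum_nonneg nn) auto
    moreover have "c * (\<Sum>n=1..T. 1 / sqrt (real n)) \<le> c * (2 * sqrt (real T))"
      using c sum_inverse_sqrt_le[of T] by (intro mult_left_mono) auto
    moreover have "K \<le> K * sqrt (real T)" using K0 elim mult_left_mono[of 1 "sqrt (real T)" K] by simp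
    ultimately show ?case using le[of T] by (simp add: distrib_right)
  qed
  then show ?thesis by (rule landau_o.bigI[rotated]) (use K0 c in simp)
qed

text \<open>The bound is used with \<open>q\<close> of the order of \<open>ln T\<close>, for which both terms are \<open>o(T / ln T)\<close>.\<close>

lemma information_term_smallo:
  fixes \<gamma> :: "nat \<Rightarrow> real"
  assumes nn: "\<And>T. 0 \<le> \<gamma> T" and c: "0 < c"
    and le: "\<And>T q. 1 \<le> q \<Longrightarrow> \<gamma> T \<le> c * (real T / (real q)\<^sup>2 + real (q + 1) ^ m)"
  shows "(\<lambda>T. sqrt (ln (real T + 2)) * sqrt (real T * \<gamma> T)) \<in> o(\<lambda>T. real T)"
proof (rule smalloI_tendsto)
  define l where "l T = ln (real T + 2)" for T
  have l0: "0 < l T" for T by (simp add: l_def)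
  have bound: "l T * \<gamma> T / real T \<le> c * (1 / l T + (l T + 2) ^ m * l T / real T)" if T: "1 \<le> T" for T
  proof -
    define q where "q = nat \<lceil>l T\<rceil>"
    have q: "1 \<le> q" "l T \<le> real q" "real q \<le> l T + 1" using l0[of T] by (auto simp: q_def) linarith+
    have "\<gamma> T \<le> c * (real T / (real q)\<^sup>2 + real (q + 1) ^ m)" by (rule le[OF q(1)])
    also have "\<dots> \<le> c * (real T / (l T)\<^sup>2 + (l T + 2) ^ m)"
      using q l0[of T] c by (intro mult_left_mono add_mono divide_left_mono power_mono mult_pos_pos) auto
    finally have "l T * \<gamma> T / real T \<le> l T * (c * (real T / (l T)\<^sup>2 + (l T + 2) ^ m)) / real T"
      using l0[of T] by (intro divide_right_mono mult_left_mono) auto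
    also have "\<dots> = c * (1 / l T + (l T + 2) ^ m * l T / real T)"
      using T l0[of T] by (simp add: field_simps power2_eq_square)
    finally show ?thesis .
  qed
  have "(\<lambda>T. c * (1 / l T + (l T + 2) ^ m * l T / real T)) \<longlonglongrightarrow> c * (0 + 0)"
  proof (intro tendsto_intros)
    show "(\<lambda>T. 1 / l T) \<longlonglongrightarrow> 0" unfolding l_def by real_asymp
    have "filterlim (\<lambda>T::nat. ln (real T + 2)) at_top sequentially" by real_asymp
    have pe: "(\<lambda>T. (l T + 2) ^ Suc m / exp (l T + 2)) \<longlonglongrightarrow> 0"
    proof (rule filterlim_compose[OF tendsto_power_div_exp_0])
      show "filterlim (\<lambda>T. l T + 2) at_top sequentially" unfolding l_def by real_asymp
    qed
    have "(\<lambda>T. exp 2 * ((real T + 2) / real T)) \<longlonglongrightarrow> exp 2 * 1"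
      by (intro tendsto_intros) real_asymp
    from tendsto_mult[OF pe this]
    have lim: "(\<lambda>T. (l T + 2) ^ Suc m / exp (l T + 2) * (exp 2 * ((real T + 2) / real T))) \<longlonglongrightarrow> 0" by simp
    have ev: "(l T + 2) ^ m * l T / real T \<le> (l T + 2) ^ Suc m / exp (l T + 2) * (exp 2 * ((real T + 2) / real T))"
      if "1 \<le> T" for T
    proof -
      have "(l T + 2) ^ m * l T \<le> (l T + 2) ^ Suc m" using l0[of T] by (simp add: mult.commute mult_left_mono)
      then have "(l T + 2) ^ m * l T / real T \<le> (l T + 2) ^ Suc m / real T" by (rule divide_right_mono) simp
      also have "\<dots> = (l T + 2) ^ Suc m / exp (l T + 2) * (exp 2 * ((real T + 2) / real T))"
        by (simp add: exp_add l_def del: power_Suc)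
      finally show ?thesis .
    qed
    show "(\<lambda>T. (l T + 2) ^ m * l T / real T) \<longlonglongrightarrow> 0"
    proof (rule tendsto_sandwich[OF _ _ tendsto_const lim])
      show "\<forall>\<^sub>F T in sequentially. 0 \<le> (l T + 2) ^ m * l T / real T"
        using l0 by (intro always_eventually allI divide_nonneg_nonneg mult_nonneg_nonneg zero_le_power) (auto intro: less_imp_le add_nonneg_nonneg simp: l_def)
      show "\<forall>\<^sub>F T in sequentially. (l T + 2) ^ m * l T / real T \<le> (l T + 2) ^ Suc m / exp (l T + 2) * (exp 2 * ((real T + 2) / real T))"
        using eventually_ge_at_top[of 1] by eventually_elim (rule ev)
    qed
  qed
  then have lim: "(\<lambda>T. c * (1 / l T + (l T + 2) ^ m * l T / real T)) \<longlonglongrightarrow> 0" by simp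
  have "(\<lambda>T. l T * \<gamma> T / real T) \<longlonglongrightarrow> 0"
  proof (rule tendsto_sandwich[OF _ _ tendsto_const lim])
    show "\<forall>\<^sub>F T in sequentially. 0 \<le> l T * \<gamma> T / real T"
      using nn l0 by (intro always_eventually allI divide_nonneg_nonneg mult_nonneg_nonneg) (auto intro: less_imp_le)
    show "\<forall>\<^sub>F T in sequentially. l T * \<gamma> T / real T \<le> c * (1 / l T + (l T + 2) ^ m * l T / real T)"
      using eventually_ge_at_top[of 1] by eventually_elim (rule bound)
  qed
  from tendsto_real_sqrt[OF this] have "(\<lambda>T. sqrt (l T * \<gamma> T / real T)) \<longlonglongrightarrow> 0" by simp
  moreover have "\<forall>\<^sub>F T in sequentially. sqrt (l T * \<gamma> T / real T) = sqrt (ln (real T + 2)) * sqrt (real T * \<gamma> T) / real T"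
    using eventually_ge_at_top[of 1]
  proof eventually_elim
    case (elim T)
    have "sqrt (l T * \<gamma> T / real T) = sqrt (l T * (real T * \<gamma> T) / (real T)\<^sup>2)"
      using elim by (simp add: power2_eq_square)
    also have "\<dots> = sqrt (ln (real T + 2)) * sqrt (real T * \<gamma> T) / real T"
      by (simp add: real_sqrt_divide real_sqrt_mult l_def)
    finally show ?case .
  qed
  ultimately show "(\<lambda>T. sqrt (ln (real T + 2)) * sqrt (real T * \<gamma> T) / real T) \<longlonglongrightarrow> 0"
    by (rule Lim_transform_eventually)
  show "\<forall>\<^sub>F T in sequentially. real T \<noteq> 0" using eventually_gt_at_top[of 0] by eventually_elim simp
qed

text \<open>The events that the constant \<open>m\<close> suffices increase with \<open>m\<close> to an almost sure event, so by continuity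
  of the measure one of them has the required probability.\<close>

lemma AE_random_constant:
  fixes R :: "nat \<Rightarrow> 'w \<Rightarrow> real"
  assumes M: "prob_space M" and R[measurable]: "\<And>T. R T \<in> borel_measurable M" and b: "\<And>T. 0 \<le> b T"
    and AE: "AE \<omega> in M. \<exists>C. \<forall>T\<ge>1. R T \<omega> \<le> C * b T" and \<delta>: "0 < \<delta>"
  shows "\<exists>C. measure M {\<omega> \<in> space M. \<forall>T\<ge>1. R T \<omega> \<le> C * b T} \<ge> 1 - \<delta>"
proof -
  interpret prob_space M by fact
  define A where "A m = {\<omega> \<in> space M. \<forall>T\<ge>1. R T \<omega> \<le> real m * b T}" for m :: nat
  have A[measurable]: "A m \<in> events" for m unfolding A_def by measurable
  have inc: "incseq A"
  proof (rule incseq_SucI, rule subsetI)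
    fix m \<omega> assume "\<omega> \<in> A m"
    moreover have "real m * b T \<le> real (Suc m) * b T" for T using b by (intro mult_right_mono) auto
    ultimately show "\<omega> \<in> A (Suc m)" unfolding A_def by (auto intro: order_trans)
  qed
  have "AE \<omega> in M. \<omega> \<in> (\<Union>m. A m)"
    using AE AE_space
  proof eventually_elim
    case (elim \<omega>)
    then obtain C where C: "\<And>T. 1 \<le> T \<Longrightarrow> R T \<omega> \<le> C * b T" by blast
    obtain m :: nat where m: "C \<le> real m" using real_arch_simple by blast
    have "R T \<omega> \<le> real m * b T" if "1 \<le> T" for T
      using C[OF that] mult_right_mono[OF m b[of T]] by linarith
    then show ?case using elim by (auto simp: A_def)
  qed
  then have "prob (\<Union>m. A m) = 1" by (intro prob_eq_1[THEN iffD2]) auto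
  moreover have "(\<lambda>m. prob (A m)) \<longlonglongrightarrow> prob (\<Union>m. A m)"
    by (rule finite_Lim_measure_incseq) (use inc in auto)
  ultimately have "\<forall>\<^sub>F m in sequentially. 1 - \<delta> < prob (A m)"
    using \<delta> by (intro order_tendstoD) auto
  then obtain m where "1 - \<delta> < prob (A m)" by (auto simp: eventually_sequentially)
  then show ?thesis unfolding A_def by (intro exI[of _ "real m"]) simp
qed

lemma SUP_dense:
  fixes f :: "'a::metric_space \<Rightarrow> real"
  assumes C: "C \<subseteq> D" "D \<subseteq> closure C" "C \<noteq> {}" and D: "compact D" and f: "continuous_on D f"
  shows "(SUP x\<in>D. f x) = (SUP x\<in>C. f x)" and "bdd_above (f ` C)"
proof -
  have cl: "closure C = D" using C D compact_imp_closed[OF D] by (metis closure_minimal subset_antisym)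
  have bd: "bdd_above (f ` D)" by (rule bounded_imp_bdd_above[OF compact_imp_bounded[OF compact_continuous_image[OF f D]]])
  show bc: "bdd_above (f ` C)" using bd C(1) by (meson bdd_above_mono image_mono)
  show "(SUP x\<in>D. f x) = (SUP x\<in>C. f x)"
  proof (rule antisym)
    show "(SUP x\<in>D. f x) \<le> (SUP x\<in>C. f x)"
    proof (rule cSUP_least)
      fix x assume "x \<in> D"
      show "f x \<le> (SUP x\<in>C. f x)"
        by (rule continuous_le_on_closure[of C f x]) (use \<open>x \<in> D\<close> cl f bc in \<open>auto intro: cSUP_upper\<close>)
    qed (use C in auto)
    show "(SUP x\<in>C. f x) \<le> (SUP x\<in>D. f x)" by (rule cSUP_subset_mono) (use C bd in auto)
  qed
qed

lemma SUP_measurable: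
  fixes f :: "'w \<Rightarrow> 'a::euclidean_space \<Rightarrow> real"
  assumes D: "compact D" "D \<noteq> {}" and f: "\<And>\<omega>. \<omega> \<in> space M \<Longrightarrow> continuous_on D (f \<omega>)"
    and m: "\<And>x. x \<in> D \<Longrightarrow> (\<lambda>\<omega>. f \<omega> x) \<in> borel_measurable M"
  shows "(\<lambda>\<omega>. SUP x\<in>D. f \<omega> x) \<in> borel_measurable M"
proof -
  obtain C where C: "countable C" "C \<subseteq> D" "D \<subseteq> closure C" using separable[of D] by metis
  have C0: "C \<noteq> {}" using C D by auto
  have "(\<lambda>\<omega>. SUP x\<in>C. f \<omega> x) \<in> borel_measurable M"
    by (rule borel_measurable_cSUP[OF C(1)]) (use m C SUP_dense(2)[OF C(2,3) C0 D(1) f] in auto)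
  then show ?thesis
    by (subst measurable_cong[where g="\<lambda>\<omega>. SUP x\<in>C. f \<omega> x"]) (use SUP_dense(1)[OF C(2,3) C0 D(1) f] in auto)
qed

context ucb_path
begin

text \<open>The sum of the confidence widths \<open>s n * sqrt (va (n - 1) (x n))\<close> is of order
  \<open>sqrt (ln T) * sqrt (T * \<gamma> T)\<close> by Cauchy-Schwarz. The confidence bounds are assumed on nets of mesh
  \<open>w / n\<^sup>2\<close>. The Lipschitz constant of the posterior mean is at most the sum of the past residuals,
  which is \<open>O(n * sqrt n)\<close>, so between net points the bounds lose \<open>e n = O(1 / sqrt n)\<close>, which sums to
  \<open>O(sqrt T)\<close>.\<close>

lemma cumulative_loss_le:
  assumes N: "1 \<le> N"
    and bdd: "\<And>n. 1 \<le> n \<Longrightarrow> bdd_above (\<phi> n ` D)"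
    and opt: "\<And>n. 1 \<le> n \<Longrightarrow> gap n \<le> \<eta> * ((SUP z\<in>D. \<phi> n z) - \<phi> n (x (n - 1)))"
    and drift: "\<And>n z. 2 \<le> n \<Longrightarrow> z \<in> D \<Longrightarrow> \<bar>v n z - v (n - 1) z\<bar> \<le> \<Delta> n"
    and s0: "\<And>n. N \<le> n \<Longrightarrow> 0 \<le> s n" and smono: "\<And>n. N \<le> n \<Longrightarrow> s n \<le> s (Suc n)"
    and sgrow: "\<And>n. 1 \<le> n \<Longrightarrow> s n \<le> K * sqrt (ln (real n + 2))" and K: "0 \<le> K"
    and noise: "\<And>n. N \<le> n \<Longrightarrow> \<bar>y n - u (x n)\<bar> \<le> s n * \<sigma>"
    and conf: "\<And>n. N \<le> n \<Longrightarrow> \<bar>u (x n) - mu (n - 1) (x n)\<bar> \<le> s n * sqrt (va (n - 1) (x n))"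
    and confP: "\<And>n p. N \<le> n \<Longrightarrow> p \<in> P n \<Longrightarrow> \<bar>u p - mu (n - 1) p\<bar> \<le> s n * sqrt (va (n - 1) p)"
    and net: "\<And>n z. 1 \<le> n \<Longrightarrow> z \<in> D \<Longrightarrow> \<exists>p\<in>P n. norm (z - p) \<le> w / (real n)\<^sup>2"
    and PD: "\<And>n. 1 \<le> n \<Longrightarrow> P n \<subseteq> D" and w: "0 \<le> w"
    and Lu: "\<And>z z'. z \<in> D \<Longrightarrow> z' \<in> D \<Longrightarrow> \<bar>u z - u z'\<bar> \<le> L * norm (z - z')" and L: "0 \<le> L"
    and Ck: "\<And>z z'. z \<in> D \<Longrightarrow> z' \<in> D \<Longrightarrow> kdist k z z' \<le> C * norm (z - z')" and C: "0 \<le> C"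
    and \<gamma>: "\<And>T. info k \<sigma> (data_upto x T) \<le> \<gamma> T"
  shows "\<exists>B. \<forall>T\<ge>1. (\<Sum>n=1..T. loss n) \<le>
    B * (sqrt (ln (real T + 2)) * sqrt (real T * \<gamma> T) + sqrt (real T) + (\<Sum>n=2..T. \<Delta> n))"
proof -
  have sm: "s i \<le> s n" if "N \<le> i" "i \<le> n" for i n
    using that(2,1) by (induction n rule: dec_induct) (auto intro: order_trans[OF _ smono])
  have s_sqrt: "s n \<le> 2 * K * sqrt (real n)" if n: "1 \<le> n" for n
  proof -
    have "ln (real n + 2) \<le> real n + 1" using ln_le_minus_one[of "real n + 2"] by simp
    then have "ln (real n + 2) \<le> 4 * real n" using n by linarith
    then have "sqrt (ln (real n + 2)) \<le> sqrt (4 * real n)" by (rule real_sqrt_le_mono)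
    then have "sqrt (ln (real n + 2)) \<le> 2 * sqrt (real n)" by (simp add: real_sqrt_mult)
    then have "K * sqrt (ln (real n + 2)) \<le> K * (2 * sqrt (real n))" by (rule mult_left_mono[OF _ K])
    then show ?thesis using sgrow[OF n] by simp
  qed
  define R0 where "R0 = (\<Sum>i=1..N-1. \<bar>y i - mu (i - 1) (x i)\<bar>)"
  have R00: "0 \<le> R0" unfolding R0_def by (intro sum_nonneg) auto
  have res: "(\<Sum>i=1..n-1. \<bar>y i - mu (i - 1) (x i)\<bar>) \<le> R0 + real n * (s n * (1 + \<sigma>))" if n: "N \<le> n" for n
  proof -
    have each: "\<bar>y i - mu (i - 1) (x i)\<bar> \<le> s n * (1 + \<sigma>)" if i: "N \<le> i" "i \<le> n" for i
    proof -
      have "s i * sqrt (va (i - 1) (x i)) \<le> s i * 1"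
        using s0[OF i(1)] va_bounds(2)[OF x_in_D] by (intro mult_left_mono) auto
      then have "\<bar>y i - mu (i - 1) (x i)\<bar> \<le> s i * (1 + \<sigma>)"
        using noise[OF i(1)] conf[OF i(1)] by (simp add: distrib_left)
      also have "\<dots> \<le> s n * (1 + \<sigma>)" using sm[OF i] noise_pos by (intro mult_right_mono) auto
      finally show ?thesis .
    qed
    have "{1..n-1} = {1..N-1} \<union> {N..n-1}" using N n by auto
    then have "(\<Sum>i=1..n-1. \<bar>y i - mu (i - 1) (x i)\<bar>) = R0 + (\<Sum>i=N..n-1. \<bar>y i - mu (i - 1) (x i)\<bar>)"
      unfolding R0_def using N by (subst sum.union_disjoint[symmetric]) auto
    also have "(\<Sum>i=N..n-1. \<bar>y i - mu (i - 1) (x i)\<bar>) \<le> (\<Sum>i=N..n-1. s n * (1 + \<sigma>))"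
      using each by (intro sum_mono) auto
    also have "\<dots> = real (card {N..n-1}) * (s n * (1 + \<sigma>))" by simp
    also have "\<dots> \<le> real n * (s n * (1 + \<sigma>))"
      using s0[OF n] noise_pos N by (intro mult_right_mono) auto
    finally show ?thesis by simp
  qed
  define e where "e n = w / (real n)\<^sup>2 * (L + C * ((R0 + real n * (s n * (1 + \<sigma>))) / \<sigma>\<^sup>2 + s n))" for n
  define E where "E = w * (L + C * ((R0 + 2 * K * (1 + \<sigma>)) / \<sigma>\<^sup>2 + 2 * K))"
  have E0: "0 \<le> E" unfolding E_def using w L C R00 K noise_pos by simp
  have upper: "u z \<le> mu (n - 1) z + s n * sqrt (va (n - 1) z) + e n" if n: "N \<le> n" and z: "z \<in> D" for n z
  proof -
    have n1: "1 \<le> n" using n N by simp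
    obtain p where p: "p \<in> P n" "norm (z - p) \<le> w / (real n)\<^sup>2" using net[OF n1 z] by blast
    have pD: "p \<in> D" using p PD[OF n1] by auto
    show ?thesis unfolding e_def
      by (rule upper_confidence_everywhere[OF n1 s0[OF n] z pD Lu[OF z pD] Ck[OF z pD] L C p(2) res[OF n] confP[OF n p(1)]])
  qed
  have e_le: "e n \<le> E * (1 / sqrt (real n))" if n: "N \<le> n" for n
  proof -
    define q where "q = sqrt (real n)"
    have n1: "1 \<le> n" using n N by simp
    have q: "1 \<le> q" "real n = q\<^sup>2" using n1 by (auto simp: q_def)
    have q3: "1 \<le> q ^ 3" "q \<le> q ^ 3" using q power_increasing[of 1 3 q] by (auto simp: one_le_power)
    have sq: "s n \<le> 2 * K * q" using s_sqrt[OF n1] by (simp add: q_def)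
    have a: "real n * (s n * (1 + \<sigma>)) \<le> q ^ 3 * (2 * K * (1 + \<sigma>))"
    proof -
      have "s n * (1 + \<sigma>) \<le> 2 * K * q * (1 + \<sigma>)" using sq noise_pos by (intro mult_right_mono) auto
      then have "real n * (s n * (1 + \<sigma>)) \<le> q\<^sup>2 * (2 * K * q * (1 + \<sigma>))" unfolding q(2) by (rule mult_left_mono) simp
      then show ?thesis by (simp add: power2_eq_square power3_eq_cube mult_ac)
    qed
    have b: "R0 \<le> q ^ 3 * R0" using R00 q3 mult_right_mono[of 1 "q ^ 3" R0] by simp
    have c: "L \<le> q ^ 3 * L" using L q3 mult_right_mono[of 1 "q ^ 3" L] by simp
    have d: "s n \<le> q ^ 3 * (2 * K)" using sq mult_left_mono[OF q3(2), of "2 * K"] K by (simp add: mult_ac)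
    have "(R0 + real n * (s n * (1 + \<sigma>))) / \<sigma>\<^sup>2 \<le> (q ^ 3 * (R0 + 2 * K * (1 + \<sigma>))) / \<sigma>\<^sup>2"
      using a b by (intro divide_right_mono) (auto simp: distrib_left)
    then have "(R0 + real n * (s n * (1 + \<sigma>))) / \<sigma>\<^sup>2 + s n \<le> q ^ 3 * ((R0 + 2 * K * (1 + \<sigma>)) / \<sigma>\<^sup>2 + 2 * K)"
      using d by (simp add: distrib_left)
    then have "C * ((R0 + real n * (s n * (1 + \<sigma>))) / \<sigma>\<^sup>2 + s n) \<le> C * (q ^ 3 * ((R0 + 2 * K * (1 + \<sigma>)) / \<sigma>\<^sup>2 + 2 * K))"
      by (rule mult_left_mono[OF _ C])
    then have "L + C * ((R0 + real n * (s n * (1 + \<sigma>))) / \<sigma>\<^sup>2 + s n) \<le> q ^ 3 * (L + C * ((R0 + 2 * K * (1 + \<sigma>)) / \<sigma>\<^sup>2 + 2 * K))"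
      using c by (simp add: distrib_left mult.left_commute)
    then have "e n \<le> w / (real n)\<^sup>2 * (q ^ 3 * (L + C * ((R0 + 2 * K * (1 + \<sigma>)) / \<sigma>\<^sup>2 + 2 * K)))"
      unfolding e_def using w by (intro mult_left_mono) auto
    also have "\<dots> = E * (q ^ 3 / (q\<^sup>2)\<^sup>2)" unfolding E_def q(2) by simp
    also have "q ^ 3 / (q\<^sup>2)\<^sup>2 = 1 / q" using q(1) by (simp add: power2_eq_square power3_eq_cube field_simps)
    finally show ?thesis by (simp add: q_def)
  qed
  have \<Delta>0: "0 \<le> \<Delta> n" if "2 \<le> n" for n using drift[OF that x_in_D[of 0]] by linarith
  have gN: "0 \<le> gap N" unfolding gap_def using cSUP_upper[OF x_in_D bdd[OF N], of N] by simp
  have \<gamma>0: "0 \<le> \<gamma> T" for T using info_bounds(3)[OF k_le_1 data_D[of T]] \<gamma>[of T] by linarith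
  define h where "h = 1 / (1 - \<eta>)"
  have h: "0 \<le> h" using \<eta> by (simp add: h_def)
  define c where "c = 2 + (2 * (1 + \<sigma>) / \<sigma>\<^sup>2 + 1) * h"
  have c: "0 \<le> c" using h noise_pos by (simp add: c_def)
  define g where "g = sqrt (2 * (1 + \<sigma>\<^sup>2))"
  define F where "F T = sqrt (ln (real T + 2)) * sqrt (real T * \<gamma> T)" for T
  define b where "b T = F T + sqrt (real T) + (\<Sum>n=2..T. \<Delta> n)" for T
  have F0: "0 \<le> F T" for T using \<gamma>0 by (simp add: F_def)
  have S0: "0 \<le> (\<Sum>n=2..T. \<Delta> n)" for T by (intro sum_nonneg \<Delta>0) auto
  have b1: "1 \<le> b T" if "1 \<le> T" for T
  proof -
    have "1 \<le> sqrt (real T)" using that by simp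
    then show ?thesis using F0[of T] S0[of T] unfolding b_def by linarith
  qed
  define Q where "Q = \<bar>\<Sum>n=1..N-1. loss n\<bar>"
  define B1 where "B1 = Q + (1 + h) * gap N + 2 * E + 2 * h + 2 * K * h + c * (K * g)"
  have late: "(\<Sum>n=1..T. loss n) \<le> B1 * b T" if T: "N \<le> T" for T
  proof -
    have T1: "1 \<le> T" using T N by simp
    define q where "q = sqrt (real T)"
    have q: "1 \<le> q" using T1 by (simp add: q_def)
    have "{1..T} = {1..N-1} \<union> {N..T}" using N T by auto
    then have "(\<Sum>n=1..T. loss n) = (\<Sum>n=1..N-1. loss n) + (\<Sum>n=N..T. loss n)"
      using N by (subst sum.union_disjoint[symmetric]) auto
    also have "\<dots> \<le> Q + ((1 + h) * gap N + (\<Sum>n=N..T. e n) + h * (2 * (\<Sum>n=Suc N..T. \<Delta> n) + s T) +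
        c * (\<Sum>n=N..T. s n * sqrt (va (n - 1) (x n))))"
    proof (rule add_mono)
      show "(\<Sum>n=1..N-1. loss n) \<le> Q" by (simp add: Q_def)
      show "(\<Sum>n=N..T. loss n) \<le> (1 + h) * gap N + (\<Sum>n=N..T. e n) + h * (2 * (\<Sum>n=Suc N..T. \<Delta> n) + s T) +
        c * (\<Sum>n=N..T. s n * sqrt (va (n - 1) (x n)))"
        using regret_le[OF N bdd opt drift s0 smono noise conf upper T] by (simp add: h_def c_def)
    qed
    also have "(\<Sum>n=N..T. e n) \<le> E * (2 * q)"
    proof -
      have "(\<Sum>n=N..T. e n) \<le> (\<Sum>n=N..T. E * (1 / sqrt (real n)))" using e_le by (intro sum_mono) auto
      also have "\<dots> \<le> (\<Sum>n=1..T. E * (1 / sqrt (real n)))" using N E0 by (intro sum_mono2) auto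
      also have "\<dots> \<le> E * (2 * q)"
        using mult_left_mono[OF sum_inverse_sqrt_le[of T] E0] by (simp add: sum_distrib_left q_def)
      finally show ?thesis .
    qed
    also have "h * (2 * (\<Sum>n=Suc N..T. \<Delta> n) + s T) \<le> h * (2 * (\<Sum>n=2..T. \<Delta> n) + 2 * K * q)"
    proof (rule mult_left_mono[OF _ h])
      have "(\<Sum>n=Suc N..T. \<Delta> n) \<le> (\<Sum>n=2..T. \<Delta> n)" using N \<Delta>0 by (intro sum_mono2) auto
      then show "2 * (\<Sum>n=Suc N..T. \<Delta> n) + s T \<le> 2 * (\<Sum>n=2..T. \<Delta> n) + 2 * K * q"
        using s_sqrt[OF T1] by (simp add: q_def)
    qed
    also have "c * (\<Sum>n=N..T. s n * sqrt (va (n - 1) (x n))) \<le> c * (K * g * F T)"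
    proof (rule mult_left_mono[OF _ c])
      have "(\<Sum>n=N..T. s n * sqrt (va (n - 1) (x n))) \<le> (\<Sum>n=N..T. s T * sqrt (va (n - 1) (x n)))"
        using sm va_bounds(1)[OF x_in_D] by (intro sum_mono mult_right_mono) auto
      also have "\<dots> = s T * (\<Sum>n=N..T. sqrt (va (n - 1) (x n)))" by (simp add: sum_distrib_left)
      also have "\<dots> \<le> s T * sqrt (real T * (2 * (1 + \<sigma>\<^sup>2) * \<gamma> T))"
      proof (rule mult_left_mono[OF _ s0[OF T]])
        have "(\<Sum>n=N..T. sqrt (va (n - 1) (x n))) \<le> sqrt (real T * (\<Sum>n=N..T. va (n - 1) (x n)))"
          using N va_bounds(1)[OF x_in_D] by (intro sum_mult_sqrt_le) auto
        also have "\<dots> \<le> sqrt (real T * (2 * (1 + \<sigma>\<^sup>2) * \<gamma> T))"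
        proof (intro real_sqrt_le_mono mult_left_mono)
          have "(\<Sum>n=N..T. va (n - 1) (x n)) \<le> (\<Sum>n=1..T. va (n - 1) (x n))"
            using N va_bounds(1)[OF x_in_D] by (intro sum_mono2) auto
          also have "\<dots> \<le> 2 * (1 + \<sigma>\<^sup>2) * info k \<sigma> (data_upto x T)" by (rule sum_va_le)
          also have "\<dots> \<le> 2 * (1 + \<sigma>\<^sup>2) * \<gamma> T" by (intro mult_left_mono \<gamma>) auto
          finally show "(\<Sum>n=N..T. va (n - 1) (x n)) \<le> 2 * (1 + \<sigma>\<^sup>2) * \<gamma> T" .
        qed simp
        finally show "(\<Sum>n=N..T. sqrt (va (n - 1) (x n))) \<le> sqrt (real T * (2 * (1 + \<sigma>\<^sup>2) * \<gamma> T))" .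
      qed
      also have "sqrt (real T * (2 * (1 + \<sigma>\<^sup>2) * \<gamma> T)) = g * sqrt (real T * \<gamma> T)"
        unfolding g_def real_sqrt_mult[symmetric] by (simp add: mult_ac)
      also have "s T * (g * sqrt (real T * \<gamma> T)) \<le> K * sqrt (ln (real T + 2)) * (g * sqrt (real T * \<gamma> T))"
        using \<gamma>0[of T] by (intro mult_right_mono sgrow[OF T1]) (simp add: g_def)
      finally show "(\<Sum>n=N..T. s n * sqrt (va (n - 1) (x n))) \<le> K * g * F T" by (simp add: F_def mult_ac)
    qed
    finally have "(\<Sum>n=1..T. loss n) \<le> Q + ((1 + h) * gap N + E * (2 * q) + h * (2 * (\<Sum>n=2..T. \<Delta> n) + 2 * K * q) + c * (K * g * F T))"
      by simp
    also have "\<dots> \<le> B1 * b T"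
    proof -
      have bq: "q \<le> b T" "1 \<le> b T" "(\<Sum>n=2..T. \<Delta> n) \<le> b T" "F T \<le> b T"
        using b1[OF T1] F0[of T] S0[of T] by (auto simp: b_def q_def)
      have "Q * 1 \<le> Q * b T" using bq by (intro mult_left_mono) (auto simp: Q_def)
      moreover have "(1 + h) * gap N * 1 \<le> (1 + h) * gap N * b T" using bq h gN by (intro mult_left_mono) auto
      moreover have "2 * E * q \<le> 2 * E * b T" using bq E0 by (intro mult_left_mono) auto
      moreover have "2 * h * (\<Sum>n=2..T. \<Delta> n) \<le> 2 * h * b T" using bq h by (intro mult_left_mono) auto
      moreover have "2 * K * h * q \<le> 2 * K * h * b T" using bq h K by (intro mult_left_mono) auto
      moreover have "c * (K * g) * F T \<le> c * (K * g) * b T" using bq c K by (intro mult_left_mono) (auto simp: g_def)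
      ultimately show ?thesis by (simp add: B1_def algebra_simps)
    qed
    finally show ?thesis .
  qed
  define B2 where "B2 = (\<Sum>T=1..N. \<bar>\<Sum>n=1..T. loss n\<bar>)"
  have B20: "0 \<le> B2" unfolding B2_def by (intro sum_nonneg) auto
  have B10: "0 \<le> B1" using h gN E0 K c unfolding B1_def Q_def g_def by simp
  show ?thesis
  proof (intro exI[of _ "B1 + B2"] allI impI)
    fix T assume T: "1 \<le> (T::nat)"
    show "(\<Sum>n=1..T. loss n) \<le> (B1 + B2) *
        (sqrt (ln (real T + 2)) * sqrt (real T * \<gamma> T) + sqrt (real T) + (\<Sum>n=2..T. \<Delta> n))"
    proof (cases "N \<le> T")
      case True
      have "B1 * b T \<le> (B1 + B2) * b T" using B20 b1[OF T] by (intro mult_right_mono) auto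
      then show ?thesis using late[OF True] unfolding b_def F_def by linarith
    next
      case False
      have "(\<Sum>n=1..T. loss n) \<le> \<bar>\<Sum>n=1..T. loss n\<bar>" by simp
      also have "\<dots> \<le> B2" unfolding B2_def using T False by (intro member_le_sum) auto
      also have "\<dots> * 1 \<le> (B1 + B2) * b T" using B10 B20 b1[OF T] by (intro mult_mono) auto
      finally show ?thesis unfolding b_def F_def by simp
    qed
  qed
qed

end

text \<open>The conditions \<open>1 / 4 < d * a\<close> and \<open>\<delta> < 1\<close> make the argument of the inner
  logarithm of \<open>beta\<close> larger than one. The
  constant term may have either sign.\<close>

lemma beta_eq:
  fixes a b r \<delta> :: real
  assumes "0 < d" "0 < b" "0 < r" "0 < \<delta>" "1 / 4 < real d * a" "\<delta> < 1" and n: "1 \<le> n"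
  shows "beta d a b r \<delta> n = beta d a b r \<delta> 1 + (4 + 4 * real d) * ln (real n)"
proof -
  define \<kappa> where "\<kappa> = 2 * pi\<^sup>2 / (3 * \<delta>)"
  define l where "l = real d * b * r * sqrt (ln (4 * real d * a / \<delta>))"
  have "1 < 4 * real d * a / \<delta>" using assms by (simp add: field_simps)
  then have "0 < sqrt (ln (4 * real d * a / \<delta>))" by (simp add: ln_gt_zero)
  then have l: "0 < l" unfolding l_def using assms by (intro mult_pos_pos) auto
  have \<kappa>: "0 < \<kappa>" using assms by (simp add: \<kappa>_def)
  have "beta d a b r \<delta> m = 2 * (2 * ln (real m) + ln \<kappa>) + 2 * real d * (2 * ln (real m) + ln l)" if "1 \<le> m" for m
  proof -
    have e1: "2 * (real m)\<^sup>2 * pi\<^sup>2 / (3 * \<delta>) = (real m)\<^sup>2 * \<kappa>" by (simp add: \<kappa>_def)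
    have e2: "real d * (real m)\<^sup>2 * b * r * sqrt (ln (4 * real d * a / \<delta>)) = (real m)\<^sup>2 * l" by (simp add: l_def)
    have e3: "ln ((real m)\<^sup>2 * \<kappa>) = 2 * ln (real m) + ln \<kappa>" "ln ((real m)\<^sup>2 * l) = 2 * ln (real m) + ln l"
      using that \<kappa> l by (auto simp: ln_mult ln_realpow)
    show ?thesis unfolding beta_def e1 e2 e3 ..
  qed
  from this[OF n] this[of 1] show ?thesis by (simp add: algebra_simps)
qed

section \<open>The regret bound\<close>

theorem theorem3:
  fixes M :: "'w measure"
    and D :: "(real ^ 'd) set"
    and V :: "real ^ 'd \<Rightarrow> real \<Rightarrow> real" and gradV :: "real \<Rightarrow> real ^ 'd \<Rightarrow> real ^ 'd"
    and U :: "'w \<Rightarrow> real ^ 'd \<Rightarrow> real" and gradU :: "'w \<Rightarrow> real ^ 'd \<Rightarrow> real ^ 'd"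
    and k :: "real ^ 'd \<Rightarrow> real ^ 'd \<Rightarrow> real"
    and \<epsilon> :: "nat \<Rightarrow> 'w \<Rightarrow> real"
    and t :: "nat \<Rightarrow> real"
    and \<A> :: "(real ^ 'd \<Rightarrow> real) \<Rightarrow> real ^ 'd \<Rightarrow> nat \<Rightarrow> real ^ 'd"
    and x0 :: "real ^ 'd" and X :: "nat \<Rightarrow> 'w \<Rightarrow> real ^ 'd"
    and \<nu> :: "(real ^ 'd) measure" and e :: "nat \<Rightarrow> real ^ 'd \<Rightarrow> real" and l :: "nat \<Rightarrow> real"
    and \<beta> \<Delta>s :: "nat \<Rightarrow> real"
    and L r a b h \<sigma> \<eta> \<delta> \<Delta> :: real
  assumes beta: "\<forall>n. \<beta> n = beta CARD('d) a b r \<delta> n"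
    and variation: "\<forall>n. \<Delta>s n = variation D V t n"
    and prob: "prob_space M"
    and sampling: "0 < h" "\<forall>n\<ge>1. t (Suc n) = t n + h"
    and gp: "gaussian_process M D (\<lambda>_. 0) k U"
    and k_le_1: "\<forall>x\<in>D. k x x \<le> 1"
    and noise: "0 < \<sigma>" "\<forall>i\<ge>1. normal_rv M 0 (\<sigma>\<^sup>2) (\<epsilon> i)"
      "prob_space.indep_vars M (\<lambda>_. borel) \<epsilon> {1..}"
    and noise_indep_U: "prob_space.indep_set M
      (sets (vimage_algebra (space M) (\<lambda>\<omega>. \<lambda>x\<in>D. U \<omega> x) (\<Pi>\<^sub>M x\<in>D. borel)))
      (sets (vimage_algebra (space M) (\<lambda>\<omega>. \<lambda>i\<in>{1..}. \<epsilon> i \<omega>) (\<Pi>\<^sub>M i\<in>{1..}. borel)))"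
    and V_convex: "\<forall>s. convex_on D (\<lambda>x. - V x s)"
    and V_smooth: "\<forall>s. strongly_smooth_on L D (\<lambda>x. - V x s) (\<lambda>x. - gradV s x)"
    and D: "0 < r" "D \<subseteq> cbox 0 (\<chi> i. r)" "compact D" "convex D"
    and U_differentiable: "\<forall>\<omega>\<in>space M. gradient_on D (U \<omega>) (gradU \<omega>)"
    and U_tail: "0 < a" "0 < b"
      "\<forall>B>0. \<forall>j.
         {\<omega> \<in> space M. (SUP x\<in>D. ereal \<bar>gradU \<omega> x $ j\<bar>) > ereal B} \<in> sets M \<and>
         measure M {\<omega> \<in> space M. (SUP x\<in>D. ereal \<bar>gradU \<omega> x $ j\<bar>) > ereal B} \<le> a * exp (- (B / b)\<^sup>2)"
    and V_variation: "\<forall>n\<ge>2. \<Delta>s n \<le> \<Delta>"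
    and delta: "0 < \<delta>" "\<delta> < 1"
    and scheme: "optimization_scheme \<A>"
    and run: "agp_ucb M D V t k \<sigma> \<beta> \<A> x0 U \<epsilon> X"
    and approx_opt: "0 \<le> \<eta>" "\<eta> < 1"
      "\<forall>n\<ge>1. \<forall>\<omega>\<in>space M.
         (SUP x\<in>D. acq V t k \<sigma> \<beta> U \<epsilon> X n \<omega> x) - acq V t k \<sigma> \<beta> U \<epsilon> X n \<omega> (X n \<omega>) \<le>
         \<eta> * ((SUP x\<in>D. acq V t k \<sigma> \<beta> U \<epsilon> X n \<omega> x) - acq V t k \<sigma> \<beta> U \<epsilon> X n \<omega> (X (n - 1) \<omega>))"
    and eigenbasis: "finite_measure \<nu>" "sets \<nu> = sets (restrict_space borel D)"
      "kernel_eigenbasis \<nu> k e l" "nondegenerate_spectrum l"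
    and well_behaved: "\<forall>n. \<forall>\<omega>\<in>space M.
      fourier_representable \<nu> e (posterior_mean k \<sigma> U \<epsilon> X n \<omega>) \<and>
      fourier_representable \<nu> e (posterior_var k \<sigma> X n \<omega>)"
  shows "\<Delta>s \<longlonglongrightarrow> 0 \<longrightarrow>
    (\<exists>g. g \<in> o(\<lambda>T. real T) \<and> (\<forall>T. tracking_term \<eta> \<Delta>s T \<le> g T)) \<and>
    (\<exists>B. B \<in> o(\<lambda>T. real T) \<and>
       measure M {\<omega> \<in> space M. \<forall>T\<ge>1. regret D V t U X T \<omega> \<le> B T} \<ge> 1 - \<delta> \<and>
       (\<Delta>s \<in> O(\<lambda>n. 1 / sqrt (real n)) \<longrightarrow>
          B \<in> bigo_polylog (\<lambda>T. sqrt (real CARD('d) * real T * info_gain k \<sigma> D T))))"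
proof -
  interpret prob_space M by (rule prob)
  interpret SP: smooth_paths M D k U gradU a b r
    by unfold_locales (use prob gp k_le_1 D U_differentiable U_tail in auto)
  interpret GP: gp_prior D k \<sigma> by unfold_locales (use SP.psd noise in auto)
  have x0: "x0 \<in> D" "\<And>\<omega>. \<omega> \<in> space M \<Longrightarrow> X 0 \<omega> = x0"
    and Xh: "\<And>n. 1 \<le> n \<Longrightarrow> X n \<in> measurable (history M (feedback U \<epsilon> X) n) borel"
    and XD1: "\<And>n \<omega>. 1 \<le> n \<Longrightarrow> \<omega> \<in> space M \<Longrightarrow> X n \<omega> \<in> D"
    using run unfolding agp_ucb_def by auto
  have XD: "X n \<omega> \<in> D" if "\<omega> \<in> space M" for n \<omega>
    using x0 XD1[of n \<omega>] that by (cases "n = 0") auto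
  have Dne: "D \<noteq> {}" using x0 by auto
  have contU: "continuous_on D (U \<omega>)" if "\<omega> \<in> space M" for \<omega>
    using U_differentiable that unfolding gradient_on_def continuous_on_eq_continuous_within
    by (blast intro: has_derivative_continuous)
  have contV: "continuous_on D (\<lambda>x. V x q)" for q
  proof -
    have "continuous_on D (\<lambda>x. - V x q)"
      using V_smooth unfolding strongly_smooth_on_def gradient_on_def continuous_on_eq_continuous_within
      by (blast intro: has_derivative_continuous)
    from continuous_on_minus[OF this] show ?thesis by simp
  qed
  have space\<nu>: "space \<nu> = D" using sets_eq_imp_space_eq[OF eigenbasis(2)] by (simp add: space_restrict_space)
  obtain x1 y1 where xy: "x1 \<in> D" "y1 \<in> D" "kdist k x1 y1 \<noteq> 0"
    using nondegenerate_kdist[OF SP.psd space\<nu> eigenbasis(3,4)] by blast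
  have xy_ne: "x1 \<noteq> y1" using xy(3) by (auto simp: kdist_def)
  have kpos: "\<exists>z\<in>D. 0 < k z z"
  proof (rule ccontr)
    assume "\<not> ?thesis"
    then have "k x1 x1 = 0" "k y1 y1 = 0"
      using psd_on_diag[OF SP.psd xy(1)] psd_on_diag[OF SP.psd xy(2)] xy by force+
    moreover from this have "k x1 y1 = 0" using psd_on_abs_le[OF SP.psd xy(1,2)] by simp
    ultimately show False using xy(3) by (simp add: kdist_def)
  qed
  \<comment> \<open>otherwise the tail bound at small levels makes the paths constant with probability at least 3/4\<close>
  have da: "1 / 4 < real CARD('d) * a"
  proof (rule ccontr)
    assume "\<not> ?thesis"
    then have small: "real CARD('d) * a * exp (- (B / b)\<^sup>2) \<le> 1 / 4" for B
      using mult_mono[of "real CARD('d) * a" "1 / 4" "exp (- (B / b)\<^sup>2)" 1] U_tail(1) by simp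
    define c where "c = 4 / 3 * (real CARD('d) * norm (x1 - y1))"
    have c: "0 < c" using xy_ne by (simp add: c_def)
    have kd: "0 < kdist k x1 y1" using xy(3) psd_on_kdist_nonneg(2)[OF SP.psd xy(1,2)] by simp
    define B where "B = kdist k x1 y1 / (2 * c)"
    have B: "0 < B" using kd c by (simp add: B_def)
    have "kdist k x1 y1 \<le> B * c" using SP.kdist_le[OF B small xy(1,2)] by (simp add: c_def mult_ac)
    also have "\<dots> = kdist k x1 y1 / 2" using c by (simp add: B_def)
    finally show False using kd by simp
  qed
  have perfect: "x islimpt D" if "x \<in> D" for x
    using xy xy_ne by (intro connected_imp_perfect[OF convex_connected[OF D(4)] that]) auto
  interpret GC: gp_prior_continuum D k \<sigma>
    by unfold_locales (use k_le_1 SP.kernel_continuous perfect in auto)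
  interpret GR: gp_run D k \<sigma> M U \<epsilon> X
    by unfold_locales
      (use prob gp contU SP.kernel_continuous compact_imp_closed[OF D(3)] Dne noise noise_indep_U Xh XD1 in auto)
  obtain C where C: "C > 0" "\<And>x y. x \<in> D \<Longrightarrow> y \<in> D \<Longrightarrow> kdist k x y \<le> C * norm (x - y)"
    using SP.kdist_Lipschitz by blast
  define \<gamma> where "\<gamma> = info_gain k \<sigma> D"
  define dr where "dr = real CARD('d) * r"
  have dr: "0 < dr" using D(1) by (simp add: dr_def)
  have \<beta>n: "\<beta> n = \<beta> 1 + (4 + 4 * real CARD('d)) * ln (real n)" if "1 \<le> n" for n
    unfolding beta[rule_format] by (rule beta_eq) (use U_tail D delta da that in auto)
  define s where "s n = sqrt (\<beta> n)" for n
  have \<beta>mono: "\<beta> n \<le> \<beta> (Suc n)" if "1 \<le> n" for n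
  proof -
    have "\<beta> (Suc n) = \<beta> 1 + (4 + 4 * real CARD('d)) * ln (real (Suc n))" by (rule \<beta>n) simp
    moreover have "(4 + 4 * real CARD('d)) * ln (real n) \<le> (4 + 4 * real CARD('d)) * ln (real (Suc n))"
      using that by (intro mult_left_mono) auto
    ultimately show ?thesis using \<beta>n[OF that] by linarith
  qed
  have smono: "s n \<le> s (Suc n)" if "1 \<le> n" for n
    unfolding s_def using \<beta>mono[OF that] by simp
  define K where "K = sqrt (\<bar>\<beta> 1\<bar> + (4 + 4 * real CARD('d)))"
  have sgrow: "s n \<le> K * sqrt (ln (real n + 2))" if n: "1 \<le> n" for n
  proof -
    have "exp 1 \<le> real n + 2" using exp_le n by linarith
    then have l1: "1 \<le> ln (real n + 2)" using ln_ge_iff[of "real n + 2" 1] by simp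
    have "\<beta> n \<le> \<bar>\<beta> 1\<bar> * ln (real n + 2) + (4 + 4 * real CARD('d)) * ln (real n + 2)"
      unfolding \<beta>n[OF n]
    proof (rule add_mono)
      show "\<beta> 1 \<le> \<bar>\<beta> 1\<bar> * ln (real n + 2)" using mult_left_mono[OF l1, of "\<bar>\<beta> 1\<bar>"] by simp
      show "(4 + 4 * real CARD('d)) * ln (real n) \<le> (4 + 4 * real CARD('d)) * ln (real n + 2)"
        using n by (intro mult_left_mono) auto
    qed
    then have "\<beta> n \<le> (\<bar>\<beta> 1\<bar> + (4 + 4 * real CARD('d))) * ln (real n + 2)" by (simp add: distrib_right)
    then show ?thesis unfolding s_def K_def real_sqrt_mult[symmetric] by (rule real_sqrt_le_mono)
  qed
  have "eventually (\<lambda>n. 0 \<le> \<beta> 1 + (4 + 4 * real CARD('d)) * ln (real n)) sequentially"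
  proof -
    have "filterlim (\<lambda>n. \<beta> 1 + (4 + 4 * real CARD('d)) * ln (real n)) at_top sequentially"
      by (intro filterlim_tendsto_add_at_top[OF tendsto_const] filterlim_tendsto_pos_mult_at_top[OF tendsto_const]
          filterlim_compose[OF ln_at_top filterlim_real_sequentially]) auto
    then show ?thesis by (simp add: filterlim_at_top)
  qed
  then obtain N1 where N1: "\<And>n. N1 \<le> n \<Longrightarrow> 0 \<le> \<beta> 1 + (4 + 4 * real CARD('d)) * ln (real n)"
    unfolding eventually_sequentially by blast
  \<comment> \<open>from \<open>N0\<close> on the weights are real square roots, and at least one observation is available\<close>
  define N0 where "N0 = max N1 2"
  have N0: "2 \<le> N0" "\<And>n. N0 \<le> n \<Longrightarrow> 0 \<le> \<beta> n"
  proof -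
    fix n assume that: "N0 \<le> n"
    have "N1 \<le> n" "1 \<le> n" using that by (auto simp: N0_def)
    then show "0 \<le> \<beta> n" using N1[of n] \<beta>n[of n] by linarith
  qed (simp add: N0_def)
  have exp\<beta>: "exp (- (s n)\<^sup>2 / 2) = exp (- \<beta> 1 / 2) / real n ^ (2 + 2 * CARD('d))" if n: "N0 \<le> n" for n
  proof -
    have n1: "1 \<le> n" using n N0(1) by simp
    have "(s n)\<^sup>2 = \<beta> n" using N0(2)[OF n] by (simp add: s_def)
    then have "- (s n)\<^sup>2 / 2 = - \<beta> 1 / 2 - real (2 + 2 * CARD('d)) * ln (real n)"
      using \<beta>n[OF n1] by (simp add: algebra_simps add_divide_distrib diff_divide_distrib)
    then have "exp (- (s n)\<^sup>2 / 2) = exp (- \<beta> 1 / 2) / exp (real (2 + 2 * CARD('d)) * ln (real n))"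
      by (simp only: exp_diff)
    also have "exp (real (2 + 2 * CARD('d)) * ln (real n)) = real n ^ (2 + 2 * CARD('d))"
      unfolding exp_of_nat_mult using n1 by simp
    finally show ?thesis .
  qed
  \<comment> \<open>The net at time \<open>n\<close> has order \<open>n ^ (2 * d)\<close> points, and each bound fails with probability of order
    \<open>1 / n ^ (2 + 2 * d)\<close>, so the failures are summable and cease almost surely.\<close>
  have "\<forall>n. \<exists>P. 1 \<le> n \<longrightarrow> finite P \<and> P \<subseteq> D \<and> card P \<le> (n\<^sup>2 + 1) ^ CARD('d) \<and>
      (\<forall>x\<in>D. \<exists>p\<in>P. norm (x - p) \<le> dr / real (n\<^sup>2))"
  proof
    fix n :: nat
    show "\<exists>P. 1 \<le> n \<longrightarrow> finite P \<and> P \<subseteq> D \<and> card P \<le> (n\<^sup>2 + 1) ^ CARD('d) \<and>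
      (\<forall>x\<in>D. \<exists>p\<in>P. norm (x - p) \<le> dr / real (n\<^sup>2))"
      using box_net[OF D(1,2), of "n\<^sup>2"] unfolding dr_def[symmetric] by (cases "1 \<le> n") auto
  qed
  from choice[OF this] obtain P where P: "\<And>n. 1 \<le> n \<Longrightarrow> finite (P n)" "\<And>n. 1 \<le> n \<Longrightarrow> P n \<subseteq> D"
    "\<And>n. 1 \<le> n \<Longrightarrow> card (P n) \<le> (n\<^sup>2 + 1) ^ CARD('d)"
    "\<And>n x. 1 \<le> n \<Longrightarrow> x \<in> D \<Longrightarrow> \<exists>p\<in>P n. norm (x - p) \<le> dr / real (n\<^sup>2)"
    by blast
  define bad where "bad n Z = {\<omega>\<in>space M. s n * sqrt (posterior_var k \<sigma> X (n - 1) \<omega> (Z \<omega>)) <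
      \<bar>U \<omega> (Z \<omega>) - posterior_mean k \<sigma> U \<epsilon> X (n - 1) \<omega> (Z \<omega>)\<bar>}" for n and Z :: "'w \<Rightarrow> real ^ 'd"
  have bad: "bad n Z \<in> events" "prob (bad n Z) \<le> 2 * exp (- (s n)\<^sup>2 / 2)"
    if "N0 \<le> n" "Z \<in> measurable (history M (feedback U \<epsilon> X) n) borel" "\<And>\<omega>. \<omega> \<in> space M \<Longrightarrow> Z \<omega> \<in> D" for n Z
  proof -
    have n: "1 \<le> n - 1" "Suc (n - 1) = n" using that(1) N0(1) by auto
    have sn: "0 \<le> s n" using N0(2)[OF that(1)] by (simp add: s_def)
    show "bad n Z \<in> events" "prob (bad n Z) \<le> 2 * exp (- (s n)\<^sup>2 / 2)"
      unfolding bad_def using GR.adaptive_tail[OF n(1) _ that(3) sn, unfolded n(2), OF that(2)] by auto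
  qed
  define noisy where "noisy n = {\<omega>\<in>space M. s n * \<sigma> < \<bar>\<epsilon> n \<omega>\<bar>}" for n
  have noisy: "noisy n \<in> events" "prob (noisy n) \<le> 2 * exp (- (s n)\<^sup>2 / 2)" if n: "N0 \<le> n" for n
  proof -
    have n1: "1 \<le> n" using n N0(1) by simp
    have [measurable]: "\<epsilon> n \<in> borel_measurable M" by (rule GR.noise_measurable[OF n1])
    show "noisy n \<in> events" unfolding noisy_def by measurable
    have d: "distributed M lborel (\<epsilon> n) (normal_density 0 \<sigma>)"
      using noise(1) noise(2)[rule_format, OF n1] by (simp add: normal_rv_def)
    have "prob (noisy n) = measure (distr M lborel (\<epsilon> n)) {x. s n * \<sigma> < \<bar>x - 0\<bar>}"
      unfolding noisy_def by (subst measure_distr) (auto intro!: arg_cong[where f=prob])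
    also have "\<dots> \<le> 2 * exp (- (s n)\<^sup>2 / 2)"
      unfolding distributed_distr_eq_density[OF d] using noise(1) N0(2)[OF n]
      by (intro normal_abs_tail) (auto simp: s_def)
    finally show "prob (noisy n) \<le> 2 * exp (- (s n)\<^sup>2 / 2)" .
  qed
  define Bad where "Bad n = (if N0 \<le> n then (\<Union>p\<in>P n. bad n (\<lambda>_. p)) \<union> bad n (X n) \<union> noisy n else {})" for n
  have badP: "bad n (\<lambda>_. p) \<in> events" "prob (bad n (\<lambda>_. p)) \<le> 2 * exp (- (s n)\<^sup>2 / 2)"
    if "N0 \<le> n" "p \<in> P n" for n p
    using bad[OF that(1), of "\<lambda>_. p"] P(2)[of n] that N0(1) by auto
  have badX: "bad n (X n) \<in> events" "prob (bad n (X n)) \<le> 2 * exp (- (s n)\<^sup>2 / 2)" if "N0 \<le> n" for n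
    using bad[OF that Xh XD] that N0(1) by auto
  have Bad_sets: "Bad n \<in> events" for n
  proof (cases "N0 \<le> n")
    case True
    then have "1 \<le> n" using N0(1) by simp
    then have "(\<Union>p\<in>P n. bad n (\<lambda>_. p)) \<in> events"
      by (intro sets.finite_UN P(1) badP(1)[OF True]) auto
    then show ?thesis unfolding Bad_def using True badX(1)[OF True] noisy(1)[OF True] by auto
  qed (simp add: Bad_def)
  define c1 where "c1 = (2 ^ CARD('d) + 2) * (2 * exp (- \<beta> 1 / 2))"
  have Bad_prob: "prob (Bad n) \<le> c1 * inverse (real n ^ 2)" for n
  proof (cases "N0 \<le> n")
    case True
    have n: "1 \<le> n" using True N0(1) by simp
    let ?t = "2 * exp (- (s n)\<^sup>2 / 2)"
    have one: "1 \<le> real n ^ (2 * CARD('d))" using n by (intro one_le_power) simp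
    have "prob (Bad n) \<le> prob (\<Union>p\<in>P n. bad n (\<lambda>_. p)) + prob (bad n (X n)) + prob (noisy n)"
    proof -
      have U: "(\<Union>p\<in>P n. bad n (\<lambda>_. p)) \<in> events" using badP[OF True] P(1)[OF n] by auto
      have "prob (Bad n) \<le> prob ((\<Union>p\<in>P n. bad n (\<lambda>_. p)) \<union> bad n (X n)) + prob (noisy n)"
        using True U badX[OF True] noisy[OF True] unfolding Bad_def by (auto intro!: measure_Un_le)
      moreover have "prob ((\<Union>p\<in>P n. bad n (\<lambda>_. p)) \<union> bad n (X n)) \<le> prob (\<Union>p\<in>P n. bad n (\<lambda>_. p)) + prob (bad n (X n))"
        using U badX[OF True] by (auto intro!: measure_Un_le)
      ultimately show ?thesis by linarith
    qed
    also have "prob (\<Union>p\<in>P n. bad n (\<lambda>_. p)) \<le> (\<Sum>p\<in>P n. prob (bad n (\<lambda>_. p)))"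
      using badP[OF True] P(1)[OF n] by (intro finite_measure_subadditive_finite) auto
    also have "\<dots> \<le> (\<Sum>p\<in>P n. ?t)" using badP[OF True] by (intro sum_mono) auto
    also have "\<dots> = real (card (P n)) * ?t" by simp
    also have "\<dots> \<le> 2 ^ CARD('d) * real n ^ (2 * CARD('d)) * ?t"
    proof (rule mult_right_mono)
      have "real (card (P n)) \<le> real ((n\<^sup>2 + 1) ^ CARD('d))" using P(3)[OF n] by (simp only: of_nat_le_iff)
      also have "\<dots> \<le> (2 * (real n)\<^sup>2) ^ CARD('d)"
        unfolding of_nat_power using n by (intro power_mono) auto
      also have "\<dots> = 2 ^ CARD('d) * real n ^ (2 * CARD('d))" by (simp add: power_mult_distrib power_mult)
      finally show "real (card (P n)) \<le> 2 ^ CARD('d) * real n ^ (2 * CARD('d))" .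
    qed simp
    also have "prob (bad n (X n)) \<le> 1 * real n ^ (2 * CARD('d)) * ?t"
      by (rule order_trans[OF badX(2)[OF True]]) (use one in simp)
    also have "prob (noisy n) \<le> 1 * real n ^ (2 * CARD('d)) * ?t"
      by (rule order_trans[OF noisy(2)[OF True]]) (use one in simp)
    finally have "prob (Bad n) \<le> (2 ^ CARD('d) + 2) * (real n ^ (2 * CARD('d)) * ?t)"
      by (simp add: algebra_simps)
    also have "real n ^ (2 * CARD('d)) * ?t = 2 * exp (- \<beta> 1 / 2) * inverse (real n ^ 2)"
      unfolding exp\<beta>[OF True] using n by (simp add: power_add field_simps power2_eq_square)
    finally show ?thesis by (simp add: c1_def)
  next
    case False
    then show ?thesis by (simp add: Bad_def c1_def)
  qed
  have "summable (\<lambda>n. prob (Bad n))"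
  proof (rule summable_comparison_test'[of "\<lambda>n. c1 * inverse (real n ^ 2)" 0])
    show "summable (\<lambda>n. c1 * inverse (real n ^ 2))"
      by (intro summable_mult inverse_power_summable) simp
  qed (use Bad_prob in auto)
  then have AE_good: "AE \<omega> in M. eventually (\<lambda>n. \<omega> \<in> space M - Bad n) sequentially"
    using Bad_sets by (intro borel_cantelli_AE1) (auto simp: emeasure_eq_measure)
  have bddV: "bdd_above ((\<lambda>z. \<bar>V z q - V z q'\<bar>) ` D)" for q q'
    by (intro bounded_imp_bdd_above compact_imp_bounded compact_continuous_image D continuous_intros contV)
  have drift: "\<bar>V z (t n) - V z (t (n - 1))\<bar> \<le> \<Delta>s n" if "z \<in> D" for n z
    unfolding variation[rule_format] variation_def by (rule cSUP_upper[OF that bddV])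
  have \<Delta>0: "0 \<le> \<Delta>s n" for n using drift[OF x0(1), of n] by linarith
  define bnd where "bnd T = sqrt (ln (real T + 2)) * sqrt (real T * \<gamma> T) + sqrt (real T) + (\<Sum>n=2..T. \<Delta>s n)" for T
  have AE_regret: "AE \<omega> in M. \<exists>B. \<forall>T\<ge>1. regret D V t U X T \<omega> \<le> B * bnd T"
    using AE_good SP.AE_Lipschitz AE_space
  proof eventually_elim
    case (elim \<omega>)
    then have \<omega>: "\<omega> \<in> space M" by simp
    obtain L where L: "0 \<le> L" "\<And>x y. x \<in> D \<Longrightarrow> y \<in> D \<Longrightarrow> \<bar>U \<omega> x - U \<omega> y\<bar> \<le> L * norm (x - y)"
      using elim by blast
    obtain N2 where N2: "\<And>n. N2 \<le> n \<Longrightarrow> \<omega> \<in> space M - Bad n"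
      using elim unfolding eventually_sequentially by blast
    define N where "N = max N0 N2"
    have N: "1 \<le> N" "N0 \<le> N" using N0(1) by (auto simp: N_def)
    interpret UP: ucb_path D k \<sigma> "\<lambda>n. X n \<omega>" "\<lambda>n. feedback U \<epsilon> X n \<omega>" "U \<omega>" "\<lambda>n z. V z (t n)" s \<Delta>s \<eta>
      by unfold_locales (use k_le_1 XD[OF \<omega>] approx_opt in auto)
    have mu: "posterior_mean k \<sigma> U \<epsilon> X n \<omega> = UP.mu n" and va: "posterior_var k \<sigma> X n \<omega> = UP.va n" for n
      by (simp_all add: posterior_mean_def posterior_var_def UP.mu_def UP.va_def)
    have \<phi>: "acq V t k \<sigma> \<beta> U \<epsilon> X n \<omega> = UP.\<phi> n" for n
      by (intro ext) (simp add: acq_def ucb_def UP.\<phi>_def mu va s_def)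
    have good: "\<bar>feedback U \<epsilon> X n \<omega> - U \<omega> (X n \<omega>)\<bar> \<le> s n * \<sigma>"
      "\<bar>U \<omega> (X n \<omega>) - UP.mu (n - 1) (X n \<omega>)\<bar> \<le> s n * sqrt (UP.va (n - 1) (X n \<omega>))"
      "p \<in> P n \<Longrightarrow> \<bar>U \<omega> p - UP.mu (n - 1) p\<bar> \<le> s n * sqrt (UP.va (n - 1) p)" if n: "N \<le> n" for n p
    proof -
      have "\<omega> \<notin> Bad n" "N0 \<le> n" using N2[of n] n by (auto simp: N_def)
      then have nb: "\<omega> \<notin> noisy n" "\<omega> \<notin> bad n (X n)" "p \<in> P n \<Longrightarrow> \<omega> \<notin> bad n (\<lambda>_. p)"
        by (auto simp: Bad_def)
      show "\<bar>feedback U \<epsilon> X n \<omega> - U \<omega> (X n \<omega>)\<bar> \<le> s n * \<sigma>"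
        using nb(1) \<omega> by (simp add: noisy_def feedback_def)
      show "\<bar>U \<omega> (X n \<omega>) - UP.mu (n - 1) (X n \<omega>)\<bar> \<le> s n * sqrt (UP.va (n - 1) (X n \<omega>))"
        using nb(2) \<omega> by (simp add: bad_def mu va)
      show "p \<in> P n \<Longrightarrow> \<bar>U \<omega> p - UP.mu (n - 1) p\<bar> \<le> s n * sqrt (UP.va (n - 1) p)"
        using nb(3) \<omega> by (simp add: bad_def mu va)
    qed
    have bdd: "bdd_above (UP.\<phi> n ` D)" for n
    proof -
      have "bdd_above ((\<lambda>z. V z (t n)) ` D)"
        by (intro bounded_imp_bdd_above compact_imp_bounded compact_continuous_image D contV)
      then obtain m where m: "\<And>z. z \<in> D \<Longrightarrow> V z (t n) \<le> m" by (auto simp: bdd_above_def)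
      define R where "R = (\<Sum>i=1..n-1. \<bar>feedback U \<epsilon> X i \<omega> - UP.mu (i - 1) (X i \<omega>)\<bar>)"
      have R0: "0 \<le> R" unfolding R_def by (intro sum_nonneg) auto
      have "UP.\<phi> n z \<le> m + (UP.mu (n - 1) x0 + 2 * R / \<sigma>\<^sup>2 + \<bar>s n\<bar>)" if z: "z \<in> D" for z
      proof -
        have "kdist k z x0 \<le> 2"
        proof -
          have "\<bar>k z x0\<bar> \<le> 1"
            using psd_on_abs_le[OF SP.psd z x0(1)] k_le_1 z x0(1)
              mult_mono[of "sqrt (k z z)" 1 "sqrt (k x0 x0)" 1] psd_on_diag[OF SP.psd x0(1)] by auto
          then have "k z z - 2 * k z x0 + k x0 x0 \<le> 2\<^sup>2"
            using k_le_1[rule_format, OF z] k_le_1[rule_format, OF x0(1)] by (simp add: abs_le_iff)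
          then show ?thesis unfolding kdist_def by (intro real_le_lsqrt) auto
        qed
        then have "kdist k z x0 * R / \<sigma>\<^sup>2 \<le> 2 * R / \<sigma>\<^sup>2" using R0 by (intro divide_right_mono mult_right_mono) auto
        then have "UP.mu (n - 1) z \<le> UP.mu (n - 1) x0 + 2 * R / \<sigma>\<^sup>2"
          using UP.mu_Lipschitz[OF z x0(1), of "n - 1"] unfolding R_def by linarith
        moreover have "s n * sqrt (UP.va (n - 1) z) \<le> \<bar>s n\<bar> * 1"
          using UP.va_bounds[OF z, of "n - 1"] by (intro mult_mono) auto
        ultimately show ?thesis using m[OF z] by (simp add: UP.\<phi>_def)
      qed
      then show ?thesis by (intro bdd_aboveI2[where M="m + (UP.mu (n - 1) x0 + 2 * R / \<sigma>\<^sup>2 + \<bar>s n\<bar>)"]) auto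
    qed
    have reg: "regret D V t U X T \<omega> = (\<Sum>n=1..T. UP.loss n)" for T
      by (simp add: regret_def UP.loss_def)
    show ?case
      unfolding reg bnd_def
    proof (rule UP.cumulative_loss_le[where P=P and w=dr and L=L and C=C and K=K])
      show "1 \<le> N" by (rule N)
      show "bdd_above (UP.\<phi> n ` D)" for n by (rule bdd)
      show "UP.gap n \<le> \<eta> * ((SUP z\<in>D. UP.\<phi> n z) - UP.\<phi> n (X (n - 1) \<omega>))" if "1 \<le> n" for n
        using approx_opt(3)[rule_format, OF that \<omega>] by (simp add: UP.gap_def \<phi>)
      show "\<bar>V z (t n) - V z (t (n - 1))\<bar> \<le> \<Delta>s n" if "2 \<le> n" "z \<in> D" for n z
        by (rule drift[OF that(2)])
      show "0 \<le> s n" if "N \<le> n" for n using N0(2)[of n] N(2) that by (simp add: s_def)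
      show "s n \<le> s (Suc n)" if "N \<le> n" for n using smono[of n] N(1) that by simp
      show "s n \<le> K * sqrt (ln (real n + 2))" if "1 \<le> n" for n by (rule sgrow[OF that])
      show "0 \<le> K" by (simp add: K_def)
      show "\<exists>p\<in>P n. norm (z - p) \<le> dr / (real n)\<^sup>2" if "1 \<le> n" "z \<in> D" for n z
        using P(4)[OF that] by simp
      show "P n \<subseteq> D" if "1 \<le> n" for n by (rule P(2)[OF that])
      show "0 \<le> dr" "0 \<le> C" using dr C by auto
      show "info k \<sigma> (data_upto (\<lambda>n. X n \<omega>) T) \<le> \<gamma> T" for T
        using GC.info_le_info_gain[OF UP.data_D[of T]] by (simp add: \<gamma>_def data_upto_def del: upt_Suc)
    qed (use good L C in auto)
  qed
  obtain z1 where z1: "z1 \<in> D" "0 < k z1 z1" using kpos by blast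
  \<comment> \<open>a positive lower bound on the information gain absorbs terms of order \<open>sqrt T\<close>\<close>
  define \<gamma>1 where "\<gamma>1 = 1 / 2 * ln (1 + k z1 z1 / \<sigma>\<^sup>2)"
  have \<gamma>1: "0 < \<gamma>1"
  proof -
    have "0 < k z1 z1 / \<sigma>\<^sup>2" using z1(2) noise(1) by simp
    then have "0 < ln (1 + k z1 z1 / \<sigma>\<^sup>2)" by (intro ln_gt_zero) linarith
    then show ?thesis by (simp add: \<gamma>1_def)
  qed
  have \<gamma>ge: "\<gamma>1 \<le> \<gamma> T" if "1 \<le> T" for T
    using GC.info_gain_lower[OF z1(1) that] by (simp add: \<gamma>_def \<gamma>1_def)
  have \<gamma>0: "0 \<le> \<gamma> T" for T
  proof -
    have "set (replicate T z1) \<subseteq> D" using z1(1) by (auto simp: set_replicate_conv_if)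
    from GC.info_le_info_gain[OF this] GP.info_bounds(3)[OF k_le_1 this]
    show ?thesis by (simp add: \<gamma>_def)
  qed
  have bnd0: "0 \<le> bnd T" for T
    unfolding bnd_def using \<gamma>0[of T] \<Delta>0 by (intro add_nonneg_nonneg mult_nonneg_nonneg sum_nonneg) auto
  have regret_measurable: "regret D V t U X T \<in> borel_measurable M" for T
  proof -
    have "(\<lambda>\<omega>. (SUP x\<in>D. V x (t n) + U \<omega> x) - (V (X n \<omega>) (t n) + U \<omega> (X n \<omega>))) \<in> borel_measurable M"
      if n: "n \<in> {1..T}" for n
    proof -
      have Xm: "X n \<in> borel_measurable M" using GR.X_measurable[of n] n by auto
      have f: "\<And>\<omega>. \<omega> \<in> space M \<Longrightarrow> continuous_on D (\<lambda>x. V x (t n) + U \<omega> x)"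
        by (intro continuous_on_add contV contU)
      have m: "\<And>x. x \<in> D \<Longrightarrow> (\<lambda>\<omega>. V x (t n) + U \<omega> x) \<in> borel_measurable M"
        by (intro borel_measurable_add borel_measurable_const GR.U_measurable)
      show ?thesis
        by (rule borel_measurable_diff[OF SUP_measurable[OF D(3) Dne f m] Caratheodory_measurable[OF f m Xm XD]])
    qed
    then show ?thesis unfolding regret_def[abs_def] by (rule borel_measurable_sum)
  qed
  obtain B0 where B0: "prob {\<omega> \<in> space M. \<forall>T\<ge>1. regret D V t U X T \<omega> \<le> B0 * bnd T} \<ge> 1 - \<delta>"
    using AE_random_constant[OF prob regret_measurable bnd0 AE_regret delta(1)] by blast
  have info_small: "(\<lambda>T. sqrt (ln (real T + 2)) * sqrt (real T * \<gamma> T)) \<in> o(\<lambda>T. real T)"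
  proof -
    \<comment> \<open>a net of mesh \<open>dr / q\<close> in \<open>D\<close> has feature-space mesh \<open>C * dr / q\<close>\<close>
    define A where "A = 2 * (C * dr)\<^sup>2"
    have A: "0 < A" using C dr by (simp add: A_def)
    define c where "c = 1 / (2 * \<sigma>\<^sup>2) * (A + 16 * (1 + \<sigma>\<^sup>2) / A\<^sup>2)"
    have c: "0 < c" unfolding c_def using A noise(1) by (intro mult_pos_pos add_pos_nonneg) auto
    have "\<gamma> T \<le> c * (real T / (real q)\<^sup>2 + real (q + 1) ^ (CARD('d) + 4))" if q: "1 \<le> q" for T q
    proof -
      obtain Q where Q: "finite Q" "Q \<subseteq> D" "card Q \<le> (q + 1) ^ CARD('d)" "\<forall>x\<in>D. \<exists>p\<in>Q. norm (x - p) \<le> dr / real q"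
        using box_net[OF D(1,2) q] unfolding dr_def by blast
      define \<theta> where "\<theta> = A / (real q)\<^sup>2"
      have \<theta>: "0 < \<theta>" using A q by (simp add: \<theta>_def)
      have net: "\<exists>p\<in>Q. (kdist k x p)\<^sup>2 \<le> \<theta> / 2" if x: "x \<in> D" for x
      proof -
        obtain p where p: "p \<in> Q" "norm (x - p) \<le> dr / real q" using Q(4) x by blast
        then have pD: "p \<in> D" using Q by auto
        have "kdist k x p \<le> C * (dr / real q)"
          using C(2)[OF x pD] mult_left_mono[OF p(2), of C] C(1) by simp
        then have "(kdist k x p)\<^sup>2 \<le> (C * (dr / real q))\<^sup>2"
          using psd_on_kdist_nonneg(2)[OF SP.psd x pD] by (intro power_mono) auto
        also have "\<dots> = \<theta> / 2" by (simp add: \<theta>_def A_def power_divide power_mult_distrib)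
        finally show ?thesis using p(1) by blast
      qed
      have "\<gamma> T \<le> 1 / (2 * \<sigma>\<^sup>2) * (\<theta> * real T + 16 * (1 + \<sigma>\<^sup>2) / \<theta>\<^sup>2 * real (card Q))"
        unfolding \<gamma>_def by (rule GC.info_gain_le[OF Q(1,2) \<theta> Dne net])
      also have "\<dots> \<le> 1 / (2 * \<sigma>\<^sup>2) * ((A + 16 * (1 + \<sigma>\<^sup>2) / A\<^sup>2) * (real T / (real q)\<^sup>2 + real (q + 1) ^ (CARD('d) + 4)))"
      proof (intro mult_left_mono)
        have "16 * (1 + \<sigma>\<^sup>2) / \<theta>\<^sup>2 * real (card Q) = 16 * (1 + \<sigma>\<^sup>2) / A\<^sup>2 * (real q ^ 4 * real (card Q))"
          by (simp add: \<theta>_def power_divide)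
        also have "\<dots> \<le> 16 * (1 + \<sigma>\<^sup>2) / A\<^sup>2 * real (q + 1) ^ (CARD('d) + 4)"
        proof (rule mult_left_mono)
          have "real (card Q) \<le> real ((q + 1) ^ CARD('d))" using Q(3) by (simp only: of_nat_le_iff)
          then have "real q ^ 4 * real (card Q) \<le> real (q + 1) ^ 4 * real (q + 1) ^ CARD('d)"
            by (intro mult_mono power_mono) auto
          then show "real q ^ 4 * real (card Q) \<le> real (q + 1) ^ (CARD('d) + 4)" by (simp add: power_add mult.commute)
        qed (use A in simp)
        finally have 1: "16 * (1 + \<sigma>\<^sup>2) / \<theta>\<^sup>2 * real (card Q) \<le> 16 * (1 + \<sigma>\<^sup>2) / A\<^sup>2 * real (q + 1) ^ (CARD('d) + 4)" .
        have 2: "0 \<le> 16 * (1 + \<sigma>\<^sup>2) / A\<^sup>2 * (real T / (real q)\<^sup>2)" "0 \<le> A * real (q + 1) ^ (CARD('d) + 4)"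
          using A by auto
        have "(A + 16 * (1 + \<sigma>\<^sup>2) / A\<^sup>2) * (real T / (real q)\<^sup>2 + real (q + 1) ^ (CARD('d) + 4)) =
            (A * (real T / (real q)\<^sup>2) + 16 * (1 + \<sigma>\<^sup>2) / A\<^sup>2 * real (q + 1) ^ (CARD('d) + 4)) +
            (16 * (1 + \<sigma>\<^sup>2) / A\<^sup>2 * (real T / (real q)\<^sup>2) + A * real (q + 1) ^ (CARD('d) + 4))"
          by (simp only: distrib_left distrib_right add_ac)
        moreover have "\<theta> * real T = A * (real T / (real q)\<^sup>2)" by (simp add: \<theta>_def)
        ultimately show "\<theta> * real T + 16 * (1 + \<sigma>\<^sup>2) / \<theta>\<^sup>2 * real (card Q) \<le>
            (A + 16 * (1 + \<sigma>\<^sup>2) / A\<^sup>2) * (real T / (real q)\<^sup>2 + real (q + 1) ^ (CARD('d) + 4))"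
          using 1 2 by linarith
      qed simp
      finally show ?thesis by (simp only: c_def mult.assoc)
    qed
    from information_term_smallo[OF \<gamma>0 c this] show ?thesis .
  qed
  have sqrt_small: "(\<lambda>T. sqrt (real T)) \<in> o(\<lambda>T. real T)" by real_asymp
  show ?thesis
  proof (intro impI conjI)
    assume lim: "\<Delta>s \<longlonglongrightarrow> 0"
    note S_small = Cesaro_smallo[OF lim \<Delta>0]
    show "\<exists>g. g \<in> o(\<lambda>T. real T) \<and> (\<forall>T. tracking_term \<eta> \<Delta>s T \<le> g T)"
    proof (intro exI conjI allI)
      show "(\<lambda>T. 2 / (1 - \<eta>) * (\<Sum>n=2..T. \<Delta>s n)) \<in> o(\<lambda>T. real T)"
        by (subst landau_o.small.cmult_in_iff) (use S_small approx_opt(2) in auto)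
      show "tracking_term \<eta> \<Delta>s T \<le> 2 / (1 - \<eta>) * (\<Sum>n=2..T. \<Delta>s n)" for T
        by (rule tracking_term_le[OF approx_opt(1,2) \<Delta>0])
    qed
    have bnd_small: "bnd \<in> o(\<lambda>T. real T)"
      unfolding bnd_def[abs_def] by (intro sum_in_smallo info_small sqrt_small S_small)
    have bnd_big: "bnd \<in> O(\<lambda>T. sqrt (real CARD('d) * real T * \<gamma> T) * ln (real T) ^ 1)"
      if O: "\<Delta>s \<in> O(\<lambda>n. 1 / sqrt (real n))"
    proof -
      let ?G = "\<lambda>T. sqrt (real CARD('d) * real T * \<gamma> T) * ln (real T) ^ 1"
      have ev: "eventually (\<lambda>T. 1 \<le> T \<and> sqrt (ln (real T + 2)) \<le> ln (real T) \<and> 1 \<le> ln (real T)) sequentially"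
        by (intro eventually_conj eventually_ge_at_top) real_asymp+
      have dge: "sqrt (real T * \<gamma> T) \<le> sqrt (real CARD('d) * real T * \<gamma> T)" for T
        using \<gamma>0[of T] mult_right_mono[of 1 "real CARD('d)" "real T * \<gamma> T"] by (simp add: Suc_le_eq mult.assoc)
      have 1: "(\<lambda>T. sqrt (ln (real T + 2)) * sqrt (real T * \<gamma> T)) \<in> O(?G)"
      proof (rule landau_o.bigI[of 1])
        show "eventually (\<lambda>T. norm (sqrt (ln (real T + 2)) * sqrt (real T * \<gamma> T)) \<le> 1 * norm (?G T)) sequentially"
          using ev
        proof eventually_elim
          case (elim T)
          have "sqrt (ln (real T + 2)) * sqrt (real T * \<gamma> T) \<le> ln (real T) * sqrt (real CARD('d) * real T * \<gamma> T)"
            using elim \<gamma>0[of T] by (intro mult_mono dge) auto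
          then show ?case using elim \<gamma>0[of T] by (simp add: abs_mult mult.commute)
        qed
      qed simp
      have 2: "(\<lambda>T. sqrt (real T)) \<in> O(?G)"
      proof (rule landau_o.bigI[of "1 / sqrt \<gamma>1"])
        show "eventually (\<lambda>T. norm (sqrt (real T)) \<le> 1 / sqrt \<gamma>1 * norm (?G T)) sequentially"
          using ev
        proof eventually_elim
          case (elim T)
          have "sqrt (real T) * sqrt \<gamma>1 \<le> sqrt (real T * \<gamma> T)"
            unfolding real_sqrt_mult[symmetric] using \<gamma>ge[of T] elim by (intro real_sqrt_le_mono mult_left_mono) auto
          also have "\<dots> \<le> sqrt (real CARD('d) * real T * \<gamma> T)" by (rule dge)
          also have "\<dots> \<le> ?G T" using elim \<gamma>0[of T] mult_left_mono[of 1 "ln (real T)" "sqrt (real CARD('d) * real T * \<gamma> T)"] by simp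
          finally have "sqrt (real T) * sqrt \<gamma>1 \<le> ?G T" .
          moreover have "0 \<le> ?G T" using elim \<gamma>0[of T] by simp
          ultimately show ?case using \<gamma>1 by (simp add: field_simps)
        qed
      qed (use \<gamma>1 in simp)
      have 3: "(\<lambda>T. \<Sum>n=2..T. \<Delta>s n) \<in> O(?G)"
        by (rule landau_o.big_trans[OF sum_bigo_sqrt[OF O \<Delta>0] 2])
      show ?thesis unfolding bnd_def[abs_def] by (intro sum_in_bigo 1 2 3)
    qed
    show "\<exists>B. B \<in> o(\<lambda>T. real T) \<and>
       measure M {\<omega> \<in> space M. \<forall>T\<ge>1. regret D V t U X T \<omega> \<le> B T} \<ge> 1 - \<delta> \<and>
       (\<Delta>s \<in> O(\<lambda>n. 1 / sqrt (real n)) \<longrightarrow>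
          B \<in> bigo_polylog (\<lambda>T. sqrt (real CARD('d) * real T * info_gain k \<sigma> D T)))"
    proof (intro exI[of _ "\<lambda>T. B0 * bnd T"] conjI impI B0)
      show "(\<lambda>T. B0 * bnd T) \<in> o(\<lambda>T. real T)" using bnd_small by (cases "B0 = 0") auto
      assume "\<Delta>s \<in> O(\<lambda>n. 1 / sqrt (real n))"
      from bnd_big[OF this] have "(\<lambda>T. B0 * bnd T) \<in> O(\<lambda>T. sqrt (real CARD('d) * real T * \<gamma> T) * ln (real T) ^ 1)"
        by (cases "B0 = 0") auto
      then show "(\<lambda>T. B0 * bnd T) \<in> bigo_polylog (\<lambda>T. sqrt (real CARD('d) * real T * info_gain k \<sigma> D T))"
        unfolding bigo_polylog_def \<gamma>_def by blast
    qed
  qed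
qed

end
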